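(* There is an algorithm that, given a $P_5$-free graph $G$ on $n$ vertices, computes the size of a minimum independent odd cycle transversal of $G$ in $O(n^{16})$ time.
   Context: An odd cycle transversal of $G$ is a set $S\subseteq V(G)$ such that $G-S$ is bipartite; it is independent if $S$ is an independent set. $P_5$ is the path on $5$ vertices; $P_5$-free means no induced subgraph isomorphic to $P_5$. *)

theory Defs
  imports Complex_Main "HOL-Library.Landau_Symbols"
begin

section \<open>Graphs\<close>

text \<open>A finite simple graph is a vertex set together with a set of two-element edges.\<close>

definition simple_graph :: "'a set \<Rightarrow> 'a set set \<Rightarrow> bool" where
  "simple_graph V E \<longleftrightarrow> finite V \<and> (\<forall>e\<in>E. e \<subseteq> V \<and> card e = 2)"

definition induced_edges :: "'a set set \<Rightarrow> 'a set \<Rightarrow> 'a set set" where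
  "induced_edges E U = {e \<in> E. e \<subseteq> U}"

definition graph_isomorphic :: "'a set \<Rightarrow> 'a set set \<Rightarrow> 'b set \<Rightarrow> 'b set set \<Rightarrow> bool" where
  "graph_isomorphic V E V' E' \<longleftrightarrow>
     (\<exists>f. bij_betw f V V' \<and> (\<forall>u\<in>V. \<forall>v\<in>V. {u, v} \<in> E \<longleftrightarrow> {f u, f v} \<in> E'))"

definition path_edges :: "nat \<Rightarrow> nat set set" where
  "path_edges k = {{i, Suc i} | i. Suc i < k}"

definition P5_free :: "'a set \<Rightarrow> 'a set set \<Rightarrow> bool" where
  "P5_free V E \<longleftrightarrow>
     \<not> (\<exists>U\<subseteq>V. graph_isomorphic U (induced_edges E U) {..<5} (path_edges 5))"

definition independent_set :: "'a set \<Rightarrow> 'a set set \<Rightarrow> 'a set \<Rightarrow> bool" where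
  "independent_set V E S \<longleftrightarrow> S \<subseteq> V \<and> (\<forall>e\<in>E. \<not> e \<subseteq> S)"

definition bipartite :: "'a set \<Rightarrow> 'a set set \<Rightarrow> bool" where
  "bipartite V E \<longleftrightarrow>
     (\<exists>A B. A \<union> B = V \<and> A \<inter> B = {} \<and> independent_set V E A \<and> independent_set V E B)"

definition odd_cycle_transversal :: "'a set \<Rightarrow> 'a set set \<Rightarrow> 'a set \<Rightarrow> bool" where
  "odd_cycle_transversal V E S \<longleftrightarrow> S \<subseteq> V \<and> bipartite (V - S) (induced_edges E (V - S))"

definition independent_oct :: "'a set \<Rightarrow> 'a set set \<Rightarrow> 'a set \<Rightarrow> bool" where
  "independent_oct V E S \<longleftrightarrow> odd_cycle_transversal V E S \<and> independent_set V E S"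

text \<open>An independent odd cycle transversal need not exist (for example in the complete graph
  on four vertices); this is the case \<open>None\<close>.\<close>

definition min_independent_oct_size :: "'a set \<Rightarrow> 'a set set \<Rightarrow> nat option" where
  "min_independent_oct_size V E =
     (if \<exists>S. independent_oct V E S
      then Some (Min (card ` {S. independent_oct V E S}))
      else None)"


section \<open>Random access machine\<close>

text \<open>Algorithms are programs for a unit-cost random access machine with bounded words, written
  in structured form. A state consists of registers and a memory, both indexed by natural
  numbers; a program mentions finitely many registers and addresses memory indirectly. Every
  word must stay below a bound \<open>W\<close>: a computation in which some value or address reaches
  \<open>W\<close> is stuck. The bound will be polynomial in the number of vertices, that is, words have
  logarithmically many bits, so that unit cost for arithmetic is realistic.\<close>

type_synonym state = "(nat \<Rightarrow> nat) \<times> (nat \<Rightarrow> nat)"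

datatype binop = Add | Sub | Mul | Div | Less | Equal

datatype expr = Const nat | Reg nat | Load expr | Op binop expr expr

datatype prog =
    Skip
  | Assign nat expr
  | Store expr expr
  | Seq prog prog
  | Cond expr prog prog
  | While expr prog

text \<open>Subtraction is truncated at zero, division is rounded down (with \<open>x div 0 = 0\<close>), and
  comparisons yield 1 or 0.\<close>

fun apply_op :: "binop \<Rightarrow> nat \<Rightarrow> nat \<Rightarrow> nat" where
  "apply_op Add x y = x + y"
| "apply_op Sub x y = x - y"
| "apply_op Mul x y = x * y"
| "apply_op Div x y = x div y"
| "apply_op Less x y = (if x < y then 1 else 0)"
| "apply_op Equal x y = (if x = y then 1 else 0)"

fun eval_expr :: "expr \<Rightarrow> state \<Rightarrow> nat" where
  "eval_expr (Const c) s = c"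
| "eval_expr (Reg x) s = fst s x"
| "eval_expr (Load e) s = snd s (eval_expr e s)"
| "eval_expr (Op f e1 e2) s = apply_op f (eval_expr e1 s) (eval_expr e2 s)"

text \<open>All intermediate values of the evaluation, including addresses, are below \<open>W\<close>.\<close>

fun fits :: "nat \<Rightarrow> expr \<Rightarrow> state \<Rightarrow> bool" where
  "fits W (Const c) s \<longleftrightarrow> c < W"
| "fits W (Reg x) s \<longleftrightarrow> fst s x < W"
| "fits W (Load e) s \<longleftrightarrow> fits W e s \<and> eval_expr (Load e) s < W"
| "fits W (Op f e1 e2) s \<longleftrightarrow> fits W e1 s \<and> fits W e2 s \<and> eval_expr (Op f e1 e2) s < W"

fun expr_cost :: "expr \<Rightarrow> nat" where
  "expr_cost (Const c) = 1"
| "expr_cost (Reg x) = 1"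
| "expr_cost (Load e) = expr_cost e + 1"
| "expr_cost (Op f e1 e2) = expr_cost e1 + expr_cost e2 + 1"

text \<open>\<open>exec W p s t s'\<close>: with word bound \<open>W\<close>, the program \<open>p\<close> started in \<open>s\<close> halts in \<open>s'\<close>
  after \<open>t\<close> time steps. Conditions are true iff they are nonzero.\<close>

inductive exec :: "nat \<Rightarrow> prog \<Rightarrow> state \<Rightarrow> nat \<Rightarrow> state \<Rightarrow> bool" for W where
  Skip: "exec W Skip s 1 s"
| Assign: "fits W e s \<Longrightarrow>
    exec W (Assign x e) s (expr_cost e + 1) ((fst s)(x := eval_expr e s), snd s)"
| Store: "fits W a s \<Longrightarrow> fits W e s \<Longrightarrow>
    exec W (Store a e) s (expr_cost a + expr_cost e + 1)
      (fst s, (snd s)(eval_expr a s := eval_expr e s))"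
| Seq: "exec W p s t1 s' \<Longrightarrow> exec W q s' t2 s'' \<Longrightarrow> exec W (Seq p q) s (t1 + t2) s''"
| CondTrue: "fits W e s \<Longrightarrow> eval_expr e s \<noteq> 0 \<Longrightarrow> exec W p s t s' \<Longrightarrow>
    exec W (Cond e p q) s (expr_cost e + 1 + t) s'"
| CondFalse: "fits W e s \<Longrightarrow> eval_expr e s = 0 \<Longrightarrow> exec W q s t s' \<Longrightarrow>
    exec W (Cond e p q) s (expr_cost e + 1 + t) s'"
| WhileFalse: "fits W e s \<Longrightarrow> eval_expr e s = 0 \<Longrightarrow>
    exec W (While e p) s (expr_cost e + 1) s"
| WhileTrue: "fits W e s \<Longrightarrow> eval_expr e s \<noteq> 0 \<Longrightarrow> exec W p s t1 s' \<Longrightarrow>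
    exec W (While e p) s' t2 s'' \<Longrightarrow>
    exec W (While e p) s (expr_cost e + 1 + t1 + t2) s''"

inductive_cases SkipE: "exec W Skip s t s'"
  and AssignE: "exec W (Assign x e) s t s'"
  and StoreE: "exec W (Store a e) s t s'"
  and SeqE: "exec W (Seq p q) s t s'"
  and CondE: "exec W (Cond e p q) s t s'"
  and WhileE: "exec W (While e p) s t s'"

text \<open>Programs are deterministic, so the existence of a halting run determines running time
  and final state.\<close>

lemma exec_deterministic:
  "exec W p s t s' \<Longrightarrow> exec W p s u s'' \<Longrightarrow> u = t \<and> s'' = s'"
proof (induction arbitrary: u s'' rule: exec.induct)
  case (Skip s)
  from Skip.prems show ?case by (rule SkipE) simp
next
  case (Assign e s x)
  from Assign.prems show ?case by (rule AssignE) simp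
next
  case (Store a s e)
  from Store.prems show ?case by (rule StoreE) simp
next
  case (Seq p s t1 s' q t2 s2)
  from Seq.prems show ?case by (rule SeqE) (drule Seq.IH(1), simp, drule Seq.IH(2), simp)
next
  case (CondTrue e s p t s' q)
  from CondTrue.prems show ?case by (rule CondE) (use CondTrue.hyps in \<open>auto dest!: CondTrue.IH\<close>)
next
  case (CondFalse e s q t s' p)
  from CondFalse.prems show ?case by (rule CondE) (use CondFalse.hyps in \<open>auto dest!: CondFalse.IH\<close>)
next
  case (WhileFalse e s p)
  from WhileFalse.prems show ?case by (rule WhileE) (use WhileFalse.hyps in simp_all)
next
  case (WhileTrue e s p t1 s' t2 s2)
  from WhileTrue.prems show ?case by (rule WhileE)
    (use WhileTrue.hyps in simp, drule WhileTrue.IH(1), simp, drule WhileTrue.IH(2), simp)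
qed

text \<open>Input: register 0 holds the number \<open>n\<close> of vertices, and memory cell \<open>i * n + j\<close> holds entry
  \<open>(i, j)\<close> of the adjacency matrix; everything else is 0. Output: register 0 is a flag saying
  whether a solution exists, and if so, register 1 holds the value.\<close>

definition input_state :: "nat \<Rightarrow> nat set set \<Rightarrow> state" where
  "input_state n E =
     ((\<lambda>x. if x = 0 then n else 0),
      (\<lambda>a. if a < n * n \<and> {a div n, a mod n} \<in> E then 1 else 0))"

definition output_of :: "state \<Rightarrow> nat option" where
  "output_of s = (if fst s 0 = 0 then None else Some (fst s 1))"

end

theory Submission
  imports Defs "HOL-Real_Asymp.Real_Asymp"
begin

text \<open>An independent odd cycle transversal is colour class 0 of a proper colouring with colours
  0, 1, 2, so a colouring with fewest vertices of colour 0 is sought, in each component separately.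
  Guess the colours of at most 12 vertices, close the colour lists under two local deletion rules
  (a vertex loses the only colour of a neighbour; two adjacent vertices that both lack colour \<open>k\<close>
  force \<open>k\<close> on every common neighbour), and complete the surviving two-element lists greedily.
  The claim is that some guess leads to an optimum of the component; properness is tested, so
  wrong guesses do no harm.

  Fix an optimal colouring \<open>\<phi>\<close>. A minimum connected dominating set \<open>D\<close> of a 3-colourable connected
  \<open>P\<^sub>5\<close>-free graph has at most three vertices, and guessing it leaves lists of size at most two. Call
  \<open>k\<close> the type of a vertex whose list lacks just \<open>k\<close>. By the second rule a vertex sees at most one
  edge-carrying component of each other type, and two such components that are attached to another
  type through neighbours of the same vertex of \<open>D\<close> produce a \<open>P\<^sub>5\<close>. So one guess for each \<open>d \<in> D\<close> and
  each other type isolates all these components, and each of them may take its cheaper 2-colouring.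
  Among the isolated vertices of type 0 adjacent to some \<open>d \<in> D\<close>, neighbourhoods in the isolated vertices of
  another type are nested, so that guessing a largest one for each of the colours 1 and 2
  leaves every remaining vertex of type 0 a colour that costs nothing. Twelve guesses and
  \<open>O(n\<^sup>4)\<close> steps for closing the lists give \<open>O(n\<^sup>1\<^sup>6)\<close>.\<close>

section \<open>Small dominating sets\<close>

text \<open>Three dominating vertices suffice because private neighbours can be exchanged into a
  minimum connected dominating set: from four vertices on, such a set must be a clique, and a
  3-colourable graph has no clique on four vertices.

  Only colour 0 costs anything. So the lists of types 1 and 2 carry the price, while a type 0 vertex
  matters through its neighbours: its colour \<open>i\<close> forces 0 on a neighbour whose list is
  \<open>{0, i}\<close>. This asymmetry is why isolated vertices of type 0 need guesses of their
  own.

  The combinatorial half never mentions deletion steps. It describes the closed lists as the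
  greatest consistent family below the guess, and the program half shows that propagation computes
  exactly this family. The two halves meet in \<open>cand\<close>.

  Each guess is evaluated on the whole graph, but the cheapest cost is stored per component.
  Different components may therefore owe their optima to different guesses, while the number of
  guesses stays \<open>(3 * n) ^ 12\<close>.\<close>

locale P5_free_adj =
  fixes adj :: "nat \<Rightarrow> nat \<Rightarrow> bool" (infix "\<sim>" 50) and n :: nat
  assumes adj_sym: "u \<sim> v \<Longrightarrow> v \<sim> u"
    and adj_irrefl: "\<not> u \<sim> u"
    and adj_less: "u \<sim> v \<Longrightarrow> u < n"
    and no_P5: "a \<sim> b \<Longrightarrow> b \<sim> c \<Longrightarrow> c \<sim> d \<Longrightarrow> d \<sim> e \<Longrightarrow> \<not> a \<sim> c \<Longrightarrow> \<not> a \<sim> d \<Longrightarrow> \<not> a \<sim> e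
      \<Longrightarrow> \<not> b \<sim> d \<Longrightarrow> \<not> b \<sim> e \<Longrightarrow> \<not> c \<sim> e \<Longrightarrow> False"
begin

text \<open>Stated through cuts, so that no walks are needed.\<close>

definition conn :: "nat set \<Rightarrow> bool" where
  "conn S \<longleftrightarrow> S \<noteq> {} \<and> (\<forall>C. C \<subseteq> S \<longrightarrow> C \<noteq> {} \<longrightarrow> C \<noteq> S \<longrightarrow> (\<exists>u\<in>C. \<exists>v\<in>S - C. u \<sim> v))"

lemma connD: "conn S \<Longrightarrow> C \<subseteq> S \<Longrightarrow> C \<noteq> {} \<Longrightarrow> C \<noteq> S \<Longrightarrow> \<exists>u\<in>C. \<exists>v\<in>S - C. u \<sim> v"
  by (simp add: conn_def)

lemma conn_insert:
  assumes S: "conn S" "x \<in> S" "x \<sim> v"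
  shows "conn (insert v S)"
  unfolding conn_def
proof (intro conjI allI impI)
  fix C assume C: "C \<subseteq> insert v S" "C \<noteq> {}" "C \<noteq> insert v S"
  consider "C \<inter> S = {}" | "S \<subseteq> C" | "C \<inter> S \<noteq> {}" "C \<inter> S \<noteq> S" by blast
  then show "\<exists>u\<in>C. \<exists>w\<in>insert v S - C. u \<sim> w"
  proof cases
    case 1
    then have "v \<in> C" "x \<notin> C" using C S(2) by auto
    then show ?thesis using S adj_sym by blast
  next
    case 2
    then have "x \<in> C" "v \<notin> C" using C S(2) by auto
    then show ?thesis using S by blast
  next
    case 3
    then show ?thesis using connD[OF S(1), of "C \<inter> S"] by blast
  qed
qed simp

lemma conn_star:
  assumes "x \<in> S" "\<And>v. v \<in> S \<Longrightarrow> v \<noteq> x \<Longrightarrow> x \<sim> v"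
  shows "conn S"
  unfolding conn_def
proof (intro conjI allI impI)
  fix C assume C: "C \<subseteq> S" "C \<noteq> {}" "C \<noteq> S"
  show "\<exists>u\<in>C. \<exists>v\<in>S - C. u \<sim> v"
  proof (cases "x \<in> C")
    case True
    then show ?thesis using C assms by (metis DiffI psubsetI psubset_imp_ex_mem DiffE)
  next
    case False
    then show ?thesis using C assms adj_sym by blast
  qed
qed (use assms in auto)

text \<open>A maximal proper connected subset containing the closed neighbourhood of \<open>x\<close> omits just one vertex.\<close>

lemma ex_noncut:
  assumes D: "conn D" "finite D" and x: "x \<in> D" "w \<in> D" "w \<noteq> x" "\<not> x \<sim> w"
  shows "\<exists>y\<in>D. y \<noteq> x \<and> \<not> x \<sim> y \<and> conn (D - {y})"
proof -
  define N where "N = {v \<in> D. v = x \<or> x \<sim> v}"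
  define F where "F = {C. C \<subseteq> D \<and> C \<noteq> D \<and> N \<subseteq> C \<and> conn C}"
  have "conn N" by (rule conn_star[of x]) (use x in \<open>auto simp: N_def\<close>)
  moreover have "w \<notin> N" "N \<subseteq> D" using x by (auto simp: N_def)
  ultimately have "N \<in> F" using x by (auto simp: F_def)
  moreover have "finite F" by (rule finite_subset[of _ "Pow D"]) (auto simp: F_def D)
  ultimately obtain C where C: "C \<in> F" and max: "\<And>B. B \<in> F \<Longrightarrow> C \<subseteq> B \<Longrightarrow> C = B"
    using finite_has_maximal[of F] by blast
  have C': "C \<subseteq> D" "C \<noteq> D" "N \<subseteq> C" "conn C" using C by (auto simp: F_def)
  have "C \<noteq> {}" using C'(4) by (simp add: conn_def)
  then obtain u y where uy: "u \<in> C" "y \<in> D - C" "u \<sim> y" using connD[OF D(1), of C] C' by auto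
  have "conn (insert y C)" using conn_insert C'(4) uy by blast
  then have "insert y C = D" using max[of "insert y C"] uy C' by (auto simp: F_def)
  then have "D - {y} = C" using uy by auto
  then show ?thesis using uy C' by (auto simp: N_def)
qed

definition cds :: "nat set \<Rightarrow> nat set \<Rightarrow> bool" where
  "cds X D \<longleftrightarrow> D \<subseteq> X \<and> conn D \<and> (\<forall>v\<in>X - D. \<exists>d\<in>D. d \<sim> v)"

definition min_cds :: "nat set \<Rightarrow> nat set \<Rightarrow> bool" where
  "min_cds X D \<longleftrightarrow> cds X D \<and> (\<forall>D'. cds X D' \<longrightarrow> card D \<le> card D')"

context
  fixes X :: "nat set"
  assumes fin: "finite X"
begin

lemma min_cds_finite: "min_cds X D \<Longrightarrow> finite D"
  using fin by (auto simp: min_cds_def cds_def intro: finite_subset)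

text \<open>By minimality the connected set \<open>D - {x}\<close> fails to dominate some
  \<open>v\<close>. Connectedness of \<open>D\<close> gives \<open>x\<close> a neighbour in
  \<open>D - {x}\<close>, so \<open>v\<close> is not \<open>x\<close> but a vertex outside
  \<open>D\<close> that only \<open>x\<close> sees.\<close>

lemma ex_private:
  assumes D: "min_cds X D" and x: "x \<in> D" "conn (D - {x})"
  shows "\<exists>x'\<in>X - D. x \<sim> x' \<and> (\<forall>d\<in>D. d \<sim> x' \<longrightarrow> d = x)"
proof -
  have c: "cds X D" using D by (simp add: min_cds_def)
  have "card (D - {x}) < card D" using min_cds_finite[OF D] x(1) by (rule card_Diff1_less)
  then have "\<not> cds X (D - {x})" using D unfolding min_cds_def by (meson not_le)
  then obtain v where v: "v \<in> X - (D - {x})" "\<And>d. d \<in> D - {x} \<Longrightarrow> \<not> d \<sim> v"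
    using x c unfolding cds_def by blast
  have "D \<noteq> {x}" using x by (auto simp: conn_def)
  then obtain w where "w \<in> D - {x}" "x \<sim> w"
    using connD[of D "{x}"] c x by (auto simp: cds_def)
  then have "v \<noteq> x" using v(2) adj_sym by blast
  then have "v \<in> X - D" using v by auto
  moreover obtain d where "d \<in> D" "d \<sim> v" using c \<open>v \<in> X - D\<close> by (auto simp: cds_def)
  ultimately show ?thesis using v(2) by blast
qed

text \<open>First, \<open>x\<close> and \<open>y\<close> have a common neighbour \<open>z\<close> in
  \<open>D\<close>: otherwise the vertices of \<open>D\<close> within distance two of
  \<open>x\<close> miss \<open>y\<close>, and an edge \<open>b\<close>, \<open>e\<close> leaving
  them completes an induced path \<open>x', x, a, b, e\<close>. Then \<open>x'\<close> takes over
  every \<open>v\<close> that only \<open>y\<close> dominated, since otherwise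
  \<open>x', x, z, y, v\<close> is an induced P5.\<close>

lemma min_cds_swap:
  assumes D: "min_cds X D" and x: "x \<in> D" "conn (D - {x})" and y: "y \<in> D" "conn (D - {y})"
    and xy: "x \<noteq> y" "\<not> x \<sim> y"
    and x': "x' \<in> X - D" "x \<sim> x'" "\<And>d. d \<in> D \<Longrightarrow> d \<sim> x' \<Longrightarrow> d = x"
  shows "min_cds X (insert x' (D - {y}))"
proof -
  have c: "cds X D" and cD: "conn D" using D by (simp_all add: min_cds_def cds_def)
  have "\<exists>z\<in>D. x \<sim> z \<and> z \<sim> y"
  proof (rule ccontr)
    assume no: "\<not> ?thesis"
    define N1 where "N1 = {z \<in> D. x \<sim> z}"
    define N2 where "N2 = {z \<in> D. \<exists>a\<in>N1. a \<sim> z}"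
    define C where "C = insert x (N1 \<union> N2)"
    have "y \<notin> C" using no xy by (auto simp: C_def N1_def N2_def)
    moreover have "C \<subseteq> D" using x by (auto simp: C_def N1_def N2_def)
    ultimately obtain b e where be: "b \<in> C" "e \<in> D - C" "b \<sim> e"
      using connD[OF cD, of C] y unfolding C_def by blast
    then have "b \<in> N2" "b \<noteq> x" "b \<notin> N1" by (auto simp: C_def N1_def N2_def)
    then obtain a where a: "a \<in> N1" "a \<sim> b" by (auto simp: N2_def)
    have "\<not> x \<sim> b" "\<not> x \<sim> e" "\<not> a \<sim> e" "x \<sim> a" "a \<in> D" "b \<in> D" "e \<in> D" "e \<noteq> x" "a \<noteq> x"
      using a be \<open>b \<notin> N1\<close> \<open>b \<in> N2\<close> adj_irrefl by (auto simp: C_def N1_def N2_def)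
    moreover have "\<not> x' \<sim> a" "\<not> x' \<sim> b" "\<not> x' \<sim> e"
      using x'(3) adj_sym calculation \<open>b \<noteq> x\<close> by blast+
    ultimately show False using no_P5[of x' x a b e] x' a be adj_sym by blast
  qed
  then obtain z where z: "z \<in> D" "x \<sim> z" "z \<sim> y" by blast
  have zx: "z \<noteq> x" "z \<noteq> y" using z adj_irrefl by auto
  have pr: "v \<sim> x'" if v: "v \<in> X - D" "\<And>d. d \<in> D - {y} \<Longrightarrow> \<not> d \<sim> v" for v
  proof (rule ccontr)
    assume a: "\<not> v \<sim> x'"
    have "y \<sim> v" using v c by (fastforce simp: cds_def)
    then show False
      using no_P5[of x' x z y v] z zx x' xy v(2)[of x] v(2)[of z] x a y x'(3)[of z] x'(3)[of y] adj_sym by blast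
  qed
  have "conn (insert x' (D - {y}))" using conn_insert[OF y(2), of x x'] x(1) x'(2) xy(1) by simp
  moreover have "\<exists>d\<in>insert x' (D - {y}). d \<sim> v" if v: "v \<in> X - insert x' (D - {y})" for v
  proof (cases "v = y")
    case True then show ?thesis using z zx by blast
  next
    case False then show ?thesis using pr[of v] v adj_sym by blast
  qed
  ultimately have "cds X (insert x' (D - {y}))" using c x'(1) unfolding cds_def by blast
  moreover have "card (insert x' (D - {y})) = card D"
    using x'(1) y(1) min_cds_finite[OF D] card_Suc_Diff1[of D y] by simp
  ultimately show ?thesis using D by (simp add: min_cds_def)
qed

text \<open>Here \<open>p\<close> is a leaf of \<open>D\<close> hanging on \<open>x\<close>. If
  \<open>x\<close> missed a vertex of \<open>D\<close>, an edge \<open>a\<close>, \<open>b\<close>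
  would leave its closed neighbourhood in \<open>D - {p}\<close>, and with a private neighbour
  \<open>p'\<close> of \<open>p\<close> the path \<open>p', p, x, a, b\<close> would be
  induced.\<close>

lemma min_cds_pendant:
  assumes D: "min_cds X D" and p: "p \<in> D" "conn (D - {p})" "x \<in> D" "p \<sim> x"
    and only: "\<And>d. d \<in> D \<Longrightarrow> p \<sim> d \<Longrightarrow> d = x"
    and w: "w \<in> D" "w \<noteq> p" "w \<noteq> x"
  shows "x \<sim> w"
proof (rule ccontr)
  assume xw: "\<not> x \<sim> w"
  obtain p' where p': "p' \<in> X - D" "p \<sim> p'" "\<forall>d\<in>D. d \<sim> p' \<longrightarrow> d = p"
    using ex_private[OF D p(1,2)] by blast
  define C where "C = {v \<in> D - {p}. v = x \<or> x \<sim> v}"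
  have px: "p \<noteq> x" using p adj_irrefl by auto
  have "w \<notin> C" "C \<subseteq> D - {p}" "x \<in> C" using xw w px p by (auto simp: C_def)
  then obtain a b where ab: "a \<in> C" "b \<in> D - {p} - C" "a \<sim> b"
    using connD[OF p(2), of C] w by blast
  then have "a \<noteq> x" "x \<sim> a" "\<not> x \<sim> b" "b \<noteq> x" "a \<in> D" "a \<noteq> p" by (auto simp: C_def)
  moreover have "\<not> p \<sim> a" "\<not> p \<sim> b" using only[of a] only[of b] ab calculation by auto
  moreover have "\<not> p' \<sim> x" "\<not> p' \<sim> a" "\<not> p' \<sim> b" using p' adj_sym ab calculation p px by blast+
  ultimately show False using no_P5[of p' p x a b] ab p' p adj_sym by blast
qed

text \<open>From a nonadjacent pair of removable vertices, swapping in the private neighbour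
  \<open>x'\<close> of \<open>x\<close> makes \<open>x'\<close> a leaf at \<open>x\<close>, so
  \<open>x\<close> sees all of the new set. Swapping once more, now \<open>w\<close> against a
  private neighbour of \<open>x'\<close>, makes \<open>x'\<close> a centre as well, although
  \<open>x\<close> was its only neighbour.\<close>

lemma min_cds_clique_or_small:
  assumes D: "min_cds X D" and big: "card D \<ge> 4" and u: "u \<in> D" "v \<in> D" "u \<noteq> v"
  shows "u \<sim> v"
proof (rule ccontr)
  assume uv: "\<not> u \<sim> v"
  have cD: "conn D" and fD: "finite D" using D min_cds_finite[OF D] by (simp_all add: min_cds_def cds_def)
  obtain y where y: "y \<in> D" "y \<noteq> u" "\<not> u \<sim> y" "conn (D - {y})"
    using ex_noncut[OF cD fD, of u v] u uv by blast
  obtain x where x: "x \<in> D" "x \<noteq> y" "\<not> y \<sim> x" "conn (D - {x})"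
    using ex_noncut[OF cD fD, of y u] u y adj_sym by blast
  obtain x' where x': "x' \<in> X - D" "x \<sim> x'" "\<And>d. d \<in> D \<Longrightarrow> d \<sim> x' \<Longrightarrow> d = x"
    using ex_private[OF D x(1,4)] by blast
  define D' where "D' = insert x' (D - {y})"
  have D': "min_cds X D'"
    unfolding D'_def by (rule min_cds_swap[OF D x(1,4) y(1,4)]) (use x x' adj_sym in blast)+
  have pend: "\<And>d. d \<in> D' \<Longrightarrow> x' \<sim> d \<Longrightarrow> d = x"
    using x'(3) adj_sym adj_irrefl unfolding D'_def by blast
  have cDx: "conn (D' - {x'})" using x'(1) y(4) by (simp add: D'_def Diff_insert_absorb)
  have xD: "x \<in> D'" "x' \<in> D'" "x \<noteq> x'" using x x'(1) by (auto simp: D'_def)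
  have xall: "x \<sim> w" if "w \<in> D'" "w \<noteq> x" for w
    using min_cds_pendant[OF D' xD(2) cDx xD(1) _ pend] that x'(2) adj_sym by blast
  have "card D' = card D"
    using D D' unfolding min_cds_def by (meson le_antisym)
  \<comment> \<open>This is where four vertices are needed: one vertex is swapped out, and a second
    one must remain to contradict that \<open>x'\<close> is a leaf.\<close>
  then have "\<not> card (D' - {x, x'}) \<le> Suc 0" using big xD min_cds_finite[OF D'] by (simp add: card_Diff_subset)
  then obtain w w2 where w: "w \<in> D' - {x, x'}" "w2 \<in> D' - {x, x'}" "w \<noteq> w2"
    unfolding card_le_Suc0_iff_eq[OF finite_Diff[OF min_cds_finite[OF D']]] by blast
  have cw: "conn (D' - {w})" by (rule conn_star[of x]) (use xall xD w in auto)
  obtain x'' where x'': "x'' \<in> X - D'" "x' \<sim> x''" "\<And>d. d \<in> D' \<Longrightarrow> d \<sim> x'' \<Longrightarrow> d = x'"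
    using ex_private[OF D' xD(2) cDx] by blast
  define D'' where "D'' = insert x'' (D' - {w})"
  have D'': "min_cds X D''"
    unfolding D''_def by (rule min_cds_swap[OF D' xD(2) cDx _ cw]) (use w x'' pend in blast)+
  have "x' \<sim> w2"
  proof (rule min_cds_pendant[OF D'', of x''])
    show "conn (D'' - {x''})" using x''(1) cw by (simp add: D''_def)
    show "\<And>d. d \<in> D'' \<Longrightarrow> x'' \<sim> d \<Longrightarrow> d = x'" using x''(3) adj_sym adj_irrefl unfolding D''_def by blast
  qed (use x''(1,2) xD w adj_sym in \<open>auto simp: D''_def\<close>)
  then show False using pend w by blast
qed

text \<open>A minimum connected dominating set with four or more vertices would be a clique, on
  which \<open>\<phi>\<close> would be injective into three colours.\<close>

lemma ex_small_dominating:
  fixes \<phi> :: "nat \<Rightarrow> nat"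
  assumes X: "conn X" and \<phi>: "\<And>v. v \<in> X \<Longrightarrow> \<phi> v < 3"
    "\<And>u v. u \<in> X \<Longrightarrow> v \<in> X \<Longrightarrow> u \<sim> v \<Longrightarrow> \<phi> u \<noteq> \<phi> v"
  shows "\<exists>D. D \<subseteq> X \<and> D \<noteq> {} \<and> card D \<le> 3 \<and> (\<forall>v\<in>X - D. \<exists>d\<in>D. d \<sim> v)"
proof -
  have "cds X X" using X by (simp add: cds_def)
  then obtain D where D: "min_cds X D"
    using ex_has_least_nat[of "cds X" X card] by (auto simp: min_cds_def)
  then have DX: "D \<subseteq> X" "D \<noteq> {}" "\<forall>v\<in>X - D. \<exists>d\<in>D. d \<sim> v" by (auto simp: min_cds_def cds_def conn_def)
  have "card D \<le> 3"
  proof (rule ccontr)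
    assume "\<not> card D \<le> 3"
    then have "inj_on \<phi> D" using min_cds_clique_or_small[OF D] \<phi>(2) DX
      by (intro inj_onI) (metis (full_types) not_less_eq_eq Suc_numeral semiring_norm(8) semiring_norm(2) semiring_norm(5) subsetD)
    then have "card D = card (\<phi> ` D)" by (simp add: card_image)
    also have "\<dots> \<le> card {..<3::nat}" using \<phi>(1) DX by (intro card_mono) auto
    finally show False using \<open>\<not> card D \<le> 3\<close> by simp
  qed
  then show ?thesis using DX by blast
qed

end

section \<open>Colour lists\<close>

text \<open>An empty list satisfies the premise of the first rule for every \<open>j\<close>, so
  emptiness spreads to the neighbours. The second rule is sound because two adjacent vertices
  lacking \<open>k\<close> use up both other colours.\<close>

definition consistent :: "(nat \<Rightarrow> nat set) \<Rightarrow> bool" where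
  "consistent L \<longleftrightarrow> (\<forall>u v j. u \<sim> v \<longrightarrow> L u \<subseteq> {j} \<longrightarrow> j \<notin> L v) \<and>
     (\<forall>u w y j k. u \<sim> w \<longrightarrow> u \<sim> y \<longrightarrow> w \<sim> y \<longrightarrow> k < 3 \<longrightarrow> k \<notin> L u \<longrightarrow> k \<notin> L w \<longrightarrow> j \<noteq> k \<longrightarrow> j \<notin> L y)"

lemma consistent_edge: "consistent L \<Longrightarrow> u \<sim> v \<Longrightarrow> L u \<subseteq> {j} \<Longrightarrow> j \<notin> L v"
  unfolding consistent_def by blast

lemma consistent_triangle:
  "consistent L \<Longrightarrow> u \<sim> w \<Longrightarrow> u \<sim> y \<Longrightarrow> w \<sim> y \<Longrightarrow> k < 3 \<Longrightarrow> k \<notin> L u \<Longrightarrow> k \<notin> L w \<Longrightarrow> j \<noteq> k \<Longrightarrow> j \<notin> L y"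
  unfolding consistent_def by blast

definition guess :: "nat set \<Rightarrow> (nat \<Rightarrow> nat) \<Rightarrow> nat \<Rightarrow> nat set" where
  "guess \<Gamma> \<phi> v = (if v \<in> \<Gamma> then {\<phi> v} else {..<3})"

text \<open>Characterised as a greatest element, the result is independent of the order of
  deletions.\<close>

definition is_closure :: "(nat \<Rightarrow> nat set) \<Rightarrow> (nat \<Rightarrow> nat set) \<Rightarrow> bool" where
  "is_closure I L \<longleftrightarrow> consistent L \<and> L \<le> I \<and> (\<forall>M. consistent M \<longrightarrow> M \<le> I \<longrightarrow> M \<le> L)"

text \<open>The union of consistent families is consistent: if a rule applies to the union, it
  applies to each of the smaller families, none of which then contains the deleted colour.\<close>

lemma ex_closure: "\<exists>L. is_closure I L"
proof -
  define L where "L v = \<Union>{M v | M. consistent M \<and> M \<le> I}" for v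
  have le: "M v \<subseteq> L v" if "consistent M" "M \<le> I" for M v using that unfolding L_def by blast
  have ex: "\<exists>M. consistent M \<and> M \<le> I \<and> j \<in> M v" if "j \<in> L v" for j v using that unfolding L_def by blast
  have "consistent L"
    unfolding consistent_def
  proof (intro conjI allI impI notI)
    fix u v j assume a: "u \<sim> v" "L u \<subseteq> {j}" "j \<in> L v"
    from ex[OF a(3)] obtain M where M: "consistent M" "M \<le> I" "j \<in> M v" by blast
    have "M u \<subseteq> {j}" using le[OF M(1,2), of u] a(2) by blast
    then show False using consistent_edge[OF M(1) a(1)] M(3) by blast
  next
    fix u w y j k assume a: "u \<sim> w" "u \<sim> y" "w \<sim> y" "k < (3::nat)" "k \<notin> L u" "k \<notin> L w" "j \<noteq> k" "j \<in> L y"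
    from ex[OF a(8)] obtain M where M: "consistent M" "M \<le> I" "j \<in> M y" by blast
    show False
      using consistent_triangle[OF M(1) a(1-4) _ _ a(7)] le[OF M(1,2)] a(5,6) M(3) by blast
  qed
  moreover have "L \<le> I" unfolding le_fun_def L_def by blast
  moreover have "\<forall>M. consistent M \<longrightarrow> M \<le> I \<longrightarrow> M \<le> L" using le by (simp add: le_fun_def)
  ultimately show ?thesis unfolding is_closure_def by blast
qed

text \<open>The two sides of a component of vertices with equal lists: in a \<open>P\<^sub>5\<close>-free bipartite graph every
  vertex of the own side is reached by a walk of length two. The key compares the sides by size,
  and ties by the largest vertex. The second part of the flag serves isolated vertices with list
  \<open>{1, 2}\<close>: they take colour 2 unless a neighbour with list \<open>{0, 2}\<close> will take it.\<close>

definition own :: "(nat \<Rightarrow> nat set) \<Rightarrow> nat \<Rightarrow> nat set" where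
  "own L v = {x. L x = L v \<and> (\<exists>u. L u = L v \<and> v \<sim> u \<and> u \<sim> x)}"

definition key :: "(nat \<Rightarrow> nat set) \<Rightarrow> nat \<Rightarrow> nat" where
  "key L v = (if own L v = {} then 0 else card (own L v) * n + Max (own L v))"

definition flag :: "(nat \<Rightarrow> nat set) \<Rightarrow> nat \<Rightarrow> bool" where
  "flag L v \<longleftrightarrow> (\<exists>u. v \<sim> u \<and> (L u = L v \<and> key L v < key L u \<or> L v = {1, 2} \<and> L u = {0, 2}))"

text \<open>On a two-element list \<open>lo\<close> and \<open>hi\<close> are its two colours. The
  defaults keep both below 3 even on an empty list, so that every guess yields a candidate with
  colours below 3.\<close>

definition lo :: "nat set \<Rightarrow> nat" where
  "lo S = (if 0 \<in> S then 0 else if 1 \<in> S then 1 else 2)"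

definition hi :: "nat set \<Rightarrow> nat" where
  "hi S = (if 2 \<in> S then 2 else if 1 \<in> S then 1 else 0)"

definition col :: "(nat \<Rightarrow> nat set) \<Rightarrow> nat \<Rightarrow> nat" where
  "col L v = (if flag L v then lo (L v) else hi (L v))"

definition proper_on :: "nat set \<Rightarrow> (nat \<Rightarrow> nat) \<Rightarrow> bool" where
  "proper_on X c \<longleftrightarrow> (\<forall>v\<in>X. c v < 3) \<and> (\<forall>u\<in>X. \<forall>v\<in>X. u \<sim> v \<longrightarrow> c u \<noteq> c v)"

end

section \<open>Vertex types in one component with a fixed proper colouring\<close>

locale coloured_component = P5_free_adj +
  fixes X D :: "nat set" and \<phi> :: "nat \<Rightarrow> nat" and L0 :: "nat \<Rightarrow> nat set"
  assumes finX: "finite X"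
    and closed: "u \<in> X \<Longrightarrow> u \<sim> v \<Longrightarrow> v \<in> X"
    and proper: "proper_on X \<phi>"
    and DX: "D \<subseteq> X" and D_ne: "D \<noteq> {}" and cardD: "card D \<le> 3"
    and dom: "v \<in> X - D \<Longrightarrow> \<exists>d\<in>D. d \<sim> v"
    and L0: "is_closure (guess D \<phi>) L0"
begin

lemma phi_less: "v \<in> X \<Longrightarrow> \<phi> v < 3" using proper by (simp add: proper_on_def)
lemma phi_edge: "u \<in> X \<Longrightarrow> u \<sim> v \<Longrightarrow> \<phi> u \<noteq> \<phi> v" using proper closed unfolding proper_on_def by blast

lemma finD: "finite D" using DX finX by (rule finite_subset)

text \<open>No edge leaves \<open>X\<close>. Inside, a proper colouring with three colours obeys
  both rules; outside, full lists trigger neither.\<close>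

lemma phi_consistent: "consistent (\<lambda>v. if v \<in> X then {\<phi> v} else {..<3})"
  (is "consistent ?M")
  unfolding consistent_def
proof (intro conjI allI impI)
  fix u v j assume a: "u \<sim> v" "?M u \<subseteq> {j}"
  have "\<not> {..<3} \<subseteq> {j}"
  proof
    assume "{..<3} \<subseteq> {j}"
    then have "card {..<3::nat} \<le> card {j}" by (rule card_mono[rotated]) simp
    then show False by simp
  qed
  then have "u \<in> X" "j = \<phi> u" using a by (auto split: if_splits)
  then show "j \<notin> ?M v" using closed[OF _ a(1)] phi_edge[OF _ a(1)] by simp
next
  fix u w y j k assume a: "u \<sim> w" "u \<sim> y" "w \<sim> y" "k < (3::nat)" "k \<notin> ?M u" "k \<notin> ?M w" "j \<noteq> k"
  have X: "u \<in> X" "w \<in> X" "y \<in> X" using a closed by (auto split: if_splits)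
  then have "\<phi> u \<noteq> k" "\<phi> w \<noteq> k" using a by auto
  moreover have "\<phi> u \<noteq> \<phi> w" "\<phi> u \<noteq> \<phi> y" "\<phi> w \<noteq> \<phi> y" using a phi_edge X by auto
  moreover have "\<phi> u < 3" "\<phi> w < 3" "\<phi> y < 3" using phi_less X by auto
  ultimately have "\<phi> y = k" using a(4) by linarith
  then show "j \<notin> ?M y" using X a by simp
qed

text \<open>Seen as a family of one-element lists on \<open>X\<close>, \<open>\<phi>\<close> is
  consistent and below the guess, hence below its closure: a correct guess never loses a true
  colour.\<close>

lemma phi_in_closure:
  assumes L: "is_closure (guess \<Gamma> \<phi>) L" and "\<Gamma> \<subseteq> X" "v \<in> X"
  shows "\<phi> v \<in> L v"
proof -
  have "(\<lambda>v. if v \<in> X then {\<phi> v} else {..<3}) \<le> guess \<Gamma> \<phi>"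
    using assms(2) phi_less by (auto simp: le_fun_def guess_def)
  then have "(\<lambda>v. if v \<in> X then {\<phi> v} else {..<3}) \<le> L"
    using L phi_consistent by (auto simp: is_closure_def)
  then show ?thesis using assms(3) by (auto dest: le_funD[of _ _ v])
qed

text \<open>\<open>T k\<close> consists of the vertices of type \<open>k\<close> after the colours of \<open>D\<close> have been guessed.\<close>

definition T :: "nat \<Rightarrow> nat set" where
  "T k = {v \<in> X. L0 v = {..<3} - {k}}"

lemma two_elements: "k < 3 \<Longrightarrow> \<exists>i j. i \<noteq> j \<and> {..<3} - {k} = {i, j::nat}"
proof -
  assume "k < 3"
  then have "card ({..<3} - {k}) = 2" by simp
  then show ?thesis by (auto simp: card_2_iff)
qed

lemma T_X: "v \<in> T k \<Longrightarrow> v \<in> X" by (simp add: T_def)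
lemma T_L0: "v \<in> T k \<Longrightarrow> L0 v = {..<3} - {k}" by (simp add: T_def)

lemma L0_consistent: "consistent L0" and L0_le: "L0 v \<subseteq> guess D \<phi> v"
  using L0 by (auto simp: is_closure_def le_fun_def)

lemma L0_three: "v \<in> X \<Longrightarrow> L0 v \<subseteq> {..<3}"
  using L0_le[of v] phi_less[of v] by (auto simp: guess_def split: if_splits)

lemma L0_dom: "v \<in> X - D \<Longrightarrow> d \<in> D \<Longrightarrow> d \<sim> v \<Longrightarrow> \<phi> d \<notin> L0 v"
  using consistent_edge[OF L0_consistent, of d v "\<phi> d"] L0_le[of d] by (auto simp: guess_def)

lemma T_notin_D: assumes "v \<in> T k" "k < 3" shows "v \<notin> D"
proof
  assume "v \<in> D"
  then have "{..<3} - {k} \<subseteq> {\<phi> v}" using L0_le[of v] T_L0[OF assms(1)] by (simp add: guess_def)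
  then show False using two_elements[OF assms(2)] by auto
qed

text \<open>A neighbour in \<open>D\<close> strikes its own colour from the list, and
  \<open>k\<close> is the only colour missing there.\<close>

lemma T_D: assumes "v \<in> T k" "k < 3" "d \<in> D" "d \<sim> v" shows "\<phi> d = k"
  using L0_dom[of v d] T_notin_D[OF assms(1,2)] T_X[OF assms(1)] T_L0[OF assms(1)] assms phi_less[of d] DX by auto

lemma T_dom: assumes "v \<in> T k" "k < 3" obtains d where "d \<in> D" "d \<sim> v" "\<phi> d = k"
  using dom[of v] T_notin_D[OF assms] T_X[OF assms(1)] T_D[OF assms] by blast

lemma T_disjoint: "v \<in> T k \<Longrightarrow> v \<in> T l \<Longrightarrow> k < 3 \<Longrightarrow> l < 3 \<Longrightarrow> k = l"
  using T_L0[of v k] T_L0[of v l] by blast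

text \<open>This is what the second deletion rule is for: an edge inside type \<open>k\<close> would
  force \<open>k\<close> on \<open>y\<close>, but the list of \<open>y\<close> still holds a colour
  other than \<open>k\<close>.\<close>

lemma T_no_triangle:
  assumes "u \<in> T k" "w \<in> T k" "u \<sim> w" "y \<in> T l" "l \<noteq> k" "u \<sim> y" "k < 3" "l < 3"
  shows "\<not> w \<sim> y"
proof
  assume wy: "w \<sim> y"
  obtain j where j: "j \<in> {..<3} - {l}" "j \<noteq> k"
    using two_elements[OF assms(8)] by (metis insertCI)
  have "j \<notin> L0 y"
    by (rule consistent_triangle[OF L0_consistent assms(3,6) wy assms(7) _ _ j(2)])
      (use T_L0 assms in auto)
  then show False using j(1) T_L0[OF assms(4)] by simp
qed

definition R :: "nat \<Rightarrow> (nat \<times> nat) set" where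
  "R k = {(a, b). a \<in> T k \<and> b \<in> T k \<and> a \<sim> b}"

lemma R_sym: "(a, b) \<in> (R k)\<^sup>* \<Longrightarrow> (b, a) \<in> (R k)\<^sup>*"
proof -
  have "sym (R k)" by (rule symI) (auto simp: R_def adj_sym)
  then show "(a, b) \<in> (R k)\<^sup>* \<Longrightarrow> (b, a) \<in> (R k)\<^sup>*" by (metis sym_rtrancl symD)
qed

lemma R_no_edges:
  assumes "(u, u') \<notin> (R k)\<^sup>*" "(u, a) \<in> (R k)\<^sup>*" "(u', b) \<in> (R k)\<^sup>*" "a \<in> T k" "b \<in> T k"
  shows "\<not> a \<sim> b" "\<not> b \<sim> a"
proof -
  have "\<not> a \<sim> b"
  proof
    assume "a \<sim> b"
    then have "(a, b) \<in> (R k)\<^sup>*" using assms(4,5) by (intro r_into_rtrancl) (simp add: R_def)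
    then show False using assms R_sym by (meson rtrancl_trans)
  qed
  then show "\<not> a \<sim> b" "\<not> b \<sim> a" using adj_sym by blast+
qed

lemma R_edge: "a \<in> T k \<Longrightarrow> b \<in> T k \<Longrightarrow> a \<sim> b \<Longrightarrow> (a, b) \<in> (R k)\<^sup>*"
  by (rule r_into_rtrancl) (simp add: R_def)

text \<open>Otherwise \<open>u2, u, y, u', u2'\<close> is an induced P5: there are no edges between
  different components, and \<open>T_no_triangle\<close> keeps \<open>u2\<close> and
  \<open>u2'\<close> away from \<open>y\<close>.\<close>

lemma mixed_on_one_component:
  assumes y: "y \<in> T l" "l \<noteq> k" "k < 3" "l < 3"
    and u: "u \<in> T k" "u2 \<in> T k" "u \<sim> u2" "u' \<in> T k" "u2' \<in> T k" "u' \<sim> u2'" "u \<sim> y" "u' \<sim> y"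
  shows "(u, u') \<in> (R k)\<^sup>*"
proof (rule ccontr)
  assume no: "(u, u') \<notin> (R k)\<^sup>*"
  have ne: "\<not> u2 \<sim> y" "\<not> u2' \<sim> y" using T_no_triangle y u by blast+
  have e: "(u, u2) \<in> (R k)\<^sup>*" "(u', u2') \<in> (R k)\<^sup>*" using R_edge u by auto
  have "\<not> u2 \<sim> u'" "\<not> u2 \<sim> u2'" "\<not> u \<sim> u'" "\<not> u \<sim> u2'"
    using R_no_edges[OF no] e u by blast+
  then show False using no_P5[of u2 u y u' u2'] ne u adj_sym by blast
qed

text \<open>Guessing a single vertex of this set decides its whole component of
  \<open>T (\<phi> d)\<close>, and by \<open>linked_one_component\<close> all of the set lies in
  that component.\<close>

definition linked :: "nat \<Rightarrow> nat \<Rightarrow> nat set" where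
  "linked d l = {u \<in> T (\<phi> d). d \<sim> u \<and> (\<exists>u2\<in>T (\<phi> d). u \<sim> u2) \<and> (\<exists>y\<in>T l. u \<sim> y)}"

text \<open>Let \<open>u\<close> and \<open>u'\<close> lie in different components and be attached
  to \<open>y\<close> and \<open>y'\<close> of type \<open>l\<close>. Each of \<open>y\<close>,
  \<open>y'\<close> sees only one of the components. If \<open>y\<close> and \<open>y'\<close> are
  adjacent, \<open>u2, u, y, y', u'\<close> is an induced P5, and otherwise
  \<open>y, u, d, u', y'\<close> is.\<close>

lemma linked_one_component:
  assumes d: "d \<in> D" and l: "l < 3" "l \<noteq> \<phi> d" and uu: "u \<in> linked d l" "u' \<in> linked d l"
  shows "(u, u') \<in> (R (\<phi> d))\<^sup>*"
proof (rule ccontr)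
  assume no: "(u, u') \<notin> (R (\<phi> d))\<^sup>*"
  have k: "\<phi> d < 3" using phi_less d DX by blast
  obtain u2 y where u: "u \<in> T (\<phi> d)" "d \<sim> u" "u2 \<in> T (\<phi> d)" "u \<sim> u2" "y \<in> T l" "u \<sim> y"
    using uu(1) by (auto simp: linked_def)
  obtain u2' y' where u': "u' \<in> T (\<phi> d)" "d \<sim> u'" "u2' \<in> T (\<phi> d)" "u' \<sim> u2'" "y' \<in> T l" "u' \<sim> y'"
    using uu(2) by (auto simp: linked_def)
  have e: "(u, u2) \<in> (R (\<phi> d))\<^sup>*" "(u', u2') \<in> (R (\<phi> d))\<^sup>*" using R_edge u u' by auto
  have ne: "\<not> u \<sim> u'" "\<not> u2 \<sim> u'" using R_no_edges[OF no] e u u' by blast+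
  have y: "\<not> d \<sim> y" "\<not> d \<sim> y'" using T_D[of _ l d] l d u u' by auto
  have c1: "\<not> u' \<sim> y"
    using mixed_on_one_component[of y l "\<phi> d" u u2 u' u2'] u u' l k no by blast
  have c2: "\<not> u \<sim> y'"
    using mixed_on_one_component[of y' l "\<phi> d" u u2 u' u2'] u u' l k no by blast
  have c3: "\<not> u2 \<sim> y'"
  proof
    assume "u2 \<sim> y'"
    then have "(u2, u') \<in> (R (\<phi> d))\<^sup>*"
      using mixed_on_one_component[of y' l "\<phi> d" u2 u u' u2'] u u' l k adj_sym by blast
    then show False using e no by (meson rtrancl_trans)
  qed
  have c4: "\<not> u2 \<sim> y" using T_no_triangle u l k by blast
  show False
  proof (cases "y \<sim> y'")
    case True
    then show False using no_P5[of u2 u y y' u'] u u' ne c1 c2 c3 c4 adj_sym by blast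
  next
    case False
    then show False using no_P5[of y u d u' y'] u u' ne y c1 c2 adj_sym by blast
  qed
qed

definition triv :: "nat \<Rightarrow> nat set" where
  "triv k = {v \<in> T k. \<forall>v'\<in>T k. \<not> v \<sim> v'}"

definition loners :: "nat \<Rightarrow> nat \<Rightarrow> nat set" where
  "loners d i = {c \<in> triv 0. d \<sim> c \<and> \<phi> c = i}"

text \<open>The isolated neighbours of \<open>c\<close> with list \<open>{0, i}\<close>. They must
  take colour 0 when \<open>c\<close> takes \<open>i\<close>, so they pay for that choice.\<close>

abbreviation payers :: "nat \<Rightarrow> nat \<Rightarrow> nat set" where
  "payers i c \<equiv> {a \<in> triv (3 - i). c \<sim> a}"

text \<open>If \<open>a\<close> and \<open>b\<close> witnessed incomparable neighbourhoods,
  \<open>a, c, d, c', b\<close> would be an induced P5; \<open>d\<close> has colour 0 and therefore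
  sees no vertex of type \<open>3 - i\<close>. Comparing cardinalities then decides the direction of
  the inclusion.\<close>

lemma loners_nested:
  assumes "d \<in> D" "c \<in> loners d i" "c' \<in> loners d i" "i = 1 \<or> i = 2"
    and "card (payers i c) \<le> card (payers i c')"
  shows "payers i c \<subseteq> payers i c'"
proof (rule ccontr)
  assume "\<not> payers i c \<subseteq> payers i c'"
  then obtain a where a: "a \<in> triv (3 - i)" "c \<sim> a" "\<not> c' \<sim> a" by blast
  have fin: "finite (payers i v)" for v using finX by (rule finite_subset[rotated]) (auto simp: triv_def T_def)
  have "\<not> payers i c' \<subseteq> payers i c"
  proof
    assume s: "payers i c' \<subseteq> payers i c"
    then have "payers i c' \<subset> payers i c" using a by blast
    then show False using assms(5) psubset_card_mono[OF fin] by (meson not_le)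
  qed
  then obtain b where b: "b \<in> triv (3 - i)" "c' \<sim> b" "\<not> c \<sim> b" by blast
  have cT: "c \<in> T 0" "d \<sim> c" "c' \<in> T 0" "d \<sim> c'" "\<not> c \<sim> c'"
    using assms(2,3) by (simp_all add: loners_def triv_def)
  have abT: "a \<in> T (3 - i)" "b \<in> T (3 - i)" "\<not> a \<sim> b" using a(1) b(1) by (simp_all add: triv_def)
  have i: "3 - i < 3" "3 - i \<noteq> 0" using assms(4) by auto
  have "\<phi> d = 0" by (rule T_D[OF cT(1) _ assms(1) cT(2)]) simp
  then have "\<not> d \<sim> a" "\<not> d \<sim> b" using T_D[OF abT(1) i(1) assms(1)] T_D[OF abT(2) i(1) assms(1)] i(2) by auto
  then show False using no_P5[of a c d c' b] a(2,3) b(2,3) cT abT adj_sym by blast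
qed

definition linked_rep :: "nat \<Rightarrow> nat \<Rightarrow> nat" where
  "linked_rep d l = (SOME u. u \<in> linked d l)"

definition greedy_rep :: "nat \<Rightarrow> nat \<Rightarrow> nat" where
  "greedy_rep d i = (SOME c. c \<in> loners d i \<and> (\<forall>c'\<in>loners d i. card (payers i c') \<le> card (payers i c)))"

lemma linked_rep_in: "u \<in> linked d l \<Longrightarrow> linked_rep d l \<in> linked d l" unfolding linked_rep_def by (rule someI)

lemma finite_X_sub: "A \<subseteq> X \<Longrightarrow> finite A" using finX by (rule finite_subset[rotated])

lemma greedy_rep_in:
  assumes "c \<in> loners d i"
  shows "greedy_rep d i \<in> loners d i" "c' \<in> loners d i \<Longrightarrow> card (payers i c') \<le> card (payers i (greedy_rep d i))"
proof -
  let ?P = "\<lambda>c. c \<in> loners d i \<and> (\<forall>c'\<in>loners d i. card (payers i c') \<le> card (payers i c))"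
  let ?f = "\<lambda>c. card (payers i c)"
  have "loners d i \<subseteq> X" by (auto simp: loners_def triv_def T_def)
  then have "finite (?f ` loners d i)" using finite_X_sub by blast
  moreover have "Max (?f ` loners d i) \<in> ?f ` loners d i" using assms calculation by (intro Max_in) auto
  ultimately have "\<exists>c. ?P c" using Max_ge[of "?f ` loners d i"] by (smt (verit) imageE imageI)
  then have "?P (greedy_rep d i)" unfolding greedy_rep_def by (rule someI_ex)
  then show "greedy_rep d i \<in> loners d i" "c' \<in> loners d i \<Longrightarrow> card (payers i c') \<le> card (payers i (greedy_rep d i))"
    by blast+
qed

definition \<Gamma> :: "nat set" where
  "\<Gamma> = D \<union> {linked_rep d l | d l. d \<in> D \<and> l < 3 \<and> l \<noteq> \<phi> d \<and> linked d l \<noteq> {}}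
     \<union> {greedy_rep d i | d i. d \<in> D \<and> \<phi> d = 0 \<and> (i = 1 \<or> i = 2) \<and> loners d i \<noteq> {}}"

lemma Gamma_X: "\<Gamma> \<subseteq> X"
proof -
  have "linked_rep d l \<in> X" if "linked d l \<noteq> {}" for d l
  proof -
    have "linked_rep d l \<in> linked d l" using that linked_rep_in by blast
    then show ?thesis by (simp add: linked_def T_def)
  qed
  moreover have "greedy_rep d i \<in> X" if "loners d i \<noteq> {}" for d i
  proof -
    have "greedy_rep d i \<in> loners d i" using that greedy_rep_in(1) by blast
    then show ?thesis by (simp add: loners_def triv_def T_def)
  qed
  ultimately show ?thesis using DX unfolding \<Gamma>_def by blast
qed

text \<open>A vertex of type \<open>l\<close> is dominated by a vertex of colour \<open>l\<close>,
  so only colours present on \<open>D\<close> need linked representatives. If \<open>D\<close>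
  carries at most two colours, the count is at most 3 + 3 + 6 = 12. If it carries three,
  \<open>D\<close> has only one vertex of colour 0 and the count is at most 3 + 6 + 2 = 11.\<close>

lemma card_Gamma: "card \<Gamma> \<le> 12"
proof -
  define P1 where "P1 = (SIGMA d : D. \<phi> ` D - {\<phi> d})"
  define P2 where "P2 = {d \<in> D. \<phi> d = 0} \<times> {1, 2::nat}"
  have "linked d l = {}" if "l < 3" "l \<notin> \<phi> ` D" for d l
  proof (rule ccontr)
    assume "linked d l \<noteq> {}"
    then obtain y where "y \<in> T l" by (auto simp: linked_def)
    then show False using T_dom[of y l] that by auto
  qed
  then have "\<Gamma> \<subseteq> D \<union> (case_prod linked_rep) ` P1 \<union> (case_prod greedy_rep) ` P2"
    unfolding \<Gamma>_def P1_def P2_def by force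
  then have "card \<Gamma> \<le> card (D \<union> (case_prod linked_rep) ` P1 \<union> (case_prod greedy_rep) ` P2)"
    using finD by (intro card_mono) (auto simp: P1_def P2_def)
  also have "\<dots> \<le> card D + card ((case_prod linked_rep) ` P1) + card ((case_prod greedy_rep) ` P2)"
    by (meson add_le_mono1 card_Un_le le_trans)
  also have "\<dots> \<le> card D + card P1 + card P2"
    using finD by (intro add_mono card_image_le) (auto simp: P1_def P2_def)
  also have "card P1 = card D * (card (\<phi> ` D) - 1)"
    unfolding P1_def using finD by (subst card_SigmaI) auto
  also have "card P2 = 2 * card {d \<in> D. \<phi> d = 0}"
    unfolding P2_def by (simp add: card_cartesian_product)
  finally have le: "card \<Gamma> \<le> card D + card D * (card (\<phi> ` D) - 1) + 2 * card {d \<in> D. \<phi> d = 0}" .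
  have c0: "card {d \<in> D. \<phi> d = 0} \<le> card D" using finD by (intro card_mono) auto
  have img: "card (\<phi> ` D) \<le> card D" using finD by (rule card_image_le)
  show ?thesis
  proof (cases "card (\<phi> ` D) \<le> 2")
    case True
    then have "card D * (card (\<phi> ` D) - 1) \<le> card D * 1" by (intro mult_le_mono2) simp
    then show ?thesis using le c0 cardD by linarith
  next
    case False
    then have e: "card (\<phi> ` D) = 3" "card D = 3" using img cardD by auto
    then have "inj_on \<phi> D" using finD by (simp add: eq_card_imp_inj_on)
    then have "card {d \<in> D. \<phi> d = 0} \<le> Suc 0"
      using finD by (subst card_le_Suc0_iff_eq) (auto simp: inj_on_def)
    then show ?thesis using le e by simp
  qed
qed

end

section \<open>The greedy completion\<close>

locale closed_lists = coloured_component +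
  fixes L :: "nat \<Rightarrow> nat set"
  assumes L: "is_closure (guess \<Gamma> \<phi>) L"
begin

lemma L_consistent: "consistent L" and L_guess: "L v \<subseteq> guess \<Gamma> \<phi> v"
  using L by (auto simp: is_closure_def le_fun_def)

lemma phi_L: "v \<in> X \<Longrightarrow> \<phi> v \<in> L v"
  using phi_in_closure[OF L Gamma_X] .

lemma L_Gamma: "v \<in> \<Gamma> \<Longrightarrow> L v = {\<phi> v}"
  using L_guess[of v] phi_L[of v] Gamma_X by (auto simp: guess_def)

lemma L_L0: "L v \<subseteq> L0 v"
proof -
  have "guess \<Gamma> \<phi> \<le> guess D \<phi>"
  proof (rule le_funI)
    fix v
    have "D \<subseteq> \<Gamma>" by (auto simp: \<Gamma>_def)
    moreover have "v \<in> \<Gamma> \<Longrightarrow> \<phi> v < 3" using Gamma_X phi_less by blast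
    ultimately show "guess \<Gamma> \<phi> v \<le> guess D \<phi> v" unfolding guess_def by auto
  qed
  then have "L \<le> guess D \<phi>" using L by (meson is_closure_def order_trans)
  then have "L \<le> L0" using L0 L_consistent by (simp add: is_closure_def)
  then show ?thesis by (simp add: le_fun_def)
qed

text \<open>The residual vertices: those which even the full guess leaves with two colours.\<close>

definition Res :: "nat \<Rightarrow> nat set" where
  "Res k = {v \<in> X. L v = {..<3} - {k}}"

lemma Res_X: "v \<in> Res k \<Longrightarrow> v \<in> X" by (simp add: Res_def)
lemma Res_L: "v \<in> Res k \<Longrightarrow> L v = {..<3} - {k}" by (simp add: Res_def)

lemma not_single: "k < 3 \<Longrightarrow> \<not> {..<3} - {k} \<subseteq> {c::nat}"
  using two_elements[of k] by auto

text \<open>Outside \<open>D\<close>, the list \<open>L0 v\<close> has already lost the colour of a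
  dominating neighbour. As two colours survive in \<open>L v\<close>, the lost colour is
  \<open>k\<close> and nothing else was deleted in between.\<close>

lemma Res_T: assumes v: "v \<in> Res k" "k < 3" shows "v \<in> T k"
proof -
  have X: "v \<in> X" using v Res_X by blast
  have "v \<notin> D"
  proof
    assume "v \<in> D"
    then have "L v = {\<phi> v}" using L_Gamma by (simp add: \<Gamma>_def)
    then show False using Res_L[OF v(1)] not_single[OF v(2)] by blast
  qed
  then obtain d where d: "d \<in> D" "d \<sim> v" using dom X by blast
  then have 1: "\<phi> d \<notin> L0 v" "\<phi> d < 3" using L0_dom[of v d] X \<open>v \<notin> D\<close> phi_less DX by auto
  then have "\<phi> d = k" using L_L0[of v] Res_L[OF v(1)] by auto
  then have "L0 v \<subseteq> {..<3} - {k}" using 1 L0_three[OF X] by auto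
  then show ?thesis using L_L0[of v] Res_L[OF v(1)] X by (auto simp: T_def)
qed

lemma L_cases:
  assumes "v \<in> X"
  obtains "L v = {\<phi> v}" | k where "k < 3" "v \<in> Res k"
proof (cases "v \<in> D")
  case True
  then show ?thesis using L_Gamma that by (simp add: \<Gamma>_def)
next
  case False
  then obtain d where d: "d \<in> D" "d \<sim> v" using dom assms by blast
  then have 1: "\<phi> d \<notin> L0 v" "\<phi> d < 3" using L0_dom[of v d] assms False phi_less DX by auto
  then have "L v \<subseteq> {..<3} - {\<phi> d}" using L0_three[OF assms] L_L0[of v] by blast
  moreover obtain i j where "{..<3} - {\<phi> d} = {i, j}" using two_elements[OF 1(2)] by blast
  ultimately have "L v = {\<phi> v} \<or> L v = {..<3} - {\<phi> d}" using phi_L[OF assms] by auto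
  then show ?thesis using that 1(2) assms by (auto simp: Res_def)
qed

text \<open>A decided vertex of \<open>T k\<close> has one of the two colours of its type and
  strikes it from the list of each neighbour in \<open>T k\<close>. Hence components of
  \<open>T k\<close> are residual as a whole or not at all.\<close>

lemma Res_nbr: assumes "b \<in> Res k" "a \<in> T k" "a \<sim> b" "k < 3" shows "a \<in> Res k"
proof (rule L_cases[of a])
  show "a \<in> X" using assms T_X by blast
  assume a: "L a = {\<phi> a}"
  then have "\<phi> a \<notin> L b" using consistent_edge[OF L_consistent assms(3)] by simp
  moreover have "\<phi> a \<in> {..<3} - {k}"
    using L_L0[of a] a T_L0[OF assms(2)] by auto
  ultimately show ?thesis using Res_L[OF assms(1)] by blast
next
  fix l assume "l < 3" "a \<in> Res l"
  then show ?thesis using Res_T T_disjoint[OF _ assms(2)] assms(4) by blast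
qed

lemma Res_R: assumes "(a, b) \<in> (R k)\<^sup>*" "b \<in> Res k" "k < 3" shows "a \<in> Res k"
  using assms(1,2)
proof (induction rule: converse_rtrancl_induct)
  case (step a c)
  then show ?case using Res_nbr[of c k a] assms(3) by (auto simp: R_def)
qed

text \<open>Such an edge would make \<open>u\<close> a linked vertex. The representative guessed for
  it lies in the same component of \<open>T k\<close>, so it would be residual, although its list is
  a singleton.\<close>

lemma no_cross_edge:
  assumes "u \<in> Res k" "u2 \<in> Res k" "u \<sim> u2" "y \<in> Res l" "l \<noteq> k" "k < 3" "l < 3"
  shows "\<not> u \<sim> y"
proof
  assume uy: "u \<sim> y"
  obtain d where d: "d \<in> D" "d \<sim> u" "\<phi> d = k" using T_dom[OF Res_T[OF assms(1)]] assms by blast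
  then have S: "u \<in> linked d l" using assms Res_T uy unfolding linked_def by blast
  then have "linked_rep d l \<in> \<Gamma>" using d assms unfolding \<Gamma>_def by blast
  moreover have "(linked_rep d l, u) \<in> (R k)\<^sup>*" using linked_one_component[OF d(1) _ _ linked_rep_in[OF S] S] d assms by blast
  then have "linked_rep d l \<in> Res k" using Res_R assms by blast
  ultimately show False using L_Gamma[of "linked_rep d l"] Res_L[of "linked_rep d l" k] not_single[OF assms(6)] by auto
qed

text \<open>By \<open>no_cross_edge\<close> both ends are isolated in their types, so
  \<open>a\<close> is a payer of \<open>c\<close>. The guessed representative has colour
  \<open>i\<close> and, by nestedness, also sees \<open>a\<close>; it has therefore already struck
  \<open>i\<close> from the list of \<open>a\<close>.\<close>

lemma Res_0_edge:
  assumes c: "c \<in> Res 0" "\<phi> c = i" "i = 1 \<or> i = 2" and a: "a \<in> Res (3 - i)"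
  shows "\<not> c \<sim> a"
proof
  assume ca: "c \<sim> a"
  have i: "3 - i < 3" "3 - i \<noteq> 0" "i < 3" "i \<noteq> 3 - i" using c by auto
  have Tc: "c \<in> T 0" and Ta: "a \<in> T (3 - i)" using Res_T c a i by auto
  have "\<not> c \<sim> c'" if "c' \<in> T 0" for c'
    using no_cross_edge[of c 0 c' a "3 - i"] Res_nbr[of c 0 c'] that c a ca i adj_sym by auto
  then have c0: "c \<in> triv 0" using Tc by (simp add: triv_def)
  have "\<not> a \<sim> a'" if "a' \<in> T (3 - i)" for a'
    using no_cross_edge[of a "3 - i" a' c 0] Res_nbr[of a "3 - i" a'] that c a ca i adj_sym by auto
  then have a0: "a \<in> triv (3 - i)" using Ta by (simp add: triv_def)
  obtain d where d: "d \<in> D" "d \<sim> c" "\<phi> d = 0" using T_dom[OF Tc] by auto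
  have Q: "c \<in> loners d i" using c0 d c by (simp add: loners_def)
  have "payers i c \<subseteq> payers i (greedy_rep d i)"
    using loners_nested[OF d(1) Q greedy_rep_in(1)[OF Q] c(3) greedy_rep_in(2)[OF Q Q]] .
  then have "greedy_rep d i \<sim> a" using a0 ca by blast
  moreover have "greedy_rep d i \<in> \<Gamma>" using d Q c(3) unfolding \<Gamma>_def by blast
  then have "L (greedy_rep d i) = {\<phi> (greedy_rep d i)}" by (rule L_Gamma)
  moreover have "\<phi> (greedy_rep d i) = i" using greedy_rep_in(1)[OF Q] by (simp add: loners_def)
  ultimately have "i \<notin> L a" using consistent_edge[OF L_consistent] by simp
  then show False using Res_L[OF a] i by auto
qed

lemma Res_iff: "v \<in> Res k \<Longrightarrow> x \<in> X \<Longrightarrow> L x = L v \<longleftrightarrow> x \<in> Res k"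
  by (auto simp: Res_def)

lemma own_Res:
  assumes "v \<in> Res k"
  shows "own L v = {x \<in> Res k. \<exists>u\<in>Res k. v \<sim> u \<and> u \<sim> x}"
proof -
  have "L x = L v \<longleftrightarrow> x \<in> Res k" if "v \<sim> u" "u \<sim> x \<or> u = x" for u x
    using Res_iff[OF assms, of x] closed[OF Res_X[OF assms] that(1)] closed[of u x] that(2) by blast
  then show ?thesis unfolding own_def by blast
qed

lemma phi_Res: "v \<in> Res k \<Longrightarrow> \<phi> v \<in> {..<3} - {k}"
  using phi_L[of v] Res_L[of v k] Res_X[of v k] by simp

lemma phi_alternates:
  assumes "u \<in> Res k" "v \<in> Res k" "w \<in> Res k" "u \<sim> v" "v \<sim> w" "k < 3"
  shows "\<phi> u = \<phi> w"
proof -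
  obtain i j where "{..<3} - {k} = {i, j}" using two_elements assms by blast
  then show ?thesis using phi_Res[OF assms(1)] phi_Res[OF assms(2)] phi_Res[OF assms(3)]
      phi_edge[OF _ assms(4)] phi_edge[OF _ assms(5)] Res_X assms by auto
qed

text \<open>Consider the path \<open>v', u, v, a, x\<close>. Colours alternate along it, so only the
  chords from \<open>v'\<close> to \<open>a\<close> and from \<open>u\<close> to \<open>x\<close>
  are possible. One of them exists, and either brings \<open>x\<close> within two steps of
  \<open>v'\<close>.\<close>

lemma own_eqI:
  assumes "v \<in> Res k" "v' \<in> Res k" "u \<in> Res k" "v \<sim> u" "v' \<sim> u" "k < 3"
  shows "own L v \<subseteq> own L v'"
proof
  fix x assume "x \<in> own L v"
  then obtain a where a: "x \<in> Res k" "a \<in> Res k" "v \<sim> a" "a \<sim> x" using own_Res[OF assms(1)] by auto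
  have same: "\<not> p \<sim> q" if "\<phi> p = \<phi> q" "p \<in> Res k" for p q
    using phi_edge[OF Res_X[OF that(2)]] that(1) by blast
  have uv: "u \<sim> v" using assms(4) adj_sym by blast
  have ph: "\<phi> v' = \<phi> v" "\<phi> v = \<phi> x" "\<phi> u = \<phi> a"
    using phi_alternates[OF assms(2,3,1,5) uv assms(6)] phi_alternates[OF assms(1) a(2,1,3,4) assms(6)]
      phi_alternates[OF assms(3,1) a(2) uv a(3) assms(6)] by auto
  have "v' \<sim> a \<or> u \<sim> x"
    using no_P5[of v' u v a x] same ph assms a uv by metis
  then show "x \<in> own L v'" using own_Res[OF assms(2)] a assms by blast
qed

lemma own_eq:
  assumes "v \<in> Res k" "v' \<in> Res k" "u \<in> Res k" "v \<sim> u" "v' \<sim> u" "k < 3"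
  shows "own L v = own L v'"
  by (rule antisym[OF own_eqI[OF assms] own_eqI[OF assms(2,1,3,5,4,6)]])

lemma own_phi: "v \<in> Res k \<Longrightarrow> k < 3 \<Longrightarrow> x \<in> own L v \<Longrightarrow> \<phi> x = \<phi> v"
  using phi_alternates[of v k _ x] unfolding own_Res by auto

lemma own_finite: "finite (own L v)" and own_less: "x \<in> own L v \<Longrightarrow> x < n"
proof -
  have "own L v \<subseteq> {..<n}" using adj_less adj_sym unfolding own_def by blast
  then show "finite (own L v)" "x \<in> own L v \<Longrightarrow> x < n" by (auto intro: finite_subset)
qed

lemma own_self: "v \<in> Res k \<Longrightarrow> u \<in> Res k \<Longrightarrow> v \<sim> u \<Longrightarrow> v \<in> own L v"
  using own_Res adj_sym by blast

lemma key_div_mod: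
  assumes "own L v \<noteq> {}"
  shows "key L v div n = card (own L v)" "key L v mod n \<in> own L v"
proof -
  have "Max (own L v) \<in> own L v" using own_finite assms by simp
  moreover from this have "Max (own L v) < n" by (rule own_less)
  ultimately show "key L v div n = card (own L v)" "key L v mod n \<in> own L v"
    using assms by (simp_all add: key_def)
qed

text \<open>The quotient of a key by \<open>n\<close> is the size of the side, and the remainder is
  one of its vertices. The two sides are disjoint because \<open>\<phi>\<close> separates them, so
  ties in size never become ties in keys.\<close>

lemma key_edge:
  assumes "v \<in> Res k" "u \<in> Res k" "v \<sim> u" "k < 3"
  shows "key L v \<noteq> key L u" "key L v < key L u \<Longrightarrow> card (own L v) \<le> card (own L u)"
proof -
  have ne: "own L v \<noteq> {}" "own L u \<noteq> {}" using own_self assms adj_sym by blast+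
  have "own L v \<inter> own L u = {}"
    using own_phi assms phi_edge[OF Res_X[OF assms(1)] assms(3)] by (metis disjoint_iff)
  then show "key L v \<noteq> key L u" using key_div_mod(2)[OF ne(1)] key_div_mod(2)[OF ne(2)] by auto
  show "card (own L v) \<le> card (own L u)" if "key L v < key L u"
    using div_le_mono[of "key L v" "key L u" n] that key_div_mod(1)[OF ne(1)] key_div_mod(1)[OF ne(2)] by simp
qed

lemma key_own: "own L v = own L u \<Longrightarrow> key L v = key L u" by (simp add: key_def)

lemma two: "{..<3} - {0} = {1, 2::nat}" "{..<3} - {1} = {0, 2::nat}" "{..<3} - {2} = {0, 1::nat}" by auto

lemma Res_0_iff: "v \<in> X \<Longrightarrow> L v = {1, 2} \<longleftrightarrow> v \<in> Res 0"
  and Res_1_iff: "v \<in> X \<Longrightarrow> L v = {0, 2} \<longleftrightarrow> v \<in> Res 1"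
  unfolding Res_def two by simp_all

text \<open>All neighbours of \<open>v\<close> of its own type share one side and hence one key. The
  second part of the flag cannot fire, since by \<open>no_cross_edge\<close> an edge-carrying
  component has no residual neighbours of other types.\<close>

lemma flag_edge:
  assumes "v \<in> Res k" "u \<in> Res k" "v \<sim> u" "k < 3"
  shows "flag L v \<longleftrightarrow> key L v < key L u"
proof -
  have key: "key L w = key L u" if "w \<in> Res k" "v \<sim> w" for w
    using own_eq[OF that(1) assms(2,1) _ _ assms(4)] that(2) assms(3) adj_sym key_own by blast
  have "\<not> (L v = {1, 2} \<and> L w = {0, 2})" if "v \<sim> w" for w
  proof
    assume a: "L v = {1, 2} \<and> L w = {0, 2}"
    have X: "v \<in> X" "w \<in> X" using assms Res_X closed that by blast+
    have "v \<in> Res 0" "w \<in> Res 1" using a X Res_0_iff Res_1_iff by auto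
    moreover from this have "k = 0" using T_disjoint[of v k 0] assms Res_T by auto
    ultimately show False using no_cross_edge[of v 0 u w 1] assms that by auto
  qed
  moreover have "w \<in> Res k" if "v \<sim> w" "L w = L v" for w
    using Res_iff[OF assms(1)] closed Res_X[OF assms(1)] that by blast
  ultimately show ?thesis unfolding flag_def using key assms(2,3) Res_L[OF assms(1)] Res_L[OF assms(2)] by metis
qed

lemma flag_isolated:
  assumes "v \<in> Res k" "\<And>u. u \<in> Res k \<Longrightarrow> \<not> v \<sim> u" "k < 3"
  shows "flag L v \<longleftrightarrow> k = 0 \<and> (\<exists>u\<in>Res 1. v \<sim> u)"
proof -
  have "w \<in> Res k" if "v \<sim> w" "L w = L v" for w
    using Res_iff[OF assms(1)] closed Res_X[OF assms(1)] that by blast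
  moreover have "L v = {1, 2} \<longleftrightarrow> k = 0"
    using Res_0_iff[OF Res_X[OF assms(1)]] T_disjoint[of v k 0] assms Res_T by auto
  moreover have "L w = {0, 2} \<longleftrightarrow> w \<in> Res 1" if "v \<sim> w" for w
    using Res_1_iff[of w] closed Res_X[OF assms(1)] that by blast
  ultimately show ?thesis unfolding flag_def using assms(2) by (metis less_irrefl)
qed

lemma lo_hi: "lo {1, 2} = 1" "hi {1, 2} = 2" "lo {0, 2} = 0" "hi {0, 2} = 2" "lo {0, 1} = 0" "hi {0, 1} = 1"
  by (auto simp: lo_def hi_def)

lemma col_Res:
  "v \<in> Res 0 \<Longrightarrow> col L v = (if flag L v then 1 else 2)"
  "v \<in> Res 1 \<Longrightarrow> col L v = (if flag L v then 0 else 2)"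
  "v \<in> Res 2 \<Longrightarrow> col L v = (if flag L v then 0 else 1)"
  by (simp_all only: col_def Res_L two lo_hi)

lemma col_det: "v \<in> X \<Longrightarrow> L v = {\<phi> v} \<Longrightarrow> col L v = \<phi> v"
  using phi_less[of v] by (auto simp: col_def lo_def hi_def)

lemma less_3_cases: "k < 3 \<Longrightarrow> (k = 0 \<Longrightarrow> P) \<Longrightarrow> (k = 1 \<Longrightarrow> P) \<Longrightarrow> (k = 2 \<Longrightarrow> P) \<Longrightarrow> P" for k :: nat
  by linarith

lemma col_L: assumes "v \<in> X" shows "col L v \<in> L v" "col L v < 3"
proof -
  have "col L v \<in> L v \<and> col L v < 3"
  proof (rule L_cases[OF assms])
    assume "L v = {\<phi> v}" then show ?thesis using col_det assms phi_less by simp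
  next
    fix k assume "k < 3" "v \<in> Res k"
    then show ?thesis by (elim less_3_cases) (auto simp: col_Res Res_L)
  qed
  then show "col L v \<in> L v" "col L v < 3" by auto
qed

text \<open>Both ends are isolated in their types, and \<open>v\<close>, being of type 1 or 2, takes
  \<open>hi\<close>. For types 0 and 1 the flag of \<open>u\<close> is set, giving colours 1 and 2.
  For types 0 and 2, \<open>Res_0_edge\<close> first yields \<open>\<phi> u = 2\<close> and then
  that \<open>u\<close> has no residual neighbour of type 1, so the colours are 2 and 1. For types 1
  and 2 they are 2 and 1.\<close>

lemma cross_edge_colours:
  assumes "u \<in> Res k" "v \<in> Res l" "u \<sim> v" "k < l" "l < 3"
  shows "col L u \<noteq> col L v"
proof -
  have iu: "\<not> u \<sim> w" if "w \<in> Res k" for w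
    using no_cross_edge[of u k w v l] assms that by auto
  have iv: "\<not> v \<sim> w" if "w \<in> Res l" for w
    using no_cross_edge[of v l w u k] assms that adj_sym by auto
  have fv: "\<not> flag L v" using flag_isolated[OF assms(2) iv assms(5)] assms by simp
  have fu: "flag L u \<longleftrightarrow> k = 0 \<and> (\<exists>w\<in>Res 1. u \<sim> w)" using flag_isolated[OF assms(1) iu] assms by simp
  consider "k = 0" "l = 1" | "k = 0" "l = 2" | "k = 1" "l = 2" using assms(4,5) by linarith
  then show ?thesis
  proof cases
    case 1
    then show ?thesis using assms fu fv by (auto simp: col_Res)
  next
    case 2
    have "\<phi> u \<noteq> 1" using Res_0_edge[of u 1 v] assms 2 by (auto simp: numeral_eq_Suc)
    then have "\<phi> u = 2" using phi_Res[OF assms(1)] 2 by auto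
    then have "\<not> u \<sim> w" if "w \<in> Res 1" for w using Res_0_edge[of u 2 w] assms 2 that by auto
    then show ?thesis using assms fu fv 2 by (auto simp: col_Res)
  next
    case 3
    show ?thesis using assms(1,2) fu fv unfolding 3 by (auto simp: col_Res)
  qed
qed

lemma same_edge_colours:
  assumes "u \<in> Res k" "v \<in> Res k" "u \<sim> v" "k < 3"
  shows "col L u \<noteq> col L v"
proof -
  have "flag L u \<noteq> flag L v"
    using flag_edge[OF assms] flag_edge[OF assms(2,1) _ assms(4)] key_edge(1)[OF assms] assms(3) adj_sym
    by (metis linorder_neqE_nat not_less_iff_gr_or_eq)
  then show ?thesis using assms by (auto elim!: less_3_cases simp: col_Res)
qed

lemma col_proper: "proper_on X (col L)"
proof -
  have single: "col L u \<noteq> col L v" if "u \<in> X" "v \<in> X" "u \<sim> v" "L u = {\<phi> u}" for u v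
    using consistent_edge[OF L_consistent that(3), of "\<phi> u"] that col_det col_L(1)[of v] by auto
  have "col L u \<noteq> col L v" if uv: "u \<in> X" "v \<in> X" "u \<sim> v" for u v
  proof (rule L_cases[OF uv(1)])
    assume "L u = {\<phi> u}" then show ?thesis using single uv by blast
  next
    fix k assume k: "k < 3" "u \<in> Res k"
    show ?thesis
    proof (rule L_cases[OF uv(2)])
      assume "L v = {\<phi> v}" then show ?thesis using single[of v u] uv adj_sym by force
    next
      fix l assume l: "l < 3" "v \<in> Res l"
      show ?thesis
        using same_edge_colours[of u k v] cross_edge_colours[of u k v l] cross_edge_colours[of v l u k] k l uv adj_sym
        by (metis linorder_neqE_nat)
    qed
  qed
  then show ?thesis using col_L(2) by (auto simp: proper_on_def)
qed

definition sides :: "nat \<Rightarrow> nat set" where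
  "sides v = own L v \<union> \<Union>{own L u | u. L u = L v \<and> v \<sim> u}"

text \<open>The only vertices where the greedy choice may introduce a colour 0 that
  \<open>\<phi>\<close> does not use: lists of type 0 do not contain 0, and isolated vertices of
  types 1 and 2 take \<open>hi\<close>.\<close>

definition two_sided :: "nat set" where
  "two_sided = {v \<in> X. \<exists>k u. (k = 1 \<or> k = 2) \<and> v \<in> Res k \<and> u \<in> Res k \<and> v \<sim> u}"

lemma sides_edge:
  assumes "v \<in> Res k" "u \<in> Res k" "v \<sim> u" "k < 3"
  shows "sides v = own L v \<union> own L u"
proof -
  have "own L w = own L u" if "L w = L v" "v \<sim> w" for w
    using own_eq[of w k u v] Res_iff[OF assms(1), of w] closed[OF Res_X[OF assms(1)] that(2)] that assms adj_sym
    by blast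
  moreover have "L u = L v" using Res_L[OF assms(1)] Res_L[OF assms(2)] by simp
  ultimately have "{own L w | w. L w = L v \<and> v \<sim> w} = {own L u}" using assms(3) by blast
  then show ?thesis by (simp add: sides_def)
qed

lemma own_nbr:
  assumes "v \<in> Res k" "u \<in> Res k" "v \<sim> u" "k < 3" "x \<in> own L v"
  obtains w where "x \<in> Res k" "w \<in> Res k" "x \<sim> w" "own L x = own L v" "own L w = own L u"
proof -
  obtain w where w: "x \<in> Res k" "w \<in> Res k" "v \<sim> w" "w \<sim> x" using own_Res[OF assms(1)] assms(5) by blast
  have "own L x = own L v" "own L w = own L u"
    using own_eq[of x k v w] own_eq[of w k u v] w assms adj_sym by blast+
  then show ?thesis using that w adj_sym by blast
qed

text \<open>The values of \<open>sides\<close> partition \<open>two_sided\<close>, and each value is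
  its own class; costs can thus be summed over them.\<close>

lemma sides_class:
  assumes v: "v \<in> Res k" "u \<in> Res k" "v \<sim> u" and k: "k = 1 \<or> k = 2"
  shows "{x \<in> two_sided. sides x = sides v} = sides v"
proof
  have k3: "k < 3" using k by auto
  show "{x \<in> two_sided. sides x = sides v} \<subseteq> sides v"
  proof
    fix x assume x: "x \<in> {x \<in> two_sided. sides x = sides v}"
    then obtain l w where "x \<in> Res l" "w \<in> Res l" "x \<sim> w" by (auto simp: two_sided_def)
    then have "x \<in> sides x" using own_self by (simp add: sides_def)
    then show "x \<in> sides v" using x by simp
  qed
  have *: "x \<in> two_sided \<and> sides x = own L v \<union> own L u" if "x \<in> own L v" "v \<in> Res k" "u \<in> Res k" "v \<sim> u" for x v u
  proof (rule own_nbr[OF that(2-4) k3 that(1)])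
    fix w assume w: "x \<in> Res k" "w \<in> Res k" "x \<sim> w" "own L x = own L v" "own L w = own L u"
    then show ?thesis using sides_edge[OF w(1-3) k3] k Res_X by (auto simp: two_sided_def)
  qed
  show "sides v \<subseteq> {x \<in> two_sided. sides x = sides v}"
    using *[OF _ v] *[OF _ v(2,1)] v(3) adj_sym unfolding sides_edge[OF v k3] by blast
qed

lemma own_col:
  assumes v: "v \<in> Res k" "u \<in> Res k" "v \<sim> u" and k: "k = 1 \<or> k = 2" and x: "x \<in> own L v"
  shows "col L x = 0 \<longleftrightarrow> key L v < key L u"
proof -
  have k3: "k < 3" using k by auto
  show ?thesis
  proof (rule own_nbr[OF v k3 x])
    fix w assume w: "x \<in> Res k" "w \<in> Res k" "x \<sim> w" "own L x = own L v" "own L w = own L u"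
    have "flag L x \<longleftrightarrow> key L v < key L u"
      using flag_edge[OF w(1-3) k3] key_own[OF w(4)] key_own[OF w(5)] by simp
    then show ?thesis using w(1) k by (auto simp: col_Res)
  qed
qed

text \<open>The greedy colouring spends colour 0 only on the side with the smaller key, which is no
  larger than the other. Any proper colouring from these lists gives 0 to one of the two sides
  entirely.\<close>

lemma sides_cost_aux:
  assumes v: "v \<in> Res k" "u \<in> Res k" "v \<sim> u" and k: "k = 1 \<or> k = 2" and less: "key L v < key L u"
  shows "card {x \<in> sides v. col L x = 0} \<le> card {x \<in> sides v. \<phi> x = 0}"
proof -
  have k3: "k < 3" using k by auto
  have uv: "u \<sim> v" using v adj_sym by blast
  have cl: "sides v = own L v \<union> own L u" by (rule sides_edge[OF v k3])
  have "col L x \<noteq> 0" if "x \<in> own L u" for x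
    using own_col[OF v(2,1) uv k that] less by simp
  then have "{x \<in> sides v. col L x = 0} \<subseteq> own L v" unfolding cl by blast
  then have 1: "card {x \<in> sides v. col L x = 0} \<le> card (own L v)" using own_finite card_mono by blast
  have "\<phi> v = 0 \<or> \<phi> u = 0"
    using phi_Res[OF v(1)] phi_Res[OF v(2)] phi_edge[OF Res_X[OF v(1)] v(3)] k by auto
  then have "own L v \<subseteq> {x \<in> sides v. \<phi> x = 0} \<or> own L u \<subseteq> {x \<in> sides v. \<phi> x = 0}"
    using own_phi v k3 unfolding cl by auto
  moreover have "finite {x \<in> sides v. \<phi> x = 0}" using own_finite unfolding cl by simp
  ultimately have "card (own L v) \<le> card {x \<in> sides v. \<phi> x = 0} \<or> card (own L u) \<le> card {x \<in> sides v. \<phi> x = 0}"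
    using card_mono by blast
  then show ?thesis using 1 key_edge(2)[OF v k3 less] by linarith
qed

lemma sides_cost:
  assumes v: "v \<in> Res k" "u \<in> Res k" "v \<sim> u" and k: "k = 1 \<or> k = 2"
  shows "card {x \<in> sides v. col L x = 0} \<le> card {x \<in> sides v. \<phi> x = 0}"
proof (cases "key L v < key L u")
  case True
  then show ?thesis using sides_cost_aux[OF v k] by blast
next
  case False
  have k3: "k < 3" using k by auto
  have uv: "u \<sim> v" using v adj_sym by blast
  have "key L u < key L v" using False key_edge(1)[OF v k3] by simp
  moreover have "sides u = sides v" using sides_edge[OF v k3] sides_edge[OF v(2,1) uv k3] by blast
  ultimately show ?thesis using sides_cost_aux[OF v(2,1) uv k] by simp
qed

text \<open>On \<open>two_sided\<close> the comparison is made for each value of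
  \<open>sides\<close>. Elsewhere colour 0 is taken only by decided vertices, where
  \<open>col L\<close> and \<open>\<phi>\<close> agree.\<close>

lemma col_cost: "card {v \<in> X. col L v = 0} \<le> card {v \<in> X. \<phi> v = 0}"
proof -
  have fin: "finite two_sided" by (rule finite_X_sub) (auto simp: two_sided_def)
  have grp: "card {x \<in> two_sided. P x} = (\<Sum>Z\<in>sides ` two_sided. card {x \<in> Z. P x})" for P
  proof -
    have "card {x \<in> two_sided. P x} = (\<Sum>Z\<in>sides ` two_sided. card {x \<in> {x \<in> two_sided. P x}. sides x = Z})"
      using sum.group[of "{x \<in> two_sided. P x}" "sides ` two_sided" sides "\<lambda>_. 1::nat"] fin by (simp add: image_mono)
    also have "\<dots> = (\<Sum>Z\<in>sides ` two_sided. card {x \<in> Z. P x})"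
    proof (rule sum.cong[OF refl])
      fix Z assume "Z \<in> sides ` two_sided"
      then obtain v where v: "Z = sides v" "v \<in> two_sided" by blast
      then obtain k u where "k = 1 \<or> k = 2" "v \<in> Res k" "u \<in> Res k" "v \<sim> u" by (auto simp: two_sided_def)
      then have "{x \<in> two_sided. sides x = Z} = Z" using sides_class v by blast
      then have "{x \<in> {x \<in> two_sided. P x}. sides x = Z} = {x \<in> Z. P x}" by blast
      then show "card {x \<in> {x \<in> two_sided. P x}. sides x = Z} = card {x \<in> Z. P x}" by simp
    qed
    finally show ?thesis .
  qed
  have NN: "card {x \<in> two_sided. col L x = 0} \<le> card {x \<in> two_sided. \<phi> x = 0}"
    unfolding grp
  proof (rule sum_mono)
    fix Z assume "Z \<in> sides ` two_sided"
    then obtain v where v: "Z = sides v" "v \<in> two_sided" by blast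
    then obtain k u where "k = 1 \<or> k = 2" "v \<in> Res k" "u \<in> Res k" "v \<sim> u" by (auto simp: two_sided_def)
    then show "card {x \<in> Z. col L x = 0} \<le> card {x \<in> Z. \<phi> x = 0}" using sides_cost v by blast
  qed
  have out: "\<phi> v = 0" if v: "v \<in> X - two_sided" "col L v = 0" for v
  proof (rule L_cases[of v])
    show "v \<in> X" using v by blast
    assume "L v = {\<phi> v}" then show ?thesis using col_det v by simp
  next
    fix k assume k: "k < 3" "v \<in> Res k"
    have "k \<noteq> 0" using k(2) v(2) col_Res(1)[of v] by (intro notI) (simp split: if_splits)
    then have "\<not> flag L v"
      using flag_isolated[OF k(2) _ k(1)] k v by (auto simp: two_sided_def)
    then show ?thesis using k v \<open>k \<noteq> 0\<close> by (auto elim!: less_3_cases simp: col_Res)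
  qed
  have split: "card {v \<in> X. P v} = card {v \<in> X - two_sided. P v} + card {v \<in> two_sided. P v}" for P
  proof -
    have "{v \<in> X. P v} = {v \<in> X - two_sided. P v} \<union> {v \<in> two_sided. P v}" by (auto simp: two_sided_def)
    then show ?thesis using finX fin by (simp add: card_Un_disjoint disjoint_iff)
  qed
  have "card {v \<in> X - two_sided. col L v = 0} \<le> card {v \<in> X - two_sided. \<phi> v = 0}"
    using out finX by (intro card_mono) auto
  then show ?thesis using NN split[of "\<lambda>v. col L v = 0"] split[of "\<lambda>v. \<phi> v = 0"] by simp
qed

end

context P5_free_adj
begin

theorem ex_good_guess:
  assumes X: "finite X" "conn X" "\<And>u v. u \<in> X \<Longrightarrow> u \<sim> v \<Longrightarrow> v \<in> X" and \<phi>: "proper_on X \<phi>"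
  shows "\<exists>\<Gamma>\<subseteq>X. \<Gamma> \<noteq> {} \<and> card \<Gamma> \<le> 12 \<and> (\<forall>L. is_closure (guess \<Gamma> \<phi>) L \<longrightarrow>
    proper_on X (col L) \<and> card {v \<in> X. col L v = 0} \<le> card {v \<in> X. \<phi> v = 0})"
proof -
  obtain D where D: "D \<subseteq> X" "D \<noteq> {}" "card D \<le> 3" "\<forall>v\<in>X - D. \<exists>d\<in>D. d \<sim> v"
    using ex_small_dominating[OF X(1,2), of \<phi>] \<phi> unfolding proper_on_def by blast
  obtain L0 where L0: "is_closure (guess D \<phi>) L0" using ex_closure by blast
  interpret coloured_component adj n X D \<phi> L0
  proof (intro coloured_component.intro coloured_component_axioms.intro)
    show "P5_free_adj adj n" by (rule P5_free_adj_axioms)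
    show "\<And>u v. u \<in> X \<Longrightarrow> u \<sim> v \<Longrightarrow> v \<in> X" by (rule X(3))
    show "\<And>v. v \<in> X - D \<Longrightarrow> \<exists>d\<in>D. d \<sim> v" using D(4) by blast
  qed (fact X(1) \<phi> D(1-3) L0)+
  have "proper_on X (col L) \<and> card {v \<in> X. col L v = 0} \<le> card {v \<in> X. \<phi> v = 0}"
    if "is_closure (guess \<Gamma> \<phi>) L" for L
  proof -
    interpret closed_lists adj n X D \<phi> L0 L by unfold_locales (rule that)
    show ?thesis using col_proper col_cost by blast
  qed
  moreover have "\<Gamma> \<noteq> {}" using D_ne by (simp add: \<Gamma>_def)
  ultimately show ?thesis using Gamma_X card_Gamma by blast
qed

end

section \<open>Program logic\<close>

text \<open>Memory is viewed as a matrix with rows of length \<open>n\<close>. Rows below \<open>n\<close> hold the adjacency matrix,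
  rows \<open>n\<close>, \<open>n + 1\<close>, \<open>n + 2\<close> the indicators of the three colours in the lists, and rows \<open>n + 3\<close> to \<open>n + 7\<close>
  component labels, best costs, list codes, keys and colours. For \<open>n = 0\<close> no cell is ever accessed.\<close>

definition st :: "nat \<Rightarrow> (nat \<Rightarrow> nat) \<Rightarrow> (nat \<Rightarrow> nat \<Rightarrow> nat) \<Rightarrow> state" where
  "st n r M = (r, \<lambda>a. M (a div n) (a mod n))"

definition rd :: "nat \<Rightarrow> expr \<Rightarrow> expr" where
  "rd q c = Load (Op Add (Op Mul (Op Add (Reg 0) (Const q)) (Reg 0)) c)"

definition wr :: "nat \<Rightarrow> expr \<Rightarrow> expr \<Rightarrow> prog" where
  "wr q c e = Store (Op Add (Op Mul (Op Add (Reg 0) (Const q)) (Reg 0)) c) e"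

definition adjx :: "nat \<Rightarrow> nat \<Rightarrow> expr" where
  "adjx u v = Load (Op Add (Op Mul (Reg u) (Reg 0)) (Reg v))"

definition for_loop :: "nat \<Rightarrow> nat \<Rightarrow> prog \<Rightarrow> prog" where
  "for_loop c b p = Seq (Assign c (Const 0))
     (While (Op Less (Reg c) (Reg b)) (Seq p (Assign c (Op Add (Reg c) (Const 1)))))"

text \<open>An upper bound for loop-free programs. The value for loops never enters a bound, because
  \<open>wp\<close> is \<open>False\<close> there; loops are handled by
  \<open>hoare_for\<close>.\<close>

fun pcost :: "prog \<Rightarrow> nat" where
  "pcost Skip = 1"
| "pcost (Assign x e) = expr_cost e + 1"
| "pcost (Store a e) = expr_cost a + expr_cost e + 1"
| "pcost (Seq p q) = pcost p + pcost q"
| "pcost (Cond e p q) = expr_cost e + 1 + max (pcost p) (pcost q)"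
| "pcost (While e p) = 0"

fun wp :: "nat \<Rightarrow> prog \<Rightarrow> (state \<Rightarrow> bool) \<Rightarrow> state \<Rightarrow> bool" where
  "wp W Skip Q s = Q s"
| "wp W (Assign x e) Q s = (fits W e s \<and> Q ((fst s)(x := eval_expr e s), snd s))"
| "wp W (Store a e) Q s = (fits W a s \<and> fits W e s \<and> Q (fst s, (snd s)(eval_expr a s := eval_expr e s)))"
| "wp W (Seq p q) Q s = wp W p (wp W q Q) s"
| "wp W (Cond e p q) Q s = (fits W e s \<and> (if eval_expr e s = 0 then wp W q Q s else wp W p Q s))"
| "wp W (While e p) Q s = False"

lemma wp_exec: "wp W p Q s \<Longrightarrow> \<exists>t s'. exec W p s t s' \<and> t \<le> pcost p \<and> Q s'"
proof (induction p arbitrary: Q s)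
  case Skip
  then show ?case by (intro exI[of _ 1] exI[of _ s] conjI exec.Skip) simp_all
next
  case (Assign x e)
  then show ?case using exec.Assign[of W e s x] by (intro exI[of _ "expr_cost e + 1"] exI[of _ "((fst s)(x := eval_expr e s), snd s)"]) simp
next
  case (Store a e)
  then show ?case using exec.Store[of W a s e]
    by (intro exI[of _ "expr_cost a + expr_cost e + 1"] exI[of _ "(fst s, (snd s)(eval_expr a s := eval_expr e s))"]) simp
next
  case (Seq p q)
  from Seq.IH(1)[of "wp W q Q" s] Seq.prems obtain t s'
    where 1: "exec W p s t s'" "t \<le> pcost p" "wp W q Q s'" by auto
  from Seq.IH(2)[OF 1(3)] obtain u s'' where "exec W q s' u s''" "u \<le> pcost q" "Q s''" by blast
  then show ?case using exec.Seq[OF 1(1)] 1(2) by (intro exI[of _ "t + u"] exI[of _ s'']) simp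
next
  case (Cond e p q)
  show ?case
  proof (cases "eval_expr e s = 0")
    case True
    then have "wp W q Q s" using Cond.prems by simp
    then obtain t s' where "exec W q s t s'" "t \<le> pcost q" "Q s'" using Cond.IH(2) by blast
    then show ?thesis using exec.CondFalse[of W e s q t s' p] True Cond.prems
      by (intro exI[of _ "expr_cost e + 1 + t"] exI[of _ s']) auto
  next
    case False
    then have "wp W p Q s" using Cond.prems by simp
    then obtain t s' where "exec W p s t s'" "t \<le> pcost p" "Q s'" using Cond.IH(1) by blast
    then show ?thesis using exec.CondTrue[of W e s p t s' q] False Cond.prems
      by (intro exI[of _ "expr_cost e + 1 + t"] exI[of _ s']) auto
  qed
qed simp

type_synonym assertion = "(nat \<Rightarrow> nat) \<Rightarrow> (nat \<Rightarrow> nat \<Rightarrow> nat) \<Rightarrow> bool"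

locale ram =
  fixes n W :: nat
  assumes W: "(n + 2) ^ 40 \<le> W"
begin

lemma W_power: assumes "k < 40" shows "(n + 2) ^ k < W"
proof -
  have "(n + 2) ^ k < (n + 2) ^ 40" using assms by (intro power_strict_increasing) auto
  then show ?thesis using W by linarith
qed

text \<open>Constant factors are absorbed by powers of \<open>n + 2\<close>, which is at least 2:
  \<open>1024 = 2 ^ 10\<close> is at most \<open>(n + 2) ^ 10\<close>.\<close>

lemma W_quadratic: "1000 * (n * n) + 1000 * n + 1000 < W"
proof -
  have "1000 * (n * n) + 1000 * n + 1000 \<le> 1024 * ((n + 2) * (n + 2))" by (simp add: algebra_simps)
  also have "\<dots> = 2 ^ 10 * (n + 2) ^ 2" by (simp add: power2_eq_square)
  also have "\<dots> \<le> (n + 2) ^ 10 * (n + 2) ^ 2" by (intro mult_right_mono power_mono) auto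
  also have "\<dots> = (n + 2) ^ 12" by (simp add: power_add[symmetric])
  also have "\<dots> < W" by (rule W_power) simp
  finally show ?thesis .
qed

lemma W_small: "x \<le> 1000 \<Longrightarrow> x < W" and W_n: "n < W" and W_nn: "n * n < W"
  using W_quadratic by linarith+

text \<open>The largest quantity in the program is the number \<open>(3 * n) ^ 12\<close> of
  guesses, at most \<open>(n + 2) ^ 24\<close>; the exponent 40 of the word bound leaves ample
  room.\<close>

lemma W_literals: "j \<le> 12 \<Longrightarrow> (3 * n) ^ j < W"
proof -
  assume j: "j \<le> 12"
  have "3 * n \<le> (n + 2) ^ 2" by (simp add: power2_eq_square)
  then have "(3 * n) ^ j \<le> ((n + 2) ^ 2) ^ j" by (rule power_mono) simp
  also have "\<dots> = (n + 2) ^ (2 * j)" by (simp add: power_mult)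
  also have "\<dots> < W" using j by (intro W_power) simp
  finally show ?thesis .
qed

lemma fst_st [simp]: "fst (st n r M) = r"
  by (simp add: st_def)

abbreviation ev where "ev e r M \<equiv> eval_expr e (st n r M)"
abbreviation ft where "ft e r M \<equiv> fits W e (st n r M)"

lemma ev_Reg [simp]: "ev (Reg x) r M = r x" by (simp add: st_def)
lemma ft_Reg [simp]: "ft (Reg x) r M \<longleftrightarrow> r x < W" by (simp add: st_def)

lemma cell_less:
  assumes "q \<le> 10" "c < n"
  shows "(n + q) * n + c < W" "(n + q) * n < W" "n + q < W" "q < W"
proof -
  have "(n + q) * n = n * n + q * n" by (simp add: add_mult_distrib)
  moreover have "q * n \<le> 10 * n" using assms(1) by (rule mult_right_mono) simp
  ultimately show "(n + q) * n + c < W" "(n + q) * n < W" "n + q < W" "q < W"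
    using assms W_quadratic by linarith+
qed

lemma ev_rd [simp]:
  assumes "r 0 = n" "ev c r M < n"
  shows "ev (rd q c) r M = M (n + q) (ev c r M)"
  using assms by (simp add: rd_def st_def)

lemma ft_rd [simp]:
  assumes "r 0 = n" "ev c r M < n" "q \<le> 10"
  shows "ft (rd q c) r M \<longleftrightarrow> ft c r M \<and> M (n + q) (ev c r M) < W"
proof -
  have "ft (Op Add (Op Mul (Op Add (Reg 0) (Const q)) (Reg 0)) c) r M \<longleftrightarrow> ft c r M"
    using cell_less[OF assms(3,2)] W_n assms(1) by auto
  then show ?thesis using ev_rd[OF assms(1,2), of q] by (simp add: rd_def)
qed

lemma ev_adjx [simp]: "r 0 = n \<Longrightarrow> r v < n \<Longrightarrow> ev (adjx u v) r M = M (r u) (r v)"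
  by (simp add: adjx_def st_def)

lemma ft_adjx [simp]:
  assumes "r 0 = n" "r u < n" "r v < n"
  shows "ft (adjx u v) r M \<longleftrightarrow> M (r u) (r v) < W"
proof -
  have "(r u + 1) * n \<le> n * n" using assms by (intro mult_right_mono) auto
  then have "r u * n + r v < W" using W_nn assms by simp
  then show ?thesis using W_n assms ev_adjx[OF assms(1,3), of u M] by (auto simp: adjx_def)
qed

text \<open>As the column is below \<open>n\<close>, an address determines row and column by
  division with remainder, so one store changes one matrix entry.\<close>

lemma wp_wr [simp]:
  assumes "r 0 = n" "ev c r M < n" "q \<le> 10"
  shows "wp W (wr q c e) Q (st n r M) \<longleftrightarrow>
    ft c r M \<and> ft e r M \<and> Q (st n r (M(n + q := (M (n + q))(ev c r M := ev e r M))))"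
proof -
  let ?a = "Op Add (Op Mul (Op Add (Reg 0) (Const q)) (Reg 0)) c"
  have 1: "ft ?a r M \<longleftrightarrow> ft c r M"
    using cell_less[OF assms(3,2)] W_n assms(1) by auto
  have "(snd (st n r M))((n + q) * n + ev c r M := x) = snd (st n r (M(n + q := (M (n + q))(ev c r M := x))))" for x
  proof
    fix b
    have "b = (n + q) * n + ev c r M \<longleftrightarrow> b div n = n + q \<and> b mod n = ev c r M"
      using assms(2) div_mult_mod_eq[of b n] by (metis div_mult_self3 div_less add_0 mod_mult_self3 mod_less
          add.commute bot_nat_0.not_eq_extremum not_less_zero)
    then show "((snd (st n r M))((n + q) * n + ev c r M := x)) b = snd (st n r (M(n + q := (M (n + q))(ev c r M := x)))) b"
      by (auto simp: st_def)
  qed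
  then have "(fst (st n r M), (snd (st n r M))(ev ?a r M := x)) = st n r (M(n + q := (M (n + q))(ev c r M := x)))" for x
    using assms(1) by (simp add: st_def)
  then show ?thesis using 1 by (simp only: wr_def wp.simps)
qed

lemma wp_Assign [simp]: "wp W (Assign x e) Q (st n r M) \<longleftrightarrow> ft e r M \<and> Q (st n (r(x := ev e r M)) M)"
  by (simp add: st_def)

declare wp.simps(2,3) [simp del]

definition hoare :: "assertion \<Rightarrow> prog \<Rightarrow> nat \<Rightarrow> assertion \<Rightarrow> bool" where
  "hoare P p T Q \<longleftrightarrow> (\<forall>r M. P r M \<longrightarrow>
     (\<exists>t r' M'. exec W p (st n r M) t (st n r' M') \<and> t \<le> T \<and> Q r' M'))"

definition holds :: "assertion \<Rightarrow> state \<Rightarrow> bool" where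
  "holds Q s \<longleftrightarrow> (\<exists>r M. s = st n r M \<and> Q r M)"

lemma holdsI: "Q r M \<Longrightarrow> holds Q (st n r M)"
  unfolding holds_def by blast

lemma hoare_wp:
  assumes "\<And>r M. P r M \<Longrightarrow> wp W p (holds Q) (st n r M)" "pcost p \<le> T"
  shows "hoare P p T Q"
  unfolding hoare_def
proof (intro allI impI)
  fix r M assume "P r M"
  from wp_exec[OF assms(1)[OF this]] obtain t s' where
    "exec W p (st n r M) t s'" "t \<le> pcost p" "holds Q s'" by blast
  then show "\<exists>t r' M'. exec W p (st n r M) t (st n r' M') \<and> t \<le> T \<and> Q r' M'"
    using assms(2) unfolding holds_def by (metis le_trans)
qed

lemma hoare_conseq:
  assumes "hoare P p T Q" "\<And>r M. P' r M \<Longrightarrow> P r M" "\<And>r M. Q r M \<Longrightarrow> Q' r M" "T \<le> T'"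
  shows "hoare P' p T' Q'"
  using assms unfolding hoare_def by (meson le_trans)

lemma hoare_Seq:
  assumes "hoare P p T1 R" "hoare R q T2 Q"
  shows "hoare P (Seq p q) (T1 + T2) Q"
  unfolding hoare_def
proof (intro allI impI)
  fix r M assume "P r M"
  then obtain t r' M' where 1: "exec W p (st n r M) t (st n r' M')" "t \<le> T1" "R r' M'"
    using assms(1) unfolding hoare_def by blast
  then obtain u r'' M'' where "exec W q (st n r' M') u (st n r'' M'')" "u \<le> T2" "Q r'' M''"
    using assms(2) unfolding hoare_def by blast
  then show "\<exists>t r' M'. exec W (Seq p q) (st n r M) t (st n r' M') \<and> t \<le> T1 + T2 \<and> Q r' M'"
    using exec.Seq[OF 1(1)] 1(2) by (metis add_mono)
qed

text \<open>Each round adds 4 for the test and 4 for the increment. The initial assignment and the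
  last test cost 6 together, covered by the extra round.\<close>

definition for_time :: "nat \<Rightarrow> nat \<Rightarrow> nat" where
  "for_time N T = (N + 1) * (T + 8)"

text \<open>The invariant must survive any assignment to the counter, since initialisation and
  increment change it outside \<open>p\<close>. The strict bound on \<open>N\<close> lets the final
  counter value fit into a word.\<close>

lemma hoare_for:
  assumes N: "N < W" "b \<noteq> c"
    and b: "\<And>i r M. I i r M \<Longrightarrow> r b = N"
    and stable: "\<And>i r M x. I i r M \<Longrightarrow> I i (r(c := x)) M"
    and body: "\<And>i. i < N \<Longrightarrow> hoare (\<lambda>r M. I i r M \<and> r c = i) p T (\<lambda>r M. I (Suc i) r M \<and> r c = i)"
  shows "hoare (I 0) (for_loop c b p) (for_time N T) (I N)"
proof -
  let ?e = "Op Less (Reg c) (Reg b)" and ?q = "Seq p (Assign c (Op Add (Reg c) (Const 1)))"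
  have loop: "\<exists>t r' M'. exec W (While ?e ?q) (st n r M) t (st n r' M') \<and> t \<le> k * (T + 8) + 4 \<and> I N r' M'"
    if "I (N - k) r M" "r c = N - k" "k \<le> N" for k r M
    using that
  proof (induction k arbitrary: r M)
    case 0
    have "exec W (While ?e ?q) (st n r M) (expr_cost ?e + 1) (st n r M)"
      by (rule exec.WhileFalse) (use 0 b[of N r M] N W_small in auto)
    then show ?case using 0 by (intro exI[of _ "expr_cost ?e + 1"] exI[of _ r] exI[of _ M]) simp
  next
    case (Suc k)
    let ?i = "N - Suc k"
    have i: "?i < N" "Suc ?i = N - k" using Suc.prems by auto
    obtain t1 r1 M1 where 1: "exec W p (st n r M) t1 (st n r1 M1)" "t1 \<le> T" "I (N - k) r1 M1" "r1 c = ?i"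
      using body[OF i(1)] Suc.prems i(2) unfolding hoare_def by metis
    have "exec W (Assign c (Op Add (Reg c) (Const 1))) (st n r1 M1) 4 (st n (r1(c := N - k)) M1)"
      using exec.Assign[of W "Op Add (Reg c) (Const 1)" "st n r1 M1" c] 1(4) i N W_small[of 1]
      by (simp add: st_def numeral_eq_Suc)
    from exec.Seq[OF 1(1) this] have 2: "exec W ?q (st n r M) (t1 + 4) (st n (r1(c := N - k)) M1)" .
    obtain t2 r2 M2 where 3: "exec W (While ?e ?q) (st n (r1(c := N - k)) M1) t2 (st n r2 M2)"
        "t2 \<le> k * (T + 8) + 4" "I N r2 M2"
      using Suc.IH[OF stable[OF 1(3)] fun_upd_same] Suc.prems(3) Suc_leD by blast
    have "exec W (While ?e ?q) (st n r M) (expr_cost ?e + 1 + (t1 + 4) + t2) (st n r2 M2)"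
      by (rule exec.WhileTrue[OF _ _ 2 3(1)]) (use Suc.prems b[OF Suc.prems(1)] N W_small[of 1] in auto)
    then show ?case using 1(2) 3(2,3)
      by (intro exI[of _ "expr_cost ?e + 1 + (t1 + 4) + t2"] exI[of _ r2] exI[of _ M2]) simp
  qed
  show ?thesis
    unfolding hoare_def
  proof (intro allI impI)
    fix r M assume I: "I 0 r M"
    have "exec W (Assign c (Const 0)) (st n r M) 2 (st n (r(c := 0)) M)"
      using exec.Assign[of W "Const 0" "st n r M" c] N by (simp add: st_def numeral_eq_Suc)
    moreover have "I (N - N) (r(c := 0)) M" "(r(c := 0)) c = N - N" using stable[OF I] by simp_all
    then obtain t r' M' where t: "exec W (While ?e ?q) (st n (r(c := 0)) M) t (st n r' M')"
        "t \<le> N * (T + 8) + 4" "I N r' M'"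
      using loop[of N "r(c := 0)" M] by blast
    ultimately have "exec W (for_loop c b p) (st n r M) (2 + t) (st n r' M')"
      unfolding for_loop_def by (intro exec.Seq)
    moreover have "2 + t \<le> for_time N T" using t(2) by (simp add: for_time_def)
    ultimately show "\<exists>t r' M'. exec W (for_loop c b p) (st n r M) t (st n r' M') \<and> t \<le> for_time N T \<and> I N r' M'"
      using t(3) by blast
  qed
qed

definition state_at :: "((nat \<Rightarrow> nat) \<Rightarrow> bool) \<Rightarrow> (nat \<Rightarrow> nat \<Rightarrow> nat) \<Rightarrow> assertion" where
  "state_at C M0 r M \<longleftrightarrow> C r \<and> M = M0"

lemma hoare_state_at:
  assumes "\<And>M0. J M0 \<Longrightarrow> hoare (state_at C M0) p T (\<lambda>r M. C r \<and> Q M0 M)"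
  shows "hoare (\<lambda>r M. C r \<and> J M) p T (\<lambda>r M. C r \<and> (\<exists>M0. J M0 \<and> Q M0 M))"
  using assms unfolding hoare_def state_at_def by blast

text \<open>Turns a loop into a fold over memories, so that everything about the result can be
  proved for a function instead of a program. \<open>J\<close> collects what the body needs in order
  to run.\<close>

lemma hoare_for_fold:
  assumes N: "N < W" "b \<noteq> c"
    and b: "\<And>r. C r \<Longrightarrow> r b = N"
    and stable: "\<And>r x. C r \<Longrightarrow> C (r(c := x))"
    and J: "\<And>i M. i < N \<Longrightarrow> J M \<Longrightarrow> J (f i M)" "J M0"
    and body: "\<And>i M0. i < N \<Longrightarrow> J M0 \<Longrightarrow>
      hoare (state_at (\<lambda>r. C r \<and> r c = i) M0) p T (state_at (\<lambda>r. C r \<and> r c = i) (f i M0))"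
  shows "hoare (state_at C M0) (for_loop c b p) (for_time N T) (state_at C (fold f [0..<N] M0))"
proof -
  have J': "J (fold f [0..<i] M0)" if "i \<le> N" for i
    using that by (induction i) (auto simp: J)
  have "hoare (\<lambda>r M. C r \<and> M = fold f [0..<0] M0) (for_loop c b p) (for_time N T)
    (\<lambda>r M. C r \<and> M = fold f [0..<N] M0)"
  proof (rule hoare_for[OF N, where I = "\<lambda>i r M. C r \<and> M = fold f [0..<i] M0"])
    fix i assume i: "i < N"
    show "hoare (\<lambda>r M. (C r \<and> M = fold f [0..<i] M0) \<and> r c = i) p T
        (\<lambda>r M. (C r \<and> M = fold f [0..<Suc i] M0) \<and> r c = i)"
      by (rule hoare_conseq[OF body[OF i J'[of i]]]) (use i in \<open>auto simp: state_at_def\<close>)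
  next
    show "\<And>i r M. C r \<and> M = fold f [0..<i] M0 \<Longrightarrow> r b = N" using b by blast
    show "\<And>i r M x. C r \<and> M = fold f [0..<i] M0 \<Longrightarrow> C (r(c := x)) \<and> M = fold f [0..<i] M0"
      using stable by blast
  qed
  then show ?thesis by (rule hoare_conseq) (simp_all add: state_at_def)
qed

end

lemma pcost_wr [simp]: "pcost (wr q c e) = 7 + expr_cost c + expr_cost e"
  and expr_cost_rd [simp]: "expr_cost (rd q c) = 7 + expr_cost c"
  and expr_cost_adjx [simp]: "expr_cost (adjx u v) = 6"
  by (simp_all add: wr_def rd_def adjx_def)

section \<open>Propagation\<close>

lemma fold_decreasing:
  fixes M :: "'a :: order"
  assumes "\<And>x M. x \<in> set xs \<Longrightarrow> f x M \<le> M"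
  shows "fold f xs M \<le> M"
  using assms
proof (induction xs arbitrary: M)
  case (Cons x xs)
  have "fold f xs (f x M) \<le> f x M" using Cons by simp
  then show ?case using Cons.prems[of x M] by simp
qed simp

text \<open>All steps decrease, so a fold that ends where it started leaves no room for any single
  step to change anything.\<close>

lemma fold_fixed:
  fixes M :: "'a :: order"
  assumes "\<And>x M. x \<in> set xs \<Longrightarrow> f x M \<le> M" "fold f xs M = M" "x \<in> set xs"
  shows "f x M = M"
  using assms
proof (induction xs)
  case (Cons y xs)
  have "fold f xs (f y M) \<le> f y M" using Cons.prems(1) by (intro fold_decreasing) simp
  then have "f y M = M" using Cons.prems(1)[of y M] Cons.prems(2) by (simp add: antisym)
  then show ?case using Cons by auto
qed simp

lemma fold_const: "fold (\<lambda>_. f) xs = f ^^ length xs"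
  by (induction xs) (simp_all add: funpow_swap1 fun_eq_iff)

text \<open>Every application that changes something lowers the sum of the entries in
  \<open>S\<close> by at least one, and that sum starts at no more than \<open>N\<close>.\<close>

lemma iterate_to_fixpoint:
  fixes F :: "(nat \<Rightarrow> nat \<Rightarrow> nat) \<Rightarrow> (nat \<Rightarrow> nat \<Rightarrow> nat)"
  assumes dec: "\<And>M. F M \<le> M" and loc: "\<And>M q v. (q, v) \<notin> S \<Longrightarrow> F M q v = M q v"
    and S: "finite S" and N: "(\<Sum>(q, v)\<in>S. M q v) \<le> N"
  shows "F (fold (\<lambda>_. F) [0..<N] M) = fold (\<lambda>_. F) [0..<N] M"
proof -
  define \<mu> where "\<mu> M = (\<Sum>(q, v)\<in>S. M q v)" for M :: "nat \<Rightarrow> nat \<Rightarrow> nat"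
  have less: "\<mu> (F M) < \<mu> M" if "F M \<noteq> M" for M
  proof -
    have le: "F M q v \<le> M q v" for q v using dec[of M] by (simp add: le_fun_def)
    have "\<exists>q v. F M q v \<noteq> M q v" by (rule ccontr) (use that in \<open>auto simp: fun_eq_iff\<close>)
    then obtain q v where qv: "F M q v \<noteq> M q v" by blast
    then have "(q, v) \<in> S" "F M q v < M q v" using loc le[of q v] by (metis, simp)
    then show ?thesis unfolding \<mu>_def using S le
      by (intro sum_strict_mono_ex1) (auto intro!: bexI[of _ "(q, v)"])
  qed
  have "\<mu> ((F ^^ i) M) + i \<le> \<mu> M \<or> F ((F ^^ i) M) = (F ^^ i) M" for i
  proof (induction i)
    case (Suc i)
    then show ?case using less[of "(F ^^ i) M"] by (cases "F ((F ^^ i) M) = (F ^^ i) M") auto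
  qed simp
  from this[of N] have "F ((F ^^ N) M) = (F ^^ N) M"
    using N less[of "(F ^^ N) M"] unfolding \<mu>_def by fastforce
  then show ?thesis by (simp add: fold_const)
qed

locale solver = P5_free_adj adj n + ram n W for adj (infix "\<sim>" 50) and n W
begin

text \<open>Loop bounds have to sit in registers. These are set once by \<open>setup_prog\<close>
  and kept until the output is written.\<close>

definition base :: "(nat \<Rightarrow> nat) \<Rightarrow> bool" where
  "base r \<longleftrightarrow> r 0 = n \<and> r 1 = 3 * n \<and> r 3 = n * n \<and> r 4 = (3 * n) ^ 12 \<and> r 6 = 12"

lemma base_upd [simp]: "x \<notin> {0, 1, 3, 4, 6} \<Longrightarrow> base (r(x := y)) = base r"
  by (auto simp: base_def)

lemma base_0: "base r \<Longrightarrow> r 0 = n" by (simp add: base_def)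

definition graph_rows :: "(nat \<Rightarrow> nat \<Rightarrow> nat) \<Rightarrow> bool" where
  "graph_rows M \<longleftrightarrow> (\<forall>u<n. \<forall>v<n. M u v = (if u \<sim> v then 1 else 0))"

definition wf :: "(nat \<Rightarrow> nat \<Rightarrow> nat) \<Rightarrow> bool" where
  "wf M \<longleftrightarrow> graph_rows M \<and> (\<forall>c<3. \<forall>v<n. M (n + c) v \<le> 1)"

lemma wf_graph: "wf M \<Longrightarrow> u < n \<Longrightarrow> v < n \<Longrightarrow> M u v = (if u \<sim> v then 1 else 0)"
  by (simp add: wf_def graph_rows_def)

lemma wf_list: "wf M \<Longrightarrow> c < 3 \<Longrightarrow> v < n \<Longrightarrow> M (n + c) v \<le> 1"
  by (simp add: wf_def)

text \<open>Registers 11, 12, 13 hold \<open>u\<close>, \<open>w\<close>, \<open>y\<close>. The list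
  bit is multiplied by truth values; an implication between 0/1 values \<open>p\<close> and
  \<open>q\<close> is computed as \<open>p < 1 + q\<close>.\<close>

definition prune_prog :: "nat \<Rightarrow> nat \<Rightarrow> nat \<Rightarrow> prog" where
  "prune_prog j k l = wr j (Reg 13) (Op Mul (rd j (Reg 13)) (Op Mul
     (Op Less (Const 0) (Op Add (rd k (Reg 11)) (rd l (Reg 11))))
     (Op Less (Op Mul (adjx 11 12) (adjx 12 13)) (Op Add (Const 1) (Op Mul
       (Op Less (Const 0) (Op Add (rd k (Reg 11)) (rd k (Reg 12))))
       (Op Less (Const 0) (Op Add (rd l (Reg 11)) (rd l (Reg 12)))))))))"

definition step_prog :: prog where
  "step_prog = Cond (adjx 11 13) (Seq (prune_prog 0 1 2) (Seq (prune_prog 1 0 2) (prune_prog 2 0 1))) Skip"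

definition keep :: "nat \<Rightarrow> nat \<Rightarrow> nat \<Rightarrow> nat \<Rightarrow> nat \<Rightarrow> (nat \<Rightarrow> nat \<Rightarrow> nat) \<Rightarrow> bool" where
  "keep k l u w y M \<longleftrightarrow> M (n + k) u + M (n + l) u > 0 \<and>
     (u \<sim> w \<and> w \<sim> y \<longrightarrow> M (n + k) u + M (n + k) w > 0 \<and> M (n + l) u + M (n + l) w > 0)"

definition prune :: "nat \<Rightarrow> nat \<Rightarrow> nat \<Rightarrow> nat \<Rightarrow> nat \<Rightarrow> nat \<Rightarrow> (nat \<Rightarrow> nat \<Rightarrow> nat) \<Rightarrow> nat \<Rightarrow> nat \<Rightarrow> nat" where
  "prune j k l u w y M = (if keep k l u w y M then M else M(n + j := (M (n + j))(y := 0)))"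

definition step :: "nat \<Rightarrow> nat \<Rightarrow> nat \<Rightarrow> (nat \<Rightarrow> nat \<Rightarrow> nat) \<Rightarrow> nat \<Rightarrow> nat \<Rightarrow> nat" where
  "step u w y M = (if u \<sim> y then prune 2 0 1 u w y (prune 1 0 2 u w y (prune 0 1 2 u w y M)) else M)"

lemma wf_prune: "wf M \<Longrightarrow> wf (prune j k l u w y M)"
  by (auto simp: wf_def graph_rows_def prune_def)

lemma wf_step: "wf M \<Longrightarrow> wf (step u w y M)"
  by (simp add: step_def wf_prune)

lemma wp_prune_prog:
  assumes "base r" "wf M" "r 11 < n" "r 12 < n" "r 13 < n" "j < 3" "k < 3" "l < 3"
  shows "wp W (prune_prog j k l) Q (st n r M) \<longleftrightarrow> Q (st n r (prune j k l (r 11) (r 12) (r 13) M))"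
proof -
  have le: "M (n + j) (r 13) \<le> 1" "M (n + k) (r 11) \<le> 1" "M (n + l) (r 11) \<le> 1" "M (n + k) (r 12) \<le> 1"
    "M (n + l) (r 12) \<le> 1" using assms wf_list by auto
  then have *: "M (n + j) (r 13) < W" "M (n + k) (r 11) < W" "M (n + l) (r 11) < W" "M (n + k) (r 12) < W"
    "M (n + l) (r 12) < W" "M (n + k) (r 11) + M (n + l) (r 11) < W" "M (n + k) (r 11) + M (n + k) (r 12) < W"
    "M (n + l) (r 11) + M (n + l) (r 12) < W" using W_quadratic by linarith+
  have "r 11 < W" "r 12 < W" "r 13 < W" "0 < W" "Suc 0 < W" "Suc (Suc 0) < W" using W_quadratic assms W_n by linarith+
  then show ?thesis
    using assms(3-8) base_0[OF assms(1)] wf_graph[OF assms(2)] *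
    by (simp add: prune_prog_def prune_def keep_def)
qed

text \<open>The number 300 is a generous bound shared by most loop-free pieces; for the running time
  only its being constant counts. The nested conjunction has the shape in which successive
  applications of \<open>hoare_for_fold\<close> add their counters.\<close>

lemma hoare_step:
  assumes "u < n" "w < n" "y < n" "wf M0" "\<And>r. C r \<Longrightarrow> base r"
  shows "hoare (state_at (\<lambda>r. ((C r \<and> r 11 = u) \<and> r 12 = w) \<and> r 13 = y) M0) step_prog 300
    (state_at (\<lambda>r. ((C r \<and> r 11 = u) \<and> r 12 = w) \<and> r 13 = y) (step u w y M0))"
    (is "hoare (state_at ?D _) _ _ _")
proof (rule hoare_wp)
  fix r M assume "state_at ?D M0 r M"
  then have "C r" "base r" "r 11 = u" "r 12 = w" "r 13 = y" "M = M0" using assms(5) by (simp_all add: state_at_def)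
  then show "wp W step_prog (holds (state_at ?D (step u w y M0))) (st n r M)"
    using assms(1-4) base_0[of r] wf_graph[OF assms(4)] W_small[of 1]
    by (simp add: step_prog_def wp_prune_prog wf_prune step_def holdsI state_at_def)
qed (simp add: step_prog_def prune_prog_def)

definition prop_prog :: prog where
  "prop_prog = for_loop 10 1 (for_loop 11 0 (for_loop 12 0 (for_loop 13 0 step_prog)))"

definition pass :: "(nat \<Rightarrow> nat \<Rightarrow> nat) \<Rightarrow> nat \<Rightarrow> nat \<Rightarrow> nat" where
  "pass = fold (\<lambda>u. fold (\<lambda>w. fold (\<lambda>y. step u w y) [0..<n]) [0..<n]) [0..<n]"

definition propagate :: "(nat \<Rightarrow> nat \<Rightarrow> nat) \<Rightarrow> nat \<Rightarrow> nat \<Rightarrow> nat" where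
  "propagate = fold (\<lambda>_. pass) [0..<3 * n]"

definition prop_time :: nat where
  "prop_time = for_time (3 * n) (for_time n (for_time n (for_time n 300)))"

lemma fold_inv: "(\<And>x M. x \<in> set xs \<Longrightarrow> P M \<Longrightarrow> P (f x M)) \<Longrightarrow> P M \<Longrightarrow> P (fold f xs M)"
  by (rule fold_invariant[where Q = "\<lambda>x. x \<in> set xs"]) auto

lemma pass_inv:
  assumes "\<And>u w y M. u < n \<Longrightarrow> w < n \<Longrightarrow> y < n \<Longrightarrow> P M \<Longrightarrow> P (step u w y M)" "P M"
  shows "P (pass M)"
  unfolding pass_def using assms by (intro fold_inv[where P = P]) auto

lemma propagate_inv:
  assumes "\<And>u w y M. u < n \<Longrightarrow> w < n \<Longrightarrow> y < n \<Longrightarrow> P M \<Longrightarrow> P (step u w y M)" "P M"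
  shows "P (propagate M)"
  unfolding propagate_def by (rule fold_inv[where P = P]) (use assms pass_inv[of P] in blast)+

lemma n_W: "n < W" "3 * n < W" "n * n < W" "12 < W" using W_quadratic by linarith+

lemma hoare_prop:
  assumes "wf M0"
  shows "hoare (state_at (\<lambda>r. base r \<and> r 2 = g) M0) prop_prog prop_time (state_at (\<lambda>r. base r \<and> r 2 = g) (propagate M0))"
proof -
  have inv1: "wf (fold (\<lambda>y. step u w y) [0..<n] M)" if "wf M" for u w M
    by (rule fold_inv[where P = wf, OF wf_step that])
  have inv2: "wf (fold (\<lambda>w. fold (\<lambda>y. step u w y) [0..<n]) [0..<n] M)" if "wf M" for u M
    by (rule fold_inv[where P = wf, OF inv1 that])
  have inv3: "wf (pass M)" if "wf M" for M
    unfolding pass_def by (rule fold_inv[where P = wf, OF inv2 that])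
  let ?C = "\<lambda>r. base r \<and> r 2 = g"
  let ?C0 = "\<lambda>p r. ?C r \<and> r 10 = p" let ?C1 = "\<lambda>p u r. ?C0 p r \<and> r 11 = u"
  let ?C2 = "\<lambda>p u w r. ?C1 p u r \<and> r 12 = w" let ?C3 = "\<lambda>p u w y r. ?C2 p u w r \<and> r 13 = y"
  have 0: "hoare (state_at (?C3 p u w y) M0) step_prog 300
      (state_at (?C3 p u w y) (step u w y M0))"
    if "u < n" "w < n" "y < n" "wf M0" for p u w y M0
    by (rule hoare_step[OF that]) simp
  have 1: "hoare (state_at (?C2 p u w) M0) (for_loop 13 0 step_prog) (for_time n 300)
      (state_at (?C2 p u w) (fold (\<lambda>y. step u w y) [0..<n] M0))"
    if "u < n" "w < n" "wf M0" for p u w M0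
    by (rule hoare_for_fold[where J = wf, OF _ _ _ _ _ _ 0]) (simp_all add: that n_W base_0 wf_step)
  have 2: "hoare (state_at (?C1 p u) M0) (for_loop 12 0 (for_loop 13 0 step_prog))
      (for_time n (for_time n 300))
      (state_at (?C1 p u) (fold (\<lambda>w. fold (\<lambda>y. step u w y) [0..<n]) [0..<n] M0))"
    if "u < n" "wf M0" for p u M0
    by (rule hoare_for_fold[where J = wf, OF _ _ _ _ _ _ 1]) (simp_all add: that n_W base_0 inv1)
  have 3: "hoare (state_at (?C0 p) M0) (for_loop 11 0 (for_loop 12 0 (for_loop 13 0 step_prog)))
      (for_time n (for_time n (for_time n 300))) (state_at (?C0 p) (pass M0))"
    if "wf M0" for p M0
    unfolding pass_def
    by (rule hoare_for_fold[where J = wf, OF _ _ _ _ _ _ 2]) (simp_all add: that n_W base_0 inv2)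
  show ?thesis
    unfolding prop_prog_def propagate_def prop_time_def
    by (rule hoare_for_fold[where J = wf, OF _ _ _ _ _ _ 3]) (simp_all add: assms n_W base_def inv3)
qed

text \<open>Numbers beyond the vertices get full lists, in agreement with
  \<open>guess\<close>.\<close>

definition lists :: "(nat \<Rightarrow> nat \<Rightarrow> nat) \<Rightarrow> nat \<Rightarrow> nat set" where
  "lists M v = (if v < n then {c. c < 3 \<and> M (n + c) v \<noteq> 0} else {..<3})"

lemma step_le: "step u w y M \<le> M"
  by (auto simp: step_def prune_def le_fun_def)

lemma step_frame: "q \<notin> {n..<n + 3} \<or> v \<ge> n \<Longrightarrow> y < n \<Longrightarrow> step u w y M q v = M q v"
  by (auto simp: step_def prune_def)

lemma pass_le: "pass M \<le> M"
  unfolding pass_def by (intro fold_decreasing step_le)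

lemma pass_frame: "q \<notin> {n..<n + 3} \<or> v \<ge> n \<Longrightarrow> pass M q v = M q v"
  by (rule pass_inv[of "\<lambda>M'. M' q v = M q v"]) (auto simp: step_frame)

lemma propagate_frame: "q \<notin> {n..<n + 3} \<or> v \<ge> n \<Longrightarrow> propagate M q v = M q v"
  by (rule propagate_inv[of "\<lambda>M'. M' q v = M q v"]) (auto simp: step_frame)

text \<open>A pass that changes anything deletes one of the at most \<open>3n\<close> list entries.\<close>

lemma propagate_fixed:
  assumes "wf M" "u < n" "w < n" "y < n"
  shows "step u w y (propagate M) = propagate M"
proof -
  have "(\<Sum>(q, v)\<in>{n..<n + 3} \<times> {..<n}. M q v) \<le> (\<Sum>(q, v)\<in>{n..<n + 3} \<times> {..<n}. 1)"
  proof (rule sum_mono, clarify)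
    fix q v assume "q \<in> {n..<n + 3}" "v < n"
    moreover from this have "q - n < 3" by auto
    ultimately show "M q v \<le> 1" using wf_list[OF assms(1), of "q - n" v] by simp
  qed
  then have "pass (propagate M) = propagate M" unfolding propagate_def
    using pass_le pass_frame by (intro iterate_to_fixpoint[where S = "{n..<n + 3} \<times> {..<n}"]) auto
  then have "fold (\<lambda>w. fold (\<lambda>y. step u w y) [0..<n]) [0..<n] (propagate M) = propagate M"
    unfolding pass_def using assms by (intro fold_fixed[where x = u] fold_decreasing step_le) auto
  then have "fold (\<lambda>y. step u w y) [0..<n] (propagate M) = propagate M"
    using assms by (intro fold_fixed[where x = w] fold_decreasing step_le) auto
  then show ?thesis
    using assms by (intro fold_fixed[where x = y] step_le) auto
qed

lemma lists_mono: "M' \<le> M \<Longrightarrow> lists M' \<le> lists M"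
  unfolding lists_def le_fun_def by auto (meson less_le_trans)

lemma prune_le: "prune j k l u w y M \<le> M"
  by (auto simp: prune_def le_fun_def)

text \<open>A failing \<open>keep\<close> exhibits a rule that applies to the current lists. Its
  premise passes to the smaller lists of \<open>L\<close>, and consistency shows that
  \<open>L y\<close> lacks \<open>j\<close> already.\<close>

lemma lists_prune:
  assumes L: "consistent L" "L \<le> lists M" and e: "u \<sim> y" "w < n" and jkl: "{j, k, l} = {..<3}" "j \<noteq> k" "j \<noteq> l"
  shows "L \<le> lists (prune j k l u w y M)"
proof (cases "keep k l u w y M")
  case True
  then show ?thesis using L by (simp add: prune_def)
next
  case False
  have lt: "j < 3" "k < 3" "l < 3" and un: "u < n" "y < n" using jkl(1) adj_less e adj_sym by blast+
  have sub: "L v \<subseteq> lists M v" for v using L(2) by (simp add: le_fun_def)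
  have "j \<notin> L y"
  proof (cases "M (n + k) u + M (n + l) u > 0")
    case False
    have "c = j" if "c \<in> lists M u" for c
    proof -
      have "c \<in> {j, k, l}" using that un unfolding jkl(1) by (simp add: lists_def)
      then show ?thesis using False that un by (auto simp: lists_def)
    qed
    then have "L u \<subseteq> {j}" using sub[of u] by blast
    then show ?thesis by (rule consistent_edge[OF L(1) e(1)])
  next
    case True
    then have uw: "u \<sim> w" "w \<sim> y" and "\<not> (M (n + k) u + M (n + k) w > 0 \<and> M (n + l) u + M (n + l) w > 0)"
      using False by (auto simp: keep_def)
    then obtain i where i: "i \<in> {k, l}" "M (n + i) u = 0" "M (n + i) w = 0" by auto
    have "i \<notin> lists M u" "i \<notin> lists M w" using i(2,3) un e(2) by (simp_all add: lists_def)
    then have "i \<notin> L u" "i \<notin> L w" "i < 3" "j \<noteq> i" using sub[of u] sub[of w] i(1) lt jkl by blast+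
    then show ?thesis using consistent_triangle[OF L(1) uw(1) e(1) uw(2)] by blast
  qed
  moreover have "lists (prune j k l u w y M) v = (if v = y then lists M y - {j} else lists M v)" for v
    using False un by (auto simp: prune_def lists_def)
  ultimately show ?thesis using sub by (auto simp: le_fun_def)
qed

lemma perms: "{0, 1, 2} = {..<3::nat}" "{1, 0, 2} = {..<3::nat}" "{2, 0, 1} = {..<3::nat}"
  by auto

lemma lists_step:
  assumes "consistent L" "L \<le> lists M" "w < n"
  shows "L \<le> lists (step u w y M)"
  using assms(2) unfolding step_def
  by (auto intro!: lists_prune assms perms)

text \<open>The three deletions only decrease, so if their composition changes nothing, neither does
  any one of them.\<close>

lemma step_fixed:
  assumes "step u w y M = M" "u \<sim> y"
  shows "prune 0 1 2 u w y M = M" "prune 1 0 2 u w y M = M" "prune 2 0 1 u w y M = M"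
proof -
  let ?A = "prune 0 1 2 u w y M" let ?B = "prune 1 0 2 u w y ?A"
  have fin: "prune 2 0 1 u w y ?B = M" using assms by (simp add: step_def)
  have "M \<le> ?B" using prune_le[of 2 0 1 u w y ?B] fin by simp
  moreover have "?B \<le> ?A" "?A \<le> M" by (rule prune_le)+
  ultimately have "?A = M" "?B = ?A" by (auto intro: antisym order_trans)
  then show "prune 0 1 2 u w y M = M" "prune 1 0 2 u w y M = M" "prune 2 0 1 u w y M = M" using fin by simp_all
qed

lemma prune_fixed: "prune j k l u w y M = M \<Longrightarrow> \<not> keep k l u w y M \<Longrightarrow> M (n + j) y = 0"
  by (auto simp: prune_def fun_eq_iff split: if_splits)

lemma fixed_lists:
  assumes "step u w y M = M" "u \<sim> y" "j < 3" "\<And>k l. {j, k, l} = {..<3} \<Longrightarrow> j \<noteq> k \<Longrightarrow> j \<noteq> l \<Longrightarrow> \<not> keep k l u w y M"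
  shows "j \<notin> lists M y"
proof -
  consider "j = 0" | "j = 1" | "j = 2" using assms(3) by linarith
  then have "M (n + j) y = 0"
  proof cases
    case 1
    then show ?thesis using prune_fixed[OF step_fixed(1)[OF assms(1,2)]] assms(4)[of 1 2] perms by simp
  next
    case 2
    then show ?thesis using prune_fixed[OF step_fixed(2)[OF assms(1,2)]] assms(4)[of 0 2] perms by simp
  next
    case 3
    then show ?thesis using prune_fixed[OF step_fixed(3)[OF assms(1,2)]] assms(4)[of 0 1] perms by simp
  qed
  then show ?thesis using adj_less[OF adj_sym[OF assms(2)]] by (simp add: lists_def)
qed

text \<open>A common fixpoint of all steps is consistent, and no step removes anything from a
  consistent family below the input. So the fixpoint is the greatest such family.\<close>

lemma propagate_closure:
  assumes "wf M"
  shows "is_closure (lists M) (lists (propagate M))"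
proof -
  let ?M = "propagate M"
  have fixed: "step u w y ?M = ?M" if "u < n" "w < n" "y < n" for u w y
    using propagate_fixed[OF assms that] .
  have out: "lists ?M v \<subseteq> {..<3}" for v by (auto simp: lists_def)
  have "j \<notin> lists ?M v" if uv: "u \<sim> v" "lists ?M u \<subseteq> {j}" for u v j
  proof (cases "j < 3")
    case True
    have un: "u < n" "v < n" using adj_less adj_sym uv by blast+
    \<comment> \<open>The first rule does not involve a third vertex; taking \<open>w = u\<close>
      serves, as the step merely needs some vertex there.\<close>
    show ?thesis
    proof (rule fixed_lists[OF fixed[of u u v] uv(1) True])
      fix k l assume "{j, k, l} = {..<3}" "j \<noteq> k" "j \<noteq> l"
      then have "k < 3" "l < 3" "k \<notin> lists ?M u" "l \<notin> lists ?M u" using uv(2) by auto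
      then show "\<not> keep k l u u v ?M" using un by (simp add: keep_def lists_def)
    qed (use un in auto)
  next
    case False
    then show ?thesis using out[of v] by auto
  qed
  moreover have "j \<notin> lists ?M y"
    if e: "u \<sim> w" "u \<sim> y" "w \<sim> y" "i < 3" "i \<notin> lists ?M u" "i \<notin> lists ?M w" "j \<noteq> i" for u w y j i
  proof (cases "j < 3")
    case True
    have un: "u < n" "w < n" "y < n" using adj_less adj_sym e by blast+
    show ?thesis
    proof (rule fixed_lists[OF fixed[of u w y] e(2) True])
      fix k l assume kl: "{j, k, l} = {..<3}" "j \<noteq> k" "j \<noteq> l"
      have "i \<in> {j, k, l}" using e(4) unfolding kl(1) by simp
      then have "i = k \<or> i = l" using e(7) by auto
      then show "\<not> keep k l u w y ?M" using un e by (auto simp: keep_def lists_def)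
    qed (use un in auto)
  next
    case False
    then show ?thesis using out[of y] by auto
  qed
  ultimately have "consistent (lists ?M)" unfolding consistent_def by blast
  moreover have "?M \<le> M" unfolding propagate_def by (intro fold_decreasing pass_le)
  then have "lists ?M \<le> lists M" by (rule lists_mono)
  moreover have "L \<le> lists ?M" if "consistent L" "L \<le> lists M" for L
    by (rule propagate_inv[of "\<lambda>M. L \<le> lists M"]) (use that lists_step in blast)+
  ultimately show ?thesis unfolding is_closure_def by blast
qed

section \<open>Row-wise frames, initial lists and the decoding of a guess\<close>

definition frame :: "nat set \<Rightarrow> (nat \<Rightarrow> nat \<Rightarrow> nat) \<Rightarrow> (nat \<Rightarrow> nat \<Rightarrow> nat) \<Rightarrow> bool" where
  "frame Rs M M0 \<longleftrightarrow> (\<forall>q. q \<notin> Rs \<longrightarrow> M q = M0 q)"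

lemma frame_refl [simp]: "frame Rs M M" by (simp add: frame_def)
lemma frame_upd [simp]: "q \<in> Rs \<Longrightarrow> frame Rs M M0 \<Longrightarrow> frame Rs (M(q := f)) M0" by (auto simp: frame_def)
lemma frameD: "frame Rs M M0 \<Longrightarrow> q \<notin> Rs \<Longrightarrow> M q = M0 q" by (simp add: frame_def)

lemma graph_rows_frame: "frame Rs M M0 \<Longrightarrow> Rs \<subseteq> {n..} \<Longrightarrow> graph_rows M0 \<Longrightarrow> graph_rows M"
  unfolding graph_rows_def frame_def by (metis atLeast_iff leD subsetD)

lemma hoare_Seq_at:
  assumes "hoare (state_at C M0) p T1 (\<lambda>r M. C r \<and> R M)" "\<And>M1. R M1 \<Longrightarrow> hoare (state_at C M1) q T2 Q"
  shows "hoare (state_at C M0) (Seq p q) (T1 + T2) Q"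
proof (rule hoare_Seq[OF assms(1)])
  show "hoare (\<lambda>r M. C r \<and> R M) q T2 Q"
    using assms(2) unfolding hoare_def state_at_def by blast
qed

lemma all_less_3: "(\<forall>c<3. P c) \<longleftrightarrow> P 0 \<and> P 1 \<and> P (2::nat)"
  by (auto simp: numeral_3_eq_3 numeral_2_eq_2 less_Suc_eq)

abbreviation ctx :: "nat \<Rightarrow> (nat \<Rightarrow> nat) \<Rightarrow> bool" where
  "ctx g r \<equiv> base r \<and> r 2 = g"

abbreviation init_body :: prog where
  "init_body \<equiv> Seq (wr 0 (Reg 10) (Const 1)) (Seq (wr 1 (Reg 10) (Const 1)) (wr 2 (Reg 10) (Const 1)))"

definition init_prog :: prog where
  "init_prog = for_loop 10 0 init_body"

lemma hoare_init:
  "hoare (state_at (ctx g) M0) init_prog (for_time n 300)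
     (\<lambda>r M. ctx g r \<and> frame {n..<n + 3} M M0 \<and> (\<forall>c<3. \<forall>v<n. M (n + c) v = 1))"
proof -
  let ?I = "\<lambda>i r M. ctx g r \<and> frame {n..<n + 3} M M0 \<and> (\<forall>c<3. \<forall>v<i. M (n + c) v = 1)"
  have "hoare (?I 0) init_prog (for_time n 300) (?I n)"
    unfolding init_prog_def
  proof (rule hoare_for[where I = ?I])
    fix i assume i: "i < n"
    show "hoare (\<lambda>r M. ?I i r M \<and> r 10 = i) init_body 300 (\<lambda>r M. ?I (Suc i) r M \<and> r 10 = i)"
    proof (rule hoare_wp)
      fix r M assume "?I i r M \<and> r 10 = i"
      then show "wp W init_body (holds (\<lambda>r M. ?I (Suc i) r M \<and> r 10 = i)) (st n r M)"
        using i n_W W_small[of 1] base_0[of r] by (simp add: all_less_3 less_Suc_eq holdsI all_conj_distrib)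
    qed simp
  qed (simp_all add: n_W base_0)
  then show ?thesis by (rule hoare_conseq) (simp_all add: state_at_def)
qed

text \<open>A base \<open>3n\<close> digit \<open>x\<close> of the loop counter is the guess that vertex \<open>x mod n\<close> has colour \<open>x div n\<close>.\<close>

definition digit :: "nat \<Rightarrow> nat \<Rightarrow> nat" where
  "digit g j = g div (3 * n) ^ j mod (3 * n)"

text \<open>Digits may name a vertex repeatedly, which lets twelve digits express smaller guesses.
  Contradictory digits leave no colour, that is, an empty list.\<close>

definition guessed :: "nat \<Rightarrow> nat \<Rightarrow> nat \<Rightarrow> nat \<Rightarrow> bool" where
  "guessed g i v c \<longleftrightarrow> (\<forall>j<i. digit g j mod n = v \<longrightarrow> digit g j div n = c)"

text \<open>Register 5 holds the undecoded part of the counter. The machine has no remainder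
  operation, so \<open>x mod m\<close> is computed as \<open>x - (x div m) * m\<close>.\<close>

definition guess_body :: prog where
  "guess_body = Seq (Assign 7 (Op Sub (Reg 5) (Op Mul (Op Div (Reg 5) (Reg 1)) (Reg 1))))
     (Seq (Assign 5 (Op Div (Reg 5) (Reg 1)))
     (Seq (Assign 8 (Op Div (Reg 7) (Reg 0)))
     (Seq (Assign 9 (Op Sub (Reg 7) (Op Mul (Reg 8) (Reg 0))))
     (Seq (wr 0 (Reg 9) (Op Mul (rd 0 (Reg 9)) (Op Equal (Reg 8) (Const 0))))
     (Seq (wr 1 (Reg 9) (Op Mul (rd 1 (Reg 9)) (Op Equal (Reg 8) (Const 1))))
       (wr 2 (Reg 9) (Op Mul (rd 2 (Reg 9)) (Op Equal (Reg 8) (Const 2)))))))))"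

definition guess_prog :: prog where
  "guess_prog = Seq (Assign 5 (Reg 2)) (for_loop 10 6 guess_body)"

definition guess_inv :: "nat \<Rightarrow> (nat \<Rightarrow> nat \<Rightarrow> nat) \<Rightarrow> nat \<Rightarrow> assertion" where
  "guess_inv g M0 i r M \<longleftrightarrow> ctx g r \<and> r 5 = g div (3 * n) ^ i \<and> frame {n..<n + 3} M M0 \<and>
     (\<forall>c<3. \<forall>v<n. M (n + c) v = (if guessed g i v c then 1 else 0))"

lemma wp_guess_body:
  assumes g: "g < (3 * n) ^ 12" and I: "guess_inv g M0 i r M" "r 10 = i"
  shows "wp W guess_body (holds (\<lambda>r M. guess_inv g M0 (Suc i) r M \<and> r 10 = i)) (st n r M)"
proof -
  \<comment> \<open>For \<open>n = 0\<close> there are no guesses, since \<open>(3 * n) ^ 12\<close>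
    is then 0.\<close>
  have n: "0 < n" using g by (cases n) auto
  have r: "base r" "r 0 = n" "r 1 = 3 * n" "r 2 = g" "r 5 = g div (3 * n) ^ i"
    using I by (auto simp: guess_inv_def base_def)
  define h where "h = g div (3 * n) ^ i"
  have h: "h < W" using g W_literals[of 12] unfolding h_def by (meson div_le_dividend le_refl le_less_trans less_trans)
  have le: "h div (3 * n) * (3 * n) \<le> h" "h div (3 * n) \<le> h" "h mod (3 * n) \<le> h" "h mod (3 * n) div n * n \<le> h mod (3 * n)"
    "h mod (3 * n) div n \<le> h mod (3 * n)" "h mod (3 * n) mod n < n" using n by simp_all
  have d: "digit g i = h mod (3 * n)" by (simp add: digit_def h_def)
  have "g div ((3 * n) ^ i * (3 * n)) = h div (3 * n)" unfolding h_def by (rule div_mult2_eq)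
  \<comment> \<open>The divisor is written in the form to which simplification brings
    \<open>(3 * n) ^ Suc i\<close>.\<close>
  then have next_h: "g div (3 * n * (3 ^ i * n ^ i)) = h div (3 * n)"
    by (simp only: power_mult_distrib mult.commute[of "3 ^ i * n ^ i"])
  have gs: "guessed g (Suc i) v c \<longleftrightarrow> guessed g i v c \<and> (h mod (3 * n) mod n = v \<longrightarrow> h mod (3 * n) div n = c)" for v c
    unfolding guessed_def less_Suc_eq d[symmetric] by blast
  have W': "h div (3 * n) * (3 * n) < W" "h div (3 * n) < W" "h mod (3 * n) < W" "h mod (3 * n) div n * n < W"
    "h mod (3 * n) div n < W" "h mod (3 * n) mod n < W" using h le n_W by linarith+
  have Ws: "0 < W" "Suc 0 < W" "2 < W" using n_W by linarith+
  have M: "M (n + c) v = (if guessed g i v c then 1 else 0)" if "c < 3" "v < n" for c v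
    using I that by (simp add: guess_inv_def)
  have fr: "frame {n..<n + 3} M M0" using I by (simp add: guess_inv_def)
  show ?thesis
    unfolding guess_body_def
    using r(2,3) r(5)[folded h_def] h W' le(6) Ws n_W(1,2) M[of 0] M[of 1] M[of 2]
    by (simp add: minus_div_mult_eq_mod; intro conjI impI holdsI)
      (simp_all add: guess_inv_def r I(2) fr all_less_3 gs next_h)
qed

lemma hoare_guess:
  assumes g: "g < (3 * n) ^ 12" and M0: "\<forall>c<3. \<forall>v<n. M0 (n + c) v = 1"
  shows "hoare (state_at (ctx g) M0) guess_prog (2 + for_time 12 300)
     (\<lambda>r M. ctx g r \<and> frame {n..<n + 3} M M0 \<and> (\<forall>c<3. \<forall>v<n. M (n + c) v = (if guessed g 12 v c then 1 else 0)))" (is "hoare _ _ _ ?Q")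
  unfolding guess_prog_def
proof (rule hoare_Seq)
  show "hoare (state_at (ctx g) M0) (Assign 5 (Reg 2)) 2 (guess_inv g M0 0)"
  proof (rule hoare_wp)
    fix r M assume "state_at (ctx g) M0 r M"
    moreover have "g < W" using g W_literals[of 12] by simp
    ultimately show "wp W (Assign 5 (Reg 2)) (holds (guess_inv g M0 0)) (st n r M)"
      using M0 by (simp add: state_at_def guess_inv_def guessed_def holdsI)
  qed simp
  have "hoare (guess_inv g M0 0) (for_loop 10 6 guess_body) (for_time 12 300) (guess_inv g M0 12)"
  proof (rule hoare_for)
    fix i assume "i < (12::nat)"
    show "hoare (\<lambda>r M. guess_inv g M0 i r M \<and> r 10 = i) guess_body 300 (\<lambda>r M. guess_inv g M0 (Suc i) r M \<and> r 10 = i)"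
      by (rule hoare_wp) (use wp_guess_body[OF g] in \<open>auto simp: guess_body_def\<close>)
  qed (simp_all add: n_W guess_inv_def base_def)
  then show "hoare (guess_inv g M0 0) (for_loop 10 6 guess_body) (for_time 12 300)
     ?Q"
    by (rule hoare_conseq) (simp_all add: guess_inv_def)
qed

text \<open>The list read as a three-bit number, so that two lists are compared in constant time; 6
  stands for \<open>{1, 2}\<close> and 5 for \<open>{0, 2}\<close>.\<close>

definition code :: "(nat \<Rightarrow> nat \<Rightarrow> nat) \<Rightarrow> nat \<Rightarrow> nat" where
  "code M v = M n v + (2 * M (n + 1) v + 4 * M (n + 2) v)"

lemma code_le: "wf M \<Longrightarrow> v < n \<Longrightarrow> code M v \<le> 7"
  using wf_list[of M 0 v] wf_list[of M 1 v] wf_list[of M 2 v] by (simp add: code_def)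

lemma three_bits:
  fixes x y z x' y' z' :: nat
  assumes "x \<le> 1" "y \<le> 1" "z \<le> 1" "x' \<le> 1" "y' \<le> 1" "z' \<le> 1"
  shows "x + (2 * y + 4 * z) = x' + (2 * y' + 4 * z') \<longleftrightarrow>
    (x \<noteq> 0 \<longleftrightarrow> x' \<noteq> 0) \<and> (y \<noteq> 0 \<longleftrightarrow> y' \<noteq> 0) \<and> (z \<noteq> 0 \<longleftrightarrow> z' \<noteq> 0)"
proof -
  have "x = 0 \<or> x = 1" "y = 0 \<or> y = 1" "z = 0 \<or> z = 1" "x' = 0 \<or> x' = 1" "y' = 0 \<or> y' = 1" "z' = 0 \<or> z' = 1"
    using assms by linarith+
  then show ?thesis by (elim disjE; simp)
qed

lemma lists_eq_iff:
  assumes "S \<subseteq> {..<3}" "v < n"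
  shows "lists M v = S \<longleftrightarrow> (M n v \<noteq> 0 \<longleftrightarrow> 0 \<in> S) \<and> (M (n + 1) v \<noteq> 0 \<longleftrightarrow> 1 \<in> S) \<and> (M (n + 2) v \<noteq> 0 \<longleftrightarrow> 2 \<in> S)"
proof -
  have "lists M v = S \<longleftrightarrow> (\<forall>c<3. c \<in> lists M v \<longleftrightarrow> c \<in> S)"
    using assms by (auto simp: lists_def)
  then show ?thesis unfolding all_less_3 using assms(2) by (simp add: lists_def)
qed

lemma code_lists:
  assumes M: "wf M" and v: "v < n"
  shows "u < n \<Longrightarrow> code M u = code M v \<longleftrightarrow> lists M u = lists M v"
    "code M v = 6 \<longleftrightarrow> lists M v = {1, 2}" "code M v = 5 \<longleftrightarrow> lists M v = {0, 2}"
proof -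
  have le: "M n w \<le> 1" "M (n + 1) w \<le> 1" "M (n + 2) w \<le> 1" if "w < n" for w
    using wf_list[OF M, of 0 w] wf_list[OF M, of 1 w] wf_list[OF M, of 2 w] that by simp_all
  have mem: "0 \<in> lists M v \<longleftrightarrow> M n v \<noteq> 0" "1 \<in> lists M v \<longleftrightarrow> M (n + 1) v \<noteq> 0" "2 \<in> lists M v \<longleftrightarrow> M (n + 2) v \<noteq> 0"
    using v by (simp_all add: lists_def)
  have sub: "lists M v \<subseteq> {..<3}" by (auto simp: lists_def)
  show "code M u = code M v \<longleftrightarrow> lists M u = lists M v" if u: "u < n"
    unfolding lists_eq_iff[OF sub u] mem code_def by (rule three_bits; rule le; fact)
  show "code M v = 6 \<longleftrightarrow> lists M v = {1, 2}"
    using three_bits[OF le[OF v], of 0 1 1] lists_eq_iff[of "{1, 2}" v M] v by (simp add: code_def)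
  show "code M v = 5 \<longleftrightarrow> lists M v = {0, 2}"
    using three_bits[OF le[OF v], of 1 0 1] lists_eq_iff[of "{0, 2}" v M] v by (simp add: code_def)
qed

abbreviation code_row :: prog where
  "code_row \<equiv> wr 5 (Reg 10) (Op Add (rd 0 (Reg 10))
     (Op Add (Op Mul (Const 2) (rd 1 (Reg 10))) (Op Mul (Const 4) (rd 2 (Reg 10)))))"

definition code_prog :: prog where
  "code_prog = for_loop 10 0 code_row"

lemma hoare_code:
  assumes M0: "wf M0"
  shows "hoare (state_at (ctx g) M0) code_prog (for_time n 300)
     (\<lambda>r M. ctx g r \<and> frame {n + 5} M M0 \<and> (\<forall>v<n. M (n + 5) v = code M0 v))"
proof -
  let ?I = "\<lambda>i r M. ctx g r \<and> frame {n + 5} M M0 \<and> (\<forall>v<i. M (n + 5) v = code M0 v)"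
  have "hoare (?I 0) code_prog (for_time n 300) (?I n)"
    unfolding code_prog_def
  proof (rule hoare_for[where I = ?I])
    fix i assume i: "i < n"
    show "hoare (\<lambda>r M. ?I i r M \<and> r 10 = i) code_row 300 (\<lambda>r M. ?I (Suc i) r M \<and> r 10 = i)"
    proof (rule hoare_wp)
      fix r M assume a: "?I i r M \<and> r 10 = i"
      have rows: "M n = M0 n" "M (n + 1) = M0 (n + 1)" "M (n + 2) = M0 (n + 2)"
        using a frameD[of "{n + 5}" M M0] by auto
      have le: "M0 n i \<le> 1" "M0 (n + 1) i \<le> 1" "M0 (n + 2) i \<le> 1"
        using wf_list[OF M0, of 0 i] wf_list[OF M0, of 1 i] wf_list[OF M0, of 2 i] i by simp_all
      have W': "M0 n i < W" "M0 (n + 1) i < W" "M0 (n + 2) i < W" "2 < W" "4 < W" "2 * M0 (n + 1) i < W" "4 * M0 (n + 2) i < W"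
        "2 * M0 (n + 1) i + 4 * M0 (n + 2) i < W" "M0 n i + (2 * M0 (n + 1) i + 4 * M0 (n + 2) i) < W"
        using le W_quadratic by linarith+
      show "wp W code_row (holds (\<lambda>r M. ?I (Suc i) r M \<and> r 10 = i)) (st n r M)"
        using a i rows W' n_W base_0[of r] by (simp add: holdsI code_def less_Suc_eq)
    qed simp
  qed (simp_all add: n_W base_0)
  then show ?thesis by (rule hoare_conseq) (simp_all add: state_at_def)
qed

section \<open>Evaluating a guess\<close>

text \<open>A bounded existential quantifier whose truth value ends up in register 15.\<close>

definition flag_loop :: "nat \<Rightarrow> expr \<Rightarrow> prog" where
  "flag_loop c e = Seq (Assign 15 (Const 0)) (for_loop c 0 (Cond e (Assign 15 (Const 1)) Skip))"

definition flag_time :: nat where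
  "flag_time = 2 + for_time n 300"

lemma hoare_flag_loop:
  assumes base: "\<And>r. C r \<Longrightarrow> base r" and c: "0 \<noteq> c" "15 \<noteq> c"
    and stable: "\<And>r x. C r \<Longrightarrow> C (r(c := x))" "\<And>r x. C r \<Longrightarrow> C (r(15 := x))"
    and test: "\<And>r i. C r \<Longrightarrow> r c = i \<Longrightarrow> i < n \<Longrightarrow> ft e r M0 \<and> (ev e r M0 \<noteq> 0 \<longleftrightarrow> P i)"
    and cost: "expr_cost e \<le> 200"
  shows "hoare (state_at C M0) (flag_loop c e) flag_time
    (\<lambda>r M. C r \<and> M = M0 \<and> r 15 = (if \<exists>i<n. P i then 1 else 0))"
  unfolding flag_loop_def flag_time_def
proof (rule hoare_Seq)
  let ?I = "\<lambda>i r M. C r \<and> M = M0 \<and> r 15 = (if \<exists>j<i. P j then 1 else 0)"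
  have W': "0 < W" "Suc 0 < W" using n_W by linarith+
  show "hoare (state_at C M0) (Assign 15 (Const 0)) 2 (?I 0)"
    by (rule hoare_wp) (simp_all add: state_at_def holdsI stable W')
  show "hoare (?I 0) (for_loop c 0 (Cond e (Assign 15 (Const 1)) Skip)) (for_time n 300) (?I n)"
  proof (rule hoare_for[where I = ?I])
    fix i assume i: "i < n"
    show "hoare (\<lambda>r M. ?I i r M \<and> r c = i) (Cond e (Assign 15 (Const 1)) Skip) 300 (\<lambda>r M. ?I (Suc i) r M \<and> r c = i)"
    proof (rule hoare_wp)
      fix r M assume a: "?I i r M \<and> r c = i"
      then have t: "ft e r M" "ev e r M \<noteq> 0 \<longleftrightarrow> P i" using test[of r i] i by auto
      show "wp W (Cond e (Assign 15 (Const 1)) Skip) (holds (\<lambda>r M. ?I (Suc i) r M \<and> r c = i)) (st n r M)"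
      proof (cases "P i")
        case True
        then have "\<exists>j<Suc i. P j" by blast
        then show ?thesis using True a t stable(2)[of r] c W' by (simp add: holdsI)
      next
        case False
        then have "(\<exists>j<Suc i. P j) \<longleftrightarrow> (\<exists>j<i. P j)" using less_Suc_eq by auto
        then show ?thesis using False a t by (simp add: holdsI)
      qed
    qed (use cost in simp)
  next
    show "\<And>i r M. ?I i r M \<Longrightarrow> r 0 = n" using base base_0 by blast
    show "\<And>i r M x. ?I i r M \<Longrightarrow> ?I i (r(c := x)) M" using stable(1) c by simp
  qed (use n_W c in auto)
qed

abbreviation flags_time :: nat where
  "flags_time \<equiv> for_time n (flag_time + 300)"

abbreviation key_time :: nat where
  "key_time \<equiv> for_time n (2 + (flags_time + 300))"

abbreviation best_time :: nat where
  "best_time \<equiv> for_time n (4 + (flags_time + 300))"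

section \<open>Computing the keys\<close>

definition key_add :: prog where
  "key_add = Cond (Op Mul (Reg 15) (Op Equal (rd 5 (Reg 11)) (rd 5 (Reg 10))))
     (Assign 14 (Op Add (Op Mul (Op Add (Op Div (Reg 14) (Reg 0)) (Const 1)) (Reg 0)) (Reg 11))) Skip"

definition key_inner :: prog where
  "key_inner = Seq (flag_loop 12 (Op Mul (Op Mul (adjx 10 12) (adjx 12 11)) (Op Equal (rd 5 (Reg 12)) (rd 5 (Reg 10))))) key_add"

abbreviation key_row :: prog where
  "key_row \<equiv> Seq (Assign 14 (Const 0)) (Seq (for_loop 11 0 key_inner) (wr 6 (Reg 10) (Reg 14)))"

definition key_prog :: prog where
  "key_prog = for_loop 10 0 key_row"

definition mark :: "(nat \<Rightarrow> nat) \<Rightarrow> nat \<Rightarrow> nat \<Rightarrow> bool" where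
  "mark cd v x \<longleftrightarrow> cd x = cd v \<and> (\<exists>u<n. v \<sim> u \<and> u \<sim> x \<and> cd u = cd v)"

definition partial_key :: "(nat \<Rightarrow> nat) \<Rightarrow> nat \<Rightarrow> nat \<Rightarrow> nat" where
  "partial_key cd v i = (let S = {x. x < i \<and> mark cd v x} in if S = {} then 0 else card S * n + Max S)"

lemma partial_key_0: "partial_key cd v 0 = 0"
  by (simp add: partial_key_def)

text \<open>Vertices are visited in increasing order, so a new member is the new maximum: the
  quotient, which is the size, grows by one and the remainder is replaced.\<close>

lemma partial_key_Suc:
  assumes "i < n"
  shows "partial_key cd v (Suc i) = (if mark cd v i then (partial_key cd v i div n + 1) * n + i else partial_key cd v i)"
proof (cases "mark cd v i")
  case True
  define S where "S = {x. x < i \<and> mark cd v x}"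
  have S: "{x. x < Suc i \<and> mark cd v x} = insert i S" "finite S" "i \<notin> S" "\<And>x. x \<in> S \<Longrightarrow> x < i"
    using True by (auto simp: S_def less_Suc_eq)
  have "partial_key cd v i div n = card S"
  proof (cases "S = {}")
    case False
    then have "Max S < n" using S(2,4) assms by (meson Max_in less_trans)
    then show ?thesis using False unfolding partial_key_def S_def[symmetric] by (simp add: Let_def)
  qed (simp add: partial_key_def S_def[symmetric])
  moreover have "Max (insert i S) = i" using S by (intro Max_eqI) (auto simp: less_imp_le)
  ultimately show ?thesis using True S by (simp add: partial_key_def)
next
  case False
  then have "{x. x < Suc i \<and> mark cd v x} = {x. x < i \<and> mark cd v x}" by (auto simp: less_Suc_eq)
  then show ?thesis using False by (simp add: partial_key_def)
qed

lemma partial_key_le: "i \<le> n \<Longrightarrow> partial_key cd v i \<le> n * n + n"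
proof -
  assume i: "i \<le> n"
  define S where "S = {x. x < i \<and> mark cd v x}"
  have "S \<subseteq> {..<i}" by (auto simp: S_def)
  then have "card S \<le> i" "finite S" using card_mono[of "{..<i}" S] finite_subset by auto
  moreover have "Max S < n" if "S \<noteq> {}"
    using Max_in[OF \<open>finite S\<close> that] i by (auto simp: S_def)
  moreover have "card S * n \<le> n * n" using \<open>card S \<le> i\<close> i by (intro mult_right_mono) auto
  ultimately have "S \<noteq> {} \<Longrightarrow> card S * n + Max S \<le> n * n + n" by (metis add_mono less_imp_le)
  then show ?thesis unfolding partial_key_def S_def[symmetric] Let_def by simp
qed

lemma W_key: "partial_key cd v i \<le> n * n + n \<Longrightarrow> x < n \<Longrightarrow> (partial_key cd v i div n + 1) * n + x < W
   \<and> (partial_key cd v i div n + 1) * n < W \<and> partial_key cd v i div n + 1 < W \<and> partial_key cd v i div n < W \<and> partial_key cd v i < W"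
proof -
  assume a: "partial_key cd v i \<le> n * n + n" "x < n"
  let ?k = "partial_key cd v i"
  have "?k div n * n \<le> ?k" "?k div n \<le> ?k" by simp_all
  then have "(?k div n + 1) * n \<le> ?k + n" by simp
  then show ?thesis using a \<open>?k div n \<le> ?k\<close> W_quadratic by linarith
qed

lemma hoare_key_inner:
  assumes M0: "graph_rows M0" "\<And>v. v < n \<Longrightarrow> M0 (n + 5) v = cd v" "\<And>v. v < n \<Longrightarrow> cd v \<le> 7"
    and v: "v < n" and x: "x < n"
  shows "hoare (state_at (\<lambda>r. (ctx g r \<and> r 10 = v \<and> r 14 = partial_key cd v x) \<and> r 11 = x) M0) key_inner (flag_time + 300)
    (\<lambda>r M. (ctx g r \<and> r 10 = v \<and> r 14 = partial_key cd v (Suc x) \<and> M = M0) \<and> r 11 = x)"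
  unfolding key_inner_def
proof (rule hoare_Seq)
  let ?P = "\<exists>u<n. v \<sim> u \<and> u \<sim> x \<and> cd u = cd v"
  have cd: "cd u < W" if "u < n" for u using M0(3)[OF that] W_small[of "cd u"] by simp
  have W': "0 < W" "Suc 0 < W" "n < W" using n_W by linarith+
  let ?C = "\<lambda>r. (ctx g r \<and> r 10 = v \<and> r 14 = partial_key cd v x) \<and> r 11 = x"
  show "hoare (state_at ?C M0) (flag_loop 12 (Op Mul (Op Mul (adjx 10 12) (adjx 12 11)) (Op Equal (rd 5 (Reg 12)) (rd 5 (Reg 10)))))
    flag_time (\<lambda>r M. ?C r \<and> M = M0 \<and> r 15 = (if ?P then 1 else 0))"
  proof (rule hoare_flag_loop)
    fix r i assume a: "?C r" "r 12 = i" "i < n"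
    then have r: "r 0 = n" "r 10 = v" "r 11 = x" "r 12 = i" using base_0[of r] by auto
    have A: "M0 v i = (if v \<sim> i then 1 else 0)" "M0 i x = (if i \<sim> x then 1 else 0)"
      using M0(1) v x a(3) by (simp_all add: graph_rows_def)
    show "ft (Op Mul (Op Mul (adjx 10 12) (adjx 12 11)) (Op Equal (rd 5 (Reg 12)) (rd 5 (Reg 10)))) r M0 \<and>
      (ev (Op Mul (Op Mul (adjx 10 12) (adjx 12 11)) (Op Equal (rd 5 (Reg 12)) (rd 5 (Reg 10)))) r M0 \<noteq> 0
       \<longleftrightarrow> v \<sim> i \<and> i \<sim> x \<and> cd i = cd v)"
      using r v x a(3) A M0(2) cd W' by simp
  qed simp_all
  show "hoare (\<lambda>r M. ?C r \<and> M = M0 \<and> r 15 = (if ?P then 1 else 0)) key_add 300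
    (\<lambda>r M. (ctx g r \<and> r 10 = v \<and> r 14 = partial_key cd v (Suc x) \<and> M = M0) \<and> r 11 = x)"
  proof (rule hoare_wp)
    fix r M assume a: "?C r \<and> M = M0 \<and> r 15 = (if ?P then 1 else 0)"
    define P where "P \<longleftrightarrow> ?P"
    have k: "partial_key cd v (Suc x) = (if cd x = cd v \<and> P then (partial_key cd v x div n + 1) * n + x else partial_key cd v x)"
      using partial_key_Suc[OF x] by (simp add: mark_def P_def)
    have r: "r 0 = n" using a base_0 by blast
    have k_le: "partial_key cd v x \<le> n * n + n" using partial_key_le x by simp
    show "wp W key_add (holds (\<lambda>r M. (ctx g r \<and> r 10 = v \<and> r 14 = partial_key cd v (Suc x) \<and> M = M0) \<and> r 11 = x)) (st n r M)"
      using a[folded P_def] r v x M0(2) cd W' W_key[OF k_le x] unfolding key_add_def k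
      by (simp add: holdsI)
  qed (simp add: key_add_def)
qed

lemma hoare_key:
  assumes M0: "graph_rows M0" "\<And>v. v < n \<Longrightarrow> M0 (n + 5) v = cd v" "\<And>v. v < n \<Longrightarrow> cd v \<le> 7"
  shows "hoare (state_at (ctx g) M0) key_prog key_time
    (\<lambda>r M. ctx g r \<and> frame {n + 6} M M0 \<and> (\<forall>v<n. M (n + 6) v = partial_key cd v n))"
proof -
  let ?I = "\<lambda>i r M. ctx g r \<and> frame {n + 6} M M0 \<and> (\<forall>v<i. M (n + 6) v = partial_key cd v n)"
  have "hoare (?I 0) key_prog key_time (?I n)"
    unfolding key_prog_def
  proof (rule hoare_for[where I = ?I])
    fix v assume v: "v < n"
    have *: "hoare (state_at (\<lambda>r. ctx g r \<and> r 10 = v) M1)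
        key_row
        (2 + (flags_time + 300))
        (\<lambda>r M. (ctx g r \<and> r 10 = v) \<and> M = M1(n + 6 := (M1 (n + 6))(v := partial_key cd v n)))"
      if M1: "frame {n + 6} M1 M0" for M1
    proof (rule hoare_Seq[OF _ hoare_Seq])
      let ?J = "\<lambda>i r M. ctx g r \<and> r 10 = v \<and> r 14 = partial_key cd v i \<and> M = M1"
      have g1: "graph_rows M1" using graph_rows_frame[OF M1 _ M0(1)] by simp
      have c1: "M1 (n + 5) u = cd u" if "u < n" for u using M0(2)[OF that] frameD[OF M1, of "n + 5"] by simp
      show "hoare (state_at (\<lambda>r. ctx g r \<and> r 10 = v) M1) (Assign 14 (Const 0)) 2 (?J 0)"
        using n_W by (intro hoare_wp) (simp_all add: state_at_def holdsI partial_key_0)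
      show "hoare (?J 0) (for_loop 11 0 key_inner) flags_time (?J n)"
      proof (rule hoare_for[where I = ?J])
        fix x assume x: "x < n"
        show "hoare (\<lambda>r M. ?J x r M \<and> r 11 = x) key_inner (flag_time + 300) (\<lambda>r M. ?J (Suc x) r M \<and> r 11 = x)"
          by (rule hoare_conseq[OF hoare_key_inner[OF g1 c1 M0(3) v x]]) (simp_all add: state_at_def)
      qed (simp_all add: n_W base_0)
      show "hoare (?J n) (wr 6 (Reg 10) (Reg 14)) 300
        (\<lambda>r M. (ctx g r \<and> r 10 = v) \<and> M = M1(n + 6 := (M1 (n + 6))(v := partial_key cd v n)))"
      proof (rule hoare_wp)
        fix r M assume a: "?J n r M"
        then show "wp W (wr 6 (Reg 10) (Reg 14)) (holds (\<lambda>r M. (ctx g r \<and> r 10 = v) \<and>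
            M = M1(n + 6 := (M1 (n + 6))(v := partial_key cd v n)))) (st n r M)"
          using v n_W base_0[of r] W_key[OF partial_key_le v, of n cd v] by (simp add: holdsI)
      qed simp
    qed
    show "hoare (\<lambda>r M. ?I v r M \<and> r 10 = v)
        key_row
        (2 + (flags_time + 300)) (\<lambda>r M. ?I (Suc v) r M \<and> r 10 = v)"
      by (rule hoare_conseq[OF hoare_state_at[where C = "\<lambda>r. ctx g r \<and> r 10 = v" and
            J = "\<lambda>M. frame {n + 6} M M0 \<and> (\<forall>x<v. M (n + 6) x = partial_key cd x n)", OF *]])
        (auto simp: less_Suc_eq)
  qed (simp_all add: n_W base_0)
  then show ?thesis by (rule hoare_conseq) (simp_all add: state_at_def)
qed

definition col_test :: expr where
  "col_test = Op Mul (adjx 10 11) (Op Less (Const 0) (Op Add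
     (Op Mul (Op Equal (rd 5 (Reg 11)) (rd 5 (Reg 10))) (Op Less (rd 6 (Reg 10)) (rd 6 (Reg 11))))
     (Op Mul (Op Equal (rd 5 (Reg 10)) (Const 6)) (Op Equal (rd 5 (Reg 11)) (Const 5)))))"

text \<open>With list bits \<open>a0\<close>, \<open>a1\<close>, \<open>a2\<close>, the two branches
  evaluate \<open>lo\<close> as \<open>(1 - a0) * (2 - a1)\<close> and \<open>hi\<close> as
  \<open>2 * a2 + (1 - a2) * a1\<close>.\<close>

definition col_set :: prog where
  "col_set = Cond (Reg 15)
     (wr 7 (Reg 10) (Op Mul (Op Sub (Const 1) (rd 0 (Reg 10))) (Op Sub (Const 2) (rd 1 (Reg 10)))))
     (wr 7 (Reg 10) (Op Add (Op Mul (Const 2) (rd 2 (Reg 10)))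
       (Op Mul (Op Sub (Const 1) (rd 2 (Reg 10))) (rd 1 (Reg 10)))))"

definition col_prog :: prog where
  "col_prog = for_loop 10 0 (Seq (flag_loop 11 col_test) col_set)"

lemma mark_own: assumes "wf M" "v < n" shows "{x. x < n \<and> mark (code M) v x} = own (lists M) v"
proof -
  have "mark (code M) v x \<longleftrightarrow> x \<in> own (lists M) v" if "x < n" for x
    unfolding mark_def own_def using code_lists(1)[OF assms] that adj_less adj_sym by blast
  moreover have "x < n" if "x \<in> own (lists M) v" for x
    using that adj_less adj_sym unfolding own_def by blast
  ultimately show ?thesis by blast
qed

lemma partial_key_key: "wf M \<Longrightarrow> v < n \<Longrightarrow> partial_key (code M) v n = key (lists M) v"
  unfolding partial_key_def key_def by (simp only: mark_own Let_def)

lemma flag_code: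
  assumes "wf M" "v < n"
  shows "flag (lists M) v \<longleftrightarrow> (\<exists>u<n. v \<sim> u \<and> (code M u = code M v \<and> partial_key (code M) v n < partial_key (code M) u n
    \<or> code M v = 6 \<and> code M u = 5))"
proof -
  have "lists M u = lists M v \<and> key (lists M) v < key (lists M) u \<or> lists M v = {1, 2} \<and> lists M u = {0, 2} \<longleftrightarrow>
    code M u = code M v \<and> partial_key (code M) v n < partial_key (code M) u n \<or> code M v = 6 \<and> code M u = 5" if "u < n" for u
    using code_lists(1)[OF assms that] code_lists(2)[OF assms] code_lists(3)[OF assms(1) that]
      partial_key_key[OF assms] partial_key_key[OF assms(1) that] by simp
  moreover have "u < n" if "v \<sim> u" for u using adj_less adj_sym that by blast
  ultimately show ?thesis unfolding flag_def by (intro ex_cong1) metis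
qed

lemma hoare_col:
  assumes M0: "wf M0" "\<And>v. v < n \<Longrightarrow> M0 (n + 5) v = code M0 v" "\<And>v. v < n \<Longrightarrow> M0 (n + 6) v = partial_key (code M0) v n"
  shows "hoare (state_at (ctx g) M0) col_prog flags_time
    (\<lambda>r M. ctx g r \<and> frame {n + 7} M M0 \<and> (\<forall>v<n. M (n + 7) v = col (lists M0) v))"
proof -
  let ?I = "\<lambda>i r M. ctx g r \<and> frame {n + 7} M M0 \<and> (\<forall>v<i. M (n + 7) v = col (lists M0) v)"
  have W': "0 < W" "Suc 0 < W" "n < W" "2 < W" "5 < W" "6 < W" using n_W by linarith+
  have cd: "code M0 u < W" if "u < n" for u using code_le[OF M0(1) that] W_small[of "code M0 u"] by simp
  have kd: "partial_key (code M0) u n < W" if "u < n" for u using W_key[OF partial_key_le that] by simp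
  have g0: "graph_rows M0" using M0(1) by (simp add: wf_def)
  have "hoare (?I 0) col_prog flags_time (?I n)"
    unfolding col_prog_def
  proof (rule hoare_for[where I = ?I])
    fix v assume v: "v < n"
    let ?F = "flag (lists M0) v"
    let ?P = "\<lambda>u. v \<sim> u \<and> (code M0 u = code M0 v \<and> partial_key (code M0) v n < partial_key (code M0) u n \<or> code M0 v = 6 \<and> code M0 u = 5)"
    have le: "M0 n v \<le> 1" "M0 (n + 1) v \<le> 1" "M0 (n + 2) v \<le> 1"
      using wf_list[OF M0(1), of 0 v] wf_list[OF M0(1), of 1 v] wf_list[OF M0(1), of 2 v] v by simp_all
    have col: "col (lists M0) v = (if ?F then (1 - M0 n v) * (2 - M0 (n + 1) v) else 2 * M0 (n + 2) v + (1 - M0 (n + 2) v) * M0 (n + 1) v)"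
    proof -
      have "M0 n v = 0 \<or> M0 n v = 1" "M0 (n + 1) v = 0 \<or> M0 (n + 1) v = 1" "M0 (n + 2) v = 0 \<or> M0 (n + 2) v = 1"
        using le by linarith+
      moreover have "0 \<in> lists M0 v \<longleftrightarrow> M0 n v \<noteq> 0" "1 \<in> lists M0 v \<longleftrightarrow> M0 (n + 1) v \<noteq> 0" "2 \<in> lists M0 v \<longleftrightarrow> M0 (n + 2) v \<noteq> 0"
        using v by (simp_all add: lists_def)
      ultimately show ?thesis unfolding col_def lo_def hi_def by (elim disjE) simp_all
    qed
    have *: "hoare (state_at (\<lambda>r. ctx g r \<and> r 10 = v) M1) (Seq (flag_loop 11 col_test) col_set) (flag_time + 300)
        (\<lambda>r M. (ctx g r \<and> r 10 = v) \<and> M = M1(n + 7 := (M1 (n + 7))(v := col (lists M0) v)))"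
      if M1: "frame {n + 7} M1 M0" for M1
    proof (rule hoare_Seq)
      have g1: "graph_rows M1" using graph_rows_frame[OF M1 _ g0] by simp
      have rows: "M1 n = M0 n" "M1 (n + 1) = M0 (n + 1)" "M1 (n + 2) = M0 (n + 2)" "M1 (n + 5) = M0 (n + 5)" "M1 (n + 6) = M0 (n + 6)"
        using frameD[OF M1] by simp_all
      show "hoare (state_at (\<lambda>r. ctx g r \<and> r 10 = v) M1) (flag_loop 11 col_test) flag_time
        (\<lambda>r M. (ctx g r \<and> r 10 = v) \<and> M = M1 \<and> r 15 = (if \<exists>u<n. ?P u then 1 else 0))"
      proof (rule hoare_flag_loop)
        fix r u assume a: "ctx g r \<and> r 10 = v" "r 11 = u" "u < n"
        have A: "M1 v u = (if v \<sim> u then 1 else 0)" using g1 v a(3) by (simp add: graph_rows_def)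
        show "ft col_test r M1 \<and> (ev col_test r M1 \<noteq> 0 \<longleftrightarrow> ?P u)"
          unfolding col_test_def
          using a base_0[of r] v rows A M0(2)[OF v] M0(2)[OF a(3)] M0(3)[OF v] M0(3)[OF a(3)] cd[OF v] cd[OF a(3)] kd[OF v] kd[OF a(3)] W'
          by simp
      qed (simp_all add: col_test_def)
      show "hoare (\<lambda>r M. (ctx g r \<and> r 10 = v) \<and> M = M1 \<and> r 15 = (if \<exists>u<n. ?P u then 1 else 0)) col_set 300
        (\<lambda>r M. (ctx g r \<and> r 10 = v) \<and> M = M1(n + 7 := (M1 (n + 7))(v := col (lists M0) v)))"
        unfolding flag_code[OF M0(1) v, symmetric]
      proof (rule hoare_wp)
        fix r M assume a: "(ctx g r \<and> r 10 = v) \<and> M = M1 \<and> r 15 = (if ?F then 1 else 0)"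
        have lt: "M0 n v < W" "M0 (n + 1) v < W" "M0 (n + 2) v < W" "Suc 0 - M0 n v < W" "2 - M0 (n + 1) v < W" "Suc 0 - M0 (n + 2) v < W"
          "2 * M0 (n + 2) v < W"
          using le W_quadratic by linarith+
        have p: "(Suc 0 - M0 n v) * (2 - M0 (n + 1) v) \<le> 1 * 2" "(Suc 0 - M0 (n + 2) v) * M0 (n + 1) v \<le> 1 * 1"
          using le by (intro mult_mono; simp)+
        then have lt2: "(Suc 0 - M0 n v) * (2 - M0 (n + 1) v) < W" "(Suc 0 - M0 (n + 2) v) * M0 (n + 1) v < W"
          "2 * M0 (n + 2) v + (Suc 0 - M0 (n + 2) v) * M0 (n + 1) v < W"
          using le W_quadratic by linarith+
        show "wp W col_set (holds (\<lambda>r M. (ctx g r \<and> r 10 = v) \<and> M = M1(n + 7 := (M1 (n + 7))(v := col (lists M0) v)))) (st n r M)"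
          using a base_0[of r] v rows lt lt2 W' unfolding col_set_def col by (simp add: holdsI)
      qed (simp add: col_set_def)
    qed
    show "hoare (\<lambda>r M. ?I v r M \<and> r 10 = v) (Seq (flag_loop 11 col_test) col_set) (flag_time + 300) (\<lambda>r M. ?I (Suc v) r M \<and> r 10 = v)"
      by (rule hoare_conseq[OF hoare_state_at[where C = "\<lambda>r. ctx g r \<and> r 10 = v" and
            J = "\<lambda>M. frame {n + 7} M M0 \<and> (\<forall>x<v. M (n + 7) x = col (lists M0) x)", OF *]])
        (auto simp: less_Suc_eq)
  qed (simp_all add: n_W base_0)
  then show ?thesis by (rule hoare_conseq) (simp_all add: state_at_def)
qed

section \<open>Updating the best cost of each component\<close>

abbreviation best_count :: prog where
  "best_count \<equiv> Cond (Op Equal (rd 3 (Reg 11)) (Reg 10))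
       (Seq (Assign 16 (Op Add (Reg 16) (Reg 15)))
         (Cond (rd 7 (Reg 11)) Skip (Assign 14 (Op Add (Reg 14) (Const 1))))) Skip"

definition best_inner :: prog where
  "best_inner = Seq (flag_loop 12 (Op Mul (adjx 11 12) (Op Equal (rd 7 (Reg 11)) (rd 7 (Reg 12)))))
     best_count"

definition best_set :: prog where
  "best_set = Cond (Reg 16) Skip (Cond (Op Less (Reg 14) (rd 4 (Reg 10))) (wr 4 (Reg 10) (Reg 14)) Skip)"

definition best_prog :: prog where
  "best_prog = for_loop 10 0 (Seq (Seq (Assign 14 (Const 0)) (Assign 16 (Const 0))) (Seq (for_loop 11 0 best_inner) best_set))"

definition cnt :: "(nat \<Rightarrow> bool) \<Rightarrow> nat \<Rightarrow> nat" where
  "cnt P i = card {v. v < i \<and> P v}"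

lemma cnt_0: "cnt P 0 = 0" by (simp add: cnt_def)

lemma cnt_Suc: "cnt P (Suc i) = cnt P i + (if P i then 1 else 0)"
proof -
  have "{v. v < Suc i \<and> P v} = {v. v < i \<and> P v} \<union> (if P i then {i} else {})" by (auto simp: less_Suc_eq)
  then show ?thesis by (simp add: cnt_def)
qed

lemma cnt_le: "cnt P i \<le> i"
  by (induction i) (auto simp: cnt_0 cnt_Suc)

lemma cnt_eq_0: "cnt P i = 0 \<longleftrightarrow> (\<forall>v<i. \<not> P v)"
  unfolding cnt_def by (subst card_0_eq) auto

definition clash :: "(nat \<Rightarrow> nat) \<Rightarrow> nat \<Rightarrow> bool" where
  "clash c v \<longleftrightarrow> (\<exists>u<n. v \<sim> u \<and> c v = c u)"

text \<open>Properness is tested on the component \<open>x\<close> alone, so a candidate that fails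
  elsewhere still counts where it is proper.\<close>

definition improve :: "(nat \<Rightarrow> nat) \<Rightarrow> (nat \<Rightarrow> nat) \<Rightarrow> nat \<Rightarrow> nat \<Rightarrow> nat" where
  "improve lab c x b = (if (\<forall>v<n. lab v = x \<longrightarrow> \<not> clash c v) \<and> cnt (\<lambda>v. lab v = x \<and> c v = 0) n < b
     then cnt (\<lambda>v. lab v = x \<and> c v = 0) n else b)"

lemma improve_le: "improve lab c x b \<le> b" by (simp add: improve_def)

abbreviation cost :: "(nat \<Rightarrow> nat) \<Rightarrow> (nat \<Rightarrow> nat) \<Rightarrow> nat \<Rightarrow> nat \<Rightarrow> nat" where
  "cost lab c x \<equiv> cnt (\<lambda>v. lab v = x \<and> c v = 0)"

abbreviation clashes :: "(nat \<Rightarrow> nat) \<Rightarrow> (nat \<Rightarrow> nat) \<Rightarrow> nat \<Rightarrow> nat \<Rightarrow> nat" where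
  "clashes lab c x \<equiv> cnt (\<lambda>v. lab v = x \<and> clash c v)"

lemma hoare_best_inner:
  assumes M0: "graph_rows M0" "\<And>v. v < n \<Longrightarrow> M0 (n + 7) v = c v" "\<And>v. v < n \<Longrightarrow> M0 (n + 3) v = lab v"
    "\<And>v. v < n \<Longrightarrow> c v < 3" "\<And>v. v < n \<Longrightarrow> lab v < n" and x: "x < n" and v: "v < n"
  shows "hoare (state_at (\<lambda>r. (ctx g r \<and> r 10 = x \<and> r 14 = cost lab c x v \<and>
      r 16 = clashes lab c x v) \<and> r 11 = v) M0) best_inner (flag_time + 300)
    (\<lambda>r M. (ctx g r \<and> r 10 = x \<and> r 14 = cost lab c x (Suc v) \<and>
      r 16 = clashes lab c x (Suc v) \<and> M = M0) \<and> r 11 = v)"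
  unfolding best_inner_def
proof (rule hoare_Seq)
  have W': "0 < W" "Suc 0 < W" "n < W" using n_W by linarith+
  have cW: "c u < W" if "u < n" for u using M0(4)[OF that] W_small[of "c u"] by simp
  have lW: "lab u < W" if "u < n" for u using M0(5)[OF that] n_W by simp
  let ?C = "\<lambda>r. (ctx g r \<and> r 10 = x \<and> r 14 = cost lab c x v \<and>
      r 16 = clashes lab c x v) \<and> r 11 = v"
  let ?e = "Op Mul (adjx 11 12) (Op Equal (rd 7 (Reg 11)) (rd 7 (Reg 12)))"
  show "hoare (state_at ?C M0) (flag_loop 12 ?e) flag_time (\<lambda>r M. ?C r \<and> M = M0 \<and> r 15 = (if \<exists>u<n. v \<sim> u \<and> c v = c u then 1 else 0))"
  proof (rule hoare_flag_loop)
    fix r u assume a: "?C r" "r 12 = u" "u < n"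
    have "M0 v u = (if v \<sim> u then 1 else 0)" using M0(1) v a(3) by (simp add: graph_rows_def)
    then show "ft ?e r M0 \<and> (ev ?e r M0 \<noteq> 0 \<longleftrightarrow> v \<sim> u \<and> c v = c u)"
      using a base_0[of r] v M0(2)[OF v] M0(2)[OF a(3)] cW[OF v] cW[OF a(3)] W' by simp
  qed simp_all
  show "hoare (\<lambda>r M. ?C r \<and> M = M0 \<and> r 15 = (if \<exists>u<n. v \<sim> u \<and> c v = c u then 1 else 0))
     best_count 300
    (\<lambda>r M. (ctx g r \<and> r 10 = x \<and> r 14 = cost lab c x (Suc v) \<and>
      r 16 = clashes lab c x (Suc v) \<and> M = M0) \<and> r 11 = v)"
    unfolding clash_def[of c v, symmetric]
  proof (rule hoare_wp)
    fix r M assume a: "?C r \<and> M = M0 \<and> r 15 = (if clash c v then 1 else 0)"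
    have "cost lab c x v < n" "clashes lab c x v < n"
      using cnt_le v by (meson le_less_trans)+
    then have k: "cost lab c x v < W" "clashes lab c x v < W"
      "Suc (cost lab c x v) < W" "Suc (clashes lab c x v) < W"
      using W_quadratic by linarith+
    show "wp W best_count
      (holds (\<lambda>r M. (ctx g r \<and> r 10 = x \<and> r 14 = cost lab c x (Suc v) \<and>
      r 16 = clashes lab c x (Suc v) \<and> M = M0) \<and> r 11 = v)) (st n r M)"
      using a base_0[of r] x v M0(2)[OF v] M0(3)[OF v] cW[OF v] lW[OF v] W' k by (simp add: holdsI cnt_Suc)
  qed simp
qed

lemma hoare_best:
  assumes M0: "graph_rows M0" "\<And>v. v < n \<Longrightarrow> M0 (n + 7) v = c v" "\<And>v. v < n \<Longrightarrow> M0 (n + 3) v = lab v"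
    "\<And>v. v < n \<Longrightarrow> c v < 3" "\<And>v. v < n \<Longrightarrow> lab v < n" "\<And>v. v < n \<Longrightarrow> M0 (n + 4) v \<le> n + 1"
  shows "hoare (state_at (ctx g) M0) best_prog best_time
    (\<lambda>r M. ctx g r \<and> frame {n + 4} M M0 \<and> (\<forall>x<n. M (n + 4) x = improve lab c x (M0 (n + 4) x)))"
proof -
  have W': "0 < W" "Suc 0 < W" "n < W" using n_W by linarith+
  \<comment> \<open>The row is updated in place: entries from \<open>i\<close> on must still be the
    old ones, because \<open>improve\<close> reads them later.\<close>
  let ?I = "\<lambda>i r M. ctx g r \<and> frame {n + 4} M M0 \<and> (\<forall>x<n. M (n + 4) x = (if x < i then improve lab c x (M0 (n + 4) x) else M0 (n + 4) x))"
  let ?p = "Seq (Seq (Assign 14 (Const 0)) (Assign 16 (Const 0))) (Seq (for_loop 11 0 best_inner) best_set)"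
  have "hoare (?I 0) best_prog best_time (?I n)"
    unfolding best_prog_def
  proof (rule hoare_for[where I = ?I])
    fix x assume x: "x < n"
    have *: "hoare (state_at (\<lambda>r. ctx g r \<and> r 10 = x) M1) ?p (4 + (flags_time + 300))
        (\<lambda>r M. (ctx g r \<and> r 10 = x) \<and> M = M1(n + 4 := (M1 (n + 4))(x := improve lab c x (M1 (n + 4) x))))"
      if M1: "frame {n + 4} M1 M0" and b: "M1 (n + 4) x \<le> n + 1" for M1
    proof (rule hoare_Seq[OF _ hoare_Seq])
      let ?J = "\<lambda>i r M. ctx g r \<and> r 10 = x \<and> r 14 = cost lab c x i \<and>
        r 16 = clashes lab c x i \<and> M = M1"
      have g1: "graph_rows M1" using graph_rows_frame[OF M1 _ M0(1)] by simp
      have rows: "M1 (n + 7) v = c v" "M1 (n + 3) v = lab v" if "v < n" for v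
        using M0(2,3)[OF that] frameD[OF M1, of "n + 7"] frameD[OF M1, of "n + 3"] by simp_all
      show "hoare (state_at (\<lambda>r. ctx g r \<and> r 10 = x) M1) (Seq (Assign 14 (Const 0)) (Assign 16 (Const 0))) 4 (?J 0)"
        using W' by (intro hoare_wp) (simp_all add: state_at_def holdsI cnt_0)
      show "hoare (?J 0) (for_loop 11 0 best_inner) flags_time (?J n)"
      proof (rule hoare_for[where I = ?J])
        fix v assume v: "v < n"
        show "hoare (\<lambda>r M. ?J v r M \<and> r 11 = v) best_inner (flag_time + 300) (\<lambda>r M. ?J (Suc v) r M \<and> r 11 = v)"
          by (rule hoare_conseq[OF hoare_best_inner[OF g1 rows M0(4,5) x v]]) (simp_all add: state_at_def)
      qed (simp_all add: n_W base_0)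
      show "hoare (?J n) best_set 300
        (\<lambda>r M. (ctx g r \<and> r 10 = x) \<and> M = M1(n + 4 := (M1 (n + 4))(x := improve lab c x (M1 (n + 4) x))))"
      proof (rule hoare_wp)
        fix r M assume a: "?J n r M"
        define k where "k = cost lab c x n"
        define l where "l = clashes lab c x n"
        have W2: "k < W" "l < W" "M1 (n + 4) x < W" using cnt_le[of _ n] b W_quadratic unfolding k_def l_def
          by (meson le_less_trans n_W(1), meson le_less_trans n_W(1), linarith)
        have imp: "improve lab c x (M1 (n + 4) x) = (if l = 0 \<and> k < M1 (n + 4) x then k else M1 (n + 4) x)"
          unfolding improve_def k_def l_def cnt_eq_0 by auto
        show "wp W best_set (holds (\<lambda>r M. (ctx g r \<and> r 10 = x) \<and>
            M = M1(n + 4 := (M1 (n + 4))(x := improve lab c x (M1 (n + 4) x))))) (st n r M)"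
          using a[folded k_def l_def] x W' W2 base_0[of r] unfolding best_set_def imp by (simp add: holdsI)
      qed (simp add: best_set_def)
    qed
    show "hoare (\<lambda>r M. ?I x r M \<and> r 10 = x) ?p (4 + (flags_time + 300)) (\<lambda>r M. ?I (Suc x) r M \<and> r 10 = x)"
    proof -
      let ?R = "\<lambda>M. frame {n + 4} M M0 \<and> (\<forall>y<n. M (n + 4) y = (if y < x then improve lab c y (M0 (n + 4) y) else M0 (n + 4) y))"
      show ?thesis
    proof (rule hoare_conseq[OF hoare_state_at[where C = "\<lambda>r. ctx g r \<and> r 10 = x" and
            J = ?R, OF *]])
      show "\<And>r M. ?I x r M \<and> r 10 = x \<Longrightarrow> (ctx g r \<and> r 10 = x) \<and> ?R M" by simp
    qed (use x M0(6) in \<open>auto simp: less_Suc_eq\<close>)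
    qed
  qed (simp_all add: n_W base_0)
  then show ?thesis by (rule hoare_conseq) (simp_all add: state_at_def)
qed

section \<open>The whole program\<close>

abbreviation reach :: "(nat \<times> nat) set" where
  "reach \<equiv> {(a, b). a \<sim> b}\<^sup>*"

definition lab_step :: prog where
  "lab_step = Cond (Op Mul (adjx 11 12) (Op Less (rd 3 (Reg 12)) (rd 3 (Reg 11)))) (wr 3 (Reg 11) (rd 3 (Reg 12))) Skip"

definition lab_prog :: prog where
  "lab_prog = for_loop 10 3 (for_loop 11 0 (for_loop 12 0 lab_step))"

definition lab_relax :: "nat \<Rightarrow> nat \<Rightarrow> (nat \<Rightarrow> nat \<Rightarrow> nat) \<Rightarrow> nat \<Rightarrow> nat \<Rightarrow> nat" where
  "lab_relax u v M = (if u \<sim> v \<and> M (n + 3) v < M (n + 3) u then M(n + 3 := (M (n + 3))(u := M (n + 3) v)) else M)"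

definition lab_pass :: "(nat \<Rightarrow> nat \<Rightarrow> nat) \<Rightarrow> nat \<Rightarrow> nat \<Rightarrow> nat" where
  "lab_pass = fold (\<lambda>u. fold (\<lambda>v. lab_relax u v) [0..<n]) [0..<n]"

text \<open>Labels are below \<open>n\<close>, so their sum is at most \<open>n * n\<close>, and
  every effective pass lowers it. The crude number of passes costs \<open>O(n^4)\<close> and is paid
  only once.\<close>

definition relabel :: "(nat \<Rightarrow> nat \<Rightarrow> nat) \<Rightarrow> nat \<Rightarrow> nat \<Rightarrow> nat" where
  "relabel = fold (\<lambda>_. lab_pass) [0..<n * n]"

text \<open>Reachability ties each label to the component of its vertex. Together with equality
  along edges it makes the final labels name the components.\<close>

definition lab_wf :: "(nat \<Rightarrow> nat \<Rightarrow> nat) \<Rightarrow> bool" where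
  "lab_wf M \<longleftrightarrow> graph_rows M \<and> (\<forall>v<n. M (n + 3) v < n \<and> (M (n + 3) v, v) \<in> reach)"

lemma lab_wf_relax: assumes "lab_wf M" "v < n" shows "lab_wf (lab_relax u v M)"
proof (cases "u \<sim> v \<and> M (n + 3) v < M (n + 3) u")
  case True
  have "(M (n + 3) v, v) \<in> reach" "(v, u) \<in> {(a, b). a \<sim> b}" using assms True adj_sym by (auto simp: lab_wf_def)
  then have "(M (n + 3) v, u) \<in> reach" by (rule rtrancl_into_rtrancl)
  then show ?thesis using assms True by (simp add: lab_relax_def lab_wf_def graph_rows_def)
next
  case False
  then have "lab_relax u v M = M" unfolding lab_relax_def by (rule if_not_P)
  then show ?thesis using assms(1) by simp
qed

lemma lab_relax_le: "lab_relax u v M \<le> M"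
  by (simp add: lab_relax_def le_fun_def)

lemma lab_relax_frame: "q \<noteq> n + 3 \<or> x \<ge> n \<Longrightarrow> u < n \<Longrightarrow> lab_relax u v M q x = M q x"
  by (auto simp: lab_relax_def)

lemma lab_pass_inv:
  assumes "\<And>u v M. u < n \<Longrightarrow> v < n \<Longrightarrow> P M \<Longrightarrow> P (lab_relax u v M)" "P M"
  shows "P (lab_pass M)"
  unfolding lab_pass_def using assms by (intro fold_inv[where P = P]) auto

lemma relabel_inv:
  assumes "\<And>u v M. u < n \<Longrightarrow> v < n \<Longrightarrow> P M \<Longrightarrow> P (lab_relax u v M)" "P M"
  shows "P (relabel M)"
  unfolding relabel_def by (rule fold_inv[where P = P]) (use assms lab_pass_inv[of P] in blast)+

lemma relabel_wf: "lab_wf M \<Longrightarrow> lab_wf (relabel M)"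
  by (rule relabel_inv[of lab_wf]) (auto simp: lab_wf_relax)

lemma relabel_frame: "frame {n + 3} (relabel M) M"
proof -
  have "relabel M q = M q" if "q \<noteq> n + 3" for q
    by (rule relabel_inv[of "\<lambda>M'. M' q = M q"]) (use that in \<open>auto simp: lab_relax_def\<close>)
  then show ?thesis by (simp add: frame_def)
qed

text \<open>After \<open>n * n\<close> passes no relaxation changes anything, so neither end of an
  edge can have the smaller label.\<close>

lemma relabel_edge:
  assumes "lab_wf M" "u \<sim> v"
  shows "relabel M (n + 3) u = relabel M (n + 3) v"
proof -
  let ?M = "relabel M"
  have "(\<Sum>(q, v)\<in>{n + 3} \<times> {..<n}. M q v) \<le> (\<Sum>(q, v)\<in>{n + 3} \<times> {..<n}. n)"
    using assms(1) by (intro sum_mono) (auto simp: lab_wf_def less_imp_le)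
  moreover have "lab_pass M' \<le> M'" for M' unfolding lab_pass_def by (intro fold_decreasing lab_relax_le)
  moreover have "lab_pass M' q x = M' q x" if "(q, x) \<notin> {n + 3} \<times> {..<n}" for M' q x
    by (rule lab_pass_inv[of "\<lambda>M''. M'' q x = M' q x"]) (use that in \<open>auto simp: lab_relax_frame\<close>)
  ultimately have "lab_pass ?M = ?M"
    unfolding relabel_def by (intro iterate_to_fixpoint[where S = "{n + 3} \<times> {..<n}"]) auto
  then have fixed: "lab_relax a b ?M = ?M" if "a < n" "b < n" for a b
  proof -
    have "fold (\<lambda>v. lab_relax a v) [0..<n] ?M = ?M"
      by (rule fold_fixed[where x = a and f = "\<lambda>u. fold (\<lambda>v. lab_relax u v) [0..<n]" and xs = "[0..<n]"])
        (use \<open>lab_pass ?M = ?M\<close> that(1) in \<open>simp_all add: lab_pass_def fold_decreasing lab_relax_le\<close>)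
    then show ?thesis
      by (rule fold_fixed[where x = b and f = "\<lambda>v. lab_relax a v" and xs = "[0..<n]", OF lab_relax_le]) (simp add: that(2))
  qed
  have le: "\<not> ?M (n + 3) b < ?M (n + 3) a" if "a \<sim> b" for a b
  proof
    assume l: "?M (n + 3) b < ?M (n + 3) a"
    then have "lab_relax a b ?M = ?M(n + 3 := (?M (n + 3))(a := ?M (n + 3) b))"
      unfolding lab_relax_def using that by (intro if_P conjI)
    then have "lab_relax a b ?M (n + 3) a = ?M (n + 3) b" by simp
    moreover have "lab_relax a b ?M = ?M" by (rule fixed[OF adj_less[OF that] adj_less[OF adj_sym[OF that]]])
    ultimately show False using l by simp
  qed
  show ?thesis using le[OF assms(2)] le[OF adj_sym[OF assms(2)]] by simp
qed

definition lab_time :: nat where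
  "lab_time = for_time (n * n) (for_time n (for_time n 300))"

lemma hoare_lab:
  assumes "lab_wf M0"
  shows "hoare (state_at base M0) lab_prog lab_time (state_at base (relabel M0))"
proof -
  let ?C0 = "\<lambda>p r. base r \<and> r 10 = p" let ?C1 = "\<lambda>p u r. ?C0 p r \<and> r 11 = u"
  let ?C2 = "\<lambda>p u v r. ?C1 p u r \<and> r 12 = v"
  have inv1: "lab_wf (fold (\<lambda>v. lab_relax u v) [0..<n] M)" if "lab_wf M" for u M
    by (rule fold_inv[where P = lab_wf, OF lab_wf_relax that]) auto
  have inv2: "lab_wf (lab_pass M)" if "lab_wf M" for M
    unfolding lab_pass_def by (rule fold_inv[where P = lab_wf, OF inv1 that])
  have 0: "hoare (state_at (?C2 p u v) M0) lab_step 300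
      (state_at (?C2 p u v) (lab_relax u v M0))"
    if uv: "u < n" "v < n" "lab_wf M0" for p u v M0
  proof (rule hoare_wp)
    fix r M assume a: "state_at (?C2 p u v) M0 r M"
    then have "base r" "r 10 = p" "r 11 = u" "r 12 = v" "M = M0" by (simp_all add: state_at_def)
    moreover have "M0 u v = (if u \<sim> v then 1 else 0)" "M0 (n + 3) u < W" "M0 (n + 3) v < W"
      using uv n_W by (auto simp: lab_wf_def graph_rows_def intro: less_trans)
    moreover have "0 < W" "Suc 0 < W" using n_W by linarith+
    ultimately show "wp W lab_step (holds (state_at (?C2 p u v) (lab_relax u v M0))) (st n r M)"
      using uv base_0[of r] n_W by (simp add: lab_step_def lab_relax_def holdsI state_at_def)
  qed (simp add: lab_step_def)
  have 1: "hoare (state_at (?C1 p u) M0) (for_loop 12 0 lab_step) (for_time n 300)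
      (state_at (?C1 p u) (fold (\<lambda>v. lab_relax u v) [0..<n] M0))"
    if "u < n" "lab_wf M0" for p u M0
    by (rule hoare_for_fold[where J = lab_wf, OF _ _ _ _ _ _ 0]) (simp_all add: that n_W base_0 lab_wf_relax)
  have 2: "hoare (state_at (?C0 p) M0) (for_loop 11 0 (for_loop 12 0 lab_step))
      (for_time n (for_time n 300)) (state_at (?C0 p) (lab_pass M0))"
    if "lab_wf M0" for p M0
    unfolding lab_pass_def
    by (rule hoare_for_fold[where J = lab_wf, OF _ _ _ _ _ _ 1]) (simp_all add: that n_W base_0 inv1)
  show ?thesis
    unfolding lab_prog_def relabel_def lab_time_def
    by (rule hoare_for_fold[where J = lab_wf, OF _ _ _ _ _ _ 2]) (simp_all add: assms n_W base_def inv2)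
qed

abbreviation lab_init_body :: prog where
  "lab_init_body \<equiv> Seq (wr 3 (Reg 10) (Reg 10)) (wr 4 (Reg 10) (Op Add (Reg 0) (Const 1)))"

definition lab_init :: prog where
  "lab_init = for_loop 10 0 lab_init_body"

lemma hoare_lab_init:
  "hoare (state_at base M0) lab_init (for_time n 300)
    (\<lambda>r M. base r \<and> frame {n + 3, n + 4} M M0 \<and> (\<forall>v<n. M (n + 3) v = v \<and> M (n + 4) v = n + 1))"
proof -
  let ?I = "\<lambda>i r M. base r \<and> frame {n + 3, n + 4} M M0 \<and> (\<forall>v<i. M (n + 3) v = v \<and> M (n + 4) v = n + 1)"
  have W': "0 < W" "Suc 0 < W" "n < W" "Suc n < W" using W_quadratic by linarith+
  have "hoare (?I 0) lab_init (for_time n 300) (?I n)"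
    unfolding lab_init_def
  proof (rule hoare_for[where I = ?I])
    fix i assume i: "i < n"
    show "hoare (\<lambda>r M. ?I i r M \<and> r 10 = i) lab_init_body 300
      (\<lambda>r M. ?I (Suc i) r M \<and> r 10 = i)"
    proof (rule hoare_wp)
      fix r M assume "?I i r M \<and> r 10 = i"
      then show "wp W lab_init_body
          (holds (\<lambda>r M. ?I (Suc i) r M \<and> r 10 = i)) (st n r M)"
        using i W' base_0[of r] by (simp add: holdsI less_Suc_eq)
    qed simp
  qed (simp_all add: n_W base_0)
  then show ?thesis by (rule hoare_conseq) (simp_all add: state_at_def)
qed

section \<open>The candidate colouring of a guess and one round of the main loop\<close>

definition guessed_lists :: "nat \<Rightarrow> nat \<Rightarrow> nat set" where
  "guessed_lists g v = (if v < n then {c. c < 3 \<and> guessed g 12 v c} else {..<3})"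

text \<open>Defined through the closure rather than through the program;
  \<open>closure_unique\<close> makes the choice harmless.\<close>

definition cand :: "nat \<Rightarrow> nat \<Rightarrow> nat" where
  "cand g = col (SOME L. is_closure (guessed_lists g) L)"

lemma closure_unique: "is_closure I L \<Longrightarrow> is_closure I L' \<Longrightarrow> L = L'"
  by (rule antisym) (simp_all add: is_closure_def)

lemma cand_closure: "is_closure (guessed_lists g) L \<Longrightarrow> cand g = col L"
  unfolding cand_def by (rule arg_cong[of _ _ col]) (rule closure_unique[OF someI[of "is_closure (guessed_lists g)"]])

lemma col_less: "col L v < 3"
  by (simp add: col_def lo_def hi_def)

lemma frame_trans:
  assumes "frame A M M'" "frame B M' M''" "A \<subseteq> S" "B \<subseteq> S"
  shows "frame S M M''"
  unfolding frame_def
proof (intro allI impI)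
  fix q assume "q \<notin> S"
  then have "q \<notin> A" "q \<notin> B" using assms(3,4) by blast+
  then show "M q = M'' q" using frameD[OF assms(1)] frameD[OF assms(2)] by simp
qed

lemma frame_lists:
  assumes "frame S M M'" "\<And>q. q \<in> S \<Longrightarrow> n + 3 \<le> q" "wf M'"
  shows "wf M" "lists M = lists M'" "code M = code M'"
proof -
  have rows: "M q = M' q" if "q < n + 3" for q
    using frameD[OF assms(1), of q] assms(2)[of q] that by fastforce
  show "wf M" using assms(3) rows by (simp add: wf_def graph_rows_def)
  show "lists M = lists M'" using rows by (auto simp: lists_def fun_eq_iff)
  show "code M = code M'" using rows[of n] rows[of "n + 1"] rows[of "n + 2"] by (simp add: code_def fun_eq_iff)
qed

definition body :: prog where
  "body = Seq init_prog (Seq guess_prog (Seq prop_prog (Seq code_prog (Seq key_prog (Seq col_prog best_prog)))))"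

definition body_time :: nat where
  "body_time = for_time n 300 + ((2 + for_time 12 300) + (prop_time + (for_time n 300 +
     (key_time + (flags_time +
      best_time)))))"

lemma hoare_body:
  assumes g: "g < (3 * n) ^ 12" and M0: "graph_rows M0" "\<And>v. v < n \<Longrightarrow> M0 (n + 3) v = lab v" "\<And>v. v < n \<Longrightarrow> lab v < n"
    "\<And>v. v < n \<Longrightarrow> M0 (n + 4) v \<le> n + 1"
  shows "hoare (state_at (ctx g) M0) body body_time
    (\<lambda>r M. ctx g r \<and> frame ({n..<n + 8} - {n + 3}) M M0 \<and> (\<forall>x<n. M (n + 4) x = improve lab (cand g) x (M0 (n + 4) x)))"
proof -
  let ?Q = "\<lambda>r M. ctx g r \<and> frame ({n..<n + 8} - {n + 3}) M M0 \<and> (\<forall>x<n. M (n + 4) x = improve lab (cand g) x (M0 (n + 4) x))"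
  show ?thesis
    unfolding body_def body_time_def
  proof (rule hoare_Seq_at[OF hoare_init])
  fix M1 assume M1: "frame {n..<n + 3} M1 M0 \<and> (\<forall>c<3. \<forall>v<n. M1 (n + c) v = 1)"
  then have M1_list: "\<forall>c<3. \<forall>v<n. M1 (n + c) v = 1" by blast
  show "hoare (state_at (ctx g) M1) (Seq guess_prog (Seq prop_prog (Seq code_prog (Seq key_prog (Seq col_prog best_prog)))))
    ((2 + for_time 12 300) + (prop_time + (for_time n 300 +
     (key_time + (flags_time +
      best_time)))))
    ?Q"
  proof (rule hoare_Seq_at[OF hoare_guess[OF g M1_list]])
    fix M2 assume M2: "frame {n..<n + 3} M2 M1 \<and> (\<forall>c<3. \<forall>v<n. M2 (n + c) v = (if guessed g 12 v c then 1 else 0))"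
    have f2: "frame {n..<n + 3} M2 M0" by (rule frame_trans[of "{n..<n + 3}" M2 M1 "{n..<n + 3}"]) (use M1 M2 in auto)
    have "graph_rows M2" by (rule graph_rows_frame[OF f2 _ M0(1)]) auto
    then have wf2: "wf M2" using M2 by (simp add: wf_def)
    have l2: "lists M2 = guessed_lists g"
    proof
      fix v
      have "M2 (n + c) v \<noteq> 0 \<longleftrightarrow> guessed g 12 v c" if "v < n" "c < 3" for c using M2 that by simp
      then show "lists M2 v = guessed_lists g v" unfolding lists_def guessed_lists_def by auto
    qed
    define M3 where "M3 = propagate M2"
    have wf3: "wf M3" unfolding M3_def by (rule propagate_inv[of wf, OF wf_step wf2])
    have col3: "col (lists M3) = cand g"
      using cand_closure[OF propagate_closure[OF wf2, unfolded l2]] unfolding M3_def by simp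
    have "frame {n..<n + 3} M3 M2"
      unfolding frame_def M3_def by (intro allI impI ext propagate_frame) blast
    then have f3: "frame {n..<n + 3} M3 M0" by (rule frame_trans[OF _ f2]) auto
    have p: "hoare (state_at (ctx g) M2) prop_prog prop_time (\<lambda>r M. ctx g r \<and> M = M3)"
      using hoare_prop[OF wf2, of g] unfolding M3_def state_at_def .
    show "hoare (state_at (ctx g) M2) (Seq prop_prog (Seq code_prog (Seq key_prog (Seq col_prog best_prog))))
     (prop_time + (for_time n 300 +
     (key_time + (flags_time +
      best_time))))
    ?Q"
    proof (rule hoare_Seq_at[OF p], elim ssubst, rule hoare_Seq_at[OF hoare_code[OF wf3]])
      fix M4 assume M4: "frame {n + 5} M4 M3 \<and> (\<forall>v<n. M4 (n + 5) v = code M3 v)"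
      note s4 = frame_lists[OF conjunct1[OF M4] _ wf3, simplified]
      have g4: "graph_rows M4" using s4 by (simp add: wf_def)
      have c4: "M4 (n + 5) v = code M4 v" "code M4 v \<le> 7" if "v < n" for v
        using M4 that code_le[OF s4(1), of v] s4(3) by simp_all
      show "hoare (state_at (ctx g) M4) (Seq key_prog (Seq col_prog best_prog))
        (key_time + (flags_time +
          best_time))
        ?Q"
      proof (rule hoare_Seq_at[OF hoare_key[OF g4 c4]])
        fix M5 assume M5: "frame {n + 6} M5 M4 \<and> (\<forall>v<n. M5 (n + 6) v = partial_key (code M4) v n)"
        note s5 = frame_lists[OF conjunct1[OF M5] _ s4(1), simplified]
        have r5: "M5 (n + 5) v = code M5 v" "M5 (n + 6) v = partial_key (code M5) v n" if "v < n" for v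
          using M5 c4(1)[OF that] that s5(3) frameD[of "{n + 6}" M5 M4 "n + 5"] by simp_all
        show "hoare (state_at (ctx g) M5) (Seq col_prog best_prog) (flags_time +
          best_time)
        ?Q"
        proof (rule hoare_Seq_at[OF hoare_col[OF s5(1) r5]])
          fix M6 assume M6: "frame {n + 7} M6 M5 \<and> (\<forall>v<n. M6 (n + 7) v = col (lists M5) v)"
          note s6 = frame_lists[OF conjunct1[OF M6] _ s5(1), simplified]
          have "col (lists M5) = cand g" using s5(2) s4(2) col3 by simp
          then have c6: "M6 (n + 7) v = cand g v" if "v < n" for v using M6 that by simp
          have f6: "frame ({n..<n + 8} - {n + 3, n + 4}) M6 M0"
          proof -
            let ?S = "{n..<n + 8} - {n + 3, n + 4}"
            have "frame ?S M4 M0" by (rule frame_trans[OF conjunct1[OF M4] f3]) auto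
            then have "frame ?S M5 M0" by (rule frame_trans[OF conjunct1[OF M5]]) auto
            then show ?thesis by (rule frame_trans[OF conjunct1[OF M6]]) auto
          qed
          have l6: "M6 (n + 3) v = lab v" "M6 (n + 4) v \<le> n + 1" if "v < n" for v
            using frameD[OF f6, of "n + 3"] frameD[OF f6, of "n + 4"] M0(2,4)[OF that] by simp_all
          have g6: "graph_rows M6" using s6(1) by (simp add: wf_def)
          have c3: "cand g v < 3" for v unfolding cand_def by (rule col_less)
          show "hoare (state_at (ctx g) M6) best_prog best_time
            ?Q"
          proof (rule hoare_conseq[OF hoare_best[OF g6 c6 l6(1) c3 M0(3) l6(2)]])
            fix r M assume a: "ctx g r \<and> frame {n + 4} M M6 \<and> (\<forall>x<n. M (n + 4) x = improve lab (cand g) x (M6 (n + 4) x))"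
            have "frame ({n..<n + 8} - {n + 3}) M M0" by (rule frame_trans[of "{n + 4}" M M6, OF _ f6]) (use a in auto)
            then show "ctx g r \<and> frame ({n..<n + 8} - {n + 3}) M M0 \<and> (\<forall>x<n. M (n + 4) x = improve lab (cand g) x (M0 (n + 4) x))"
              using a frameD[OF f6, of "n + 4"] by simp
          qed auto
        qed
      qed
    qed
  qed
qed
qed

text \<open>The start value \<open>n + 1\<close> exceeds the size of every colour class and plays
  the part of infinity.\<close>

primrec best :: "(nat \<Rightarrow> nat) \<Rightarrow> nat \<Rightarrow> nat \<Rightarrow> nat" where
  "best lab 0 x = n + 1"
| "best lab (Suc g) x = improve lab (cand g) x (best lab g x)"

lemma best_le: "best lab g x \<le> n + 1"
proof (induction g)
  case (Suc g)
  then show ?case using improve_le[of lab "cand g" x "best lab g x"] by simp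
qed simp

lemma hoare_main:
  assumes M0: "graph_rows M0" "\<And>v. v < n \<Longrightarrow> M0 (n + 3) v = lab v" "\<And>v. v < n \<Longrightarrow> lab v < n"
    "\<And>v. v < n \<Longrightarrow> M0 (n + 4) v = n + 1"
  shows "hoare (state_at base M0) (for_loop 2 4 body) (for_time ((3 * n) ^ 12) body_time)
    (\<lambda>r M. base r \<and> frame ({n..<n + 8} - {n + 3}) M M0 \<and> (\<forall>x<n. M (n + 4) x = best lab ((3 * n) ^ 12) x))"
proof -
  let ?F = "{n..<n + 8} - {n + 3}"
  let ?I = "\<lambda>g r M. base r \<and> frame ?F M M0 \<and> (\<forall>x<n. M (n + 4) x = best lab g x)"
  have "hoare (?I 0) (for_loop 2 4 body) (for_time ((3 * n) ^ 12) body_time) (?I ((3 * n) ^ 12))"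
  proof (rule hoare_for[where I = ?I])
    fix g assume g: "g < (3 * n) ^ 12"
    show "hoare (\<lambda>r M. ?I g r M \<and> r 2 = g) body body_time (\<lambda>r M. ?I (Suc g) r M \<and> r 2 = g)"
    proof (rule hoare_conseq[OF hoare_state_at[where C = "ctx g" and J = "\<lambda>M. frame ?F M M0 \<and> (\<forall>x<n. M (n + 4) x = best lab g x)"]])
      fix M assume a: "frame ?F M M0 \<and> (\<forall>x<n. M (n + 4) x = best lab g x)"
      then have f: "frame ?F M M0" and b: "\<And>x. x < n \<Longrightarrow> M (n + 4) x = best lab g x" by simp_all
      have gM: "graph_rows M" by (rule graph_rows_frame[OF f _ M0(1)]) auto
      have lM: "M (n + 3) v = lab v" if "v < n" for v using frameD[OF f, of "n + 3"] M0(2)[OF that] by simp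
      have bM: "M (n + 4) v \<le> n + 1" if "v < n" for v using b[OF that] best_le by simp
      show "hoare (state_at (ctx g) M) body body_time (\<lambda>r M'. ctx g r \<and>
          (frame ?F M' M \<and> (\<forall>x<n. M' (n + 4) x = improve lab (cand g) x (M (n + 4) x))))"
        by (rule hoare_body[OF g gM lM M0(3) bM])
    qed (auto intro: frame_trans)
  qed (use W_literals[of 12] in \<open>simp_all add: base_def\<close>)
  then show ?thesis by (rule hoare_conseq) (simp_all add: state_at_def M0(4))
qed

end

section \<open>Every small guess is the value of some loop counter\<close>

lemma ex_digits:
  fixes x :: "nat \<Rightarrow> nat"
  assumes "\<And>j. j < k \<Longrightarrow> x j < N"
  shows "\<exists>g<N ^ k. \<forall>j<k. g div N ^ j mod N = x j"
  using assms
proof (induction k arbitrary: x)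
  case (Suc k)
  have "\<And>j. j < k \<Longrightarrow> x (Suc j) < N" using Suc.prems by simp
  from Suc.IH[of "\<lambda>j. x (Suc j)", OF this] obtain g where g: "g < N ^ k" "\<forall>j<k. g div N ^ j mod N = x (Suc j)" by blast
  have x0: "x 0 < N" using Suc.prems by simp
  \<comment> \<open>Horner's scheme: \<open>x 0\<close> becomes the lowest digit and the number
    \<open>g\<close> for the remaining digits moves up by one place.\<close>
  have "x 0 + N * g < N * (g + 1)" using x0 by simp
  also have "\<dots> \<le> N * N ^ k" using g(1) by (intro mult_le_mono2) simp
  finally have "x 0 + N * g < N ^ Suc k" by simp
  moreover have "(x 0 + N * g) div N ^ j mod N = x j" if "j < Suc k" for j
  proof (cases j)
    case 0
    then show ?thesis using x0 by simp
  next
    case (Suc i)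
    have "(x 0 + N * g) div N ^ j = (x 0 + N * g) div N div N ^ i" by (simp add: Suc div_mult2_eq)
    also have "(x 0 + N * g) div N = g" using x0 by simp
    finally show ?thesis using g(2) that Suc by simp
  qed
  ultimately show ?case by blast
qed simp

context solver
begin

lemma ex_guess_code:
  assumes \<Gamma>: "\<Gamma> \<subseteq> {..<n}" "\<Gamma> \<noteq> {}" "card \<Gamma> \<le> 12" and \<phi>: "\<And>v. v \<in> \<Gamma> \<Longrightarrow> \<phi> v < 3"
  shows "\<exists>g<(3 * n) ^ 12. guessed_lists g = guess \<Gamma> \<phi>"
proof -
  have fin: "finite \<Gamma>" using \<Gamma>(1) by (rule finite_subset) simp
  then obtain h where h: "bij_betw h {..<card \<Gamma>} \<Gamma>" using ex_bij_betw_nat_finite[OF fin] by (auto simp: atLeast0LessThan)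
  have pos: "0 < card \<Gamma>" using fin \<Gamma>(2) by (simp add: card_gt_0_iff)
  \<comment> \<open>There are always exactly twelve digits; those beyond the size of
    \<open>\<Gamma>\<close> repeat the guess for its vertex \<open>h 0\<close>, which exists because
    \<open>\<Gamma>\<close> is nonempty.\<close>
  define f where "f j = h (if j < card \<Gamma> then j else 0)" for j
  have f_in: "f j \<in> \<Gamma>" for j using bij_betwE[OF h] pos by (simp add: f_def)
  have f_onto: "\<exists>j<12. f j = v" if v: "v \<in> \<Gamma>" for v
  proof -
    have "v \<in> h ` {..<card \<Gamma>}" using h v by (simp add: bij_betw_def)
    then obtain j where "j < card \<Gamma>" "h j = v" by auto
    then show ?thesis using \<Gamma>(3) by (intro exI[of _ j]) (simp add: f_def)
  qed
  have fn: "f j < n" "\<phi> (f j) < 3" for j using f_in[of j] \<Gamma>(1) \<phi> by auto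
  have "\<phi> (f j) * n + f j < 3 * n" for j
  proof -
    have "(\<phi> (f j) + 1) * n \<le> 3 * n" using fn[of j] by (intro mult_right_mono) auto
    then have "\<phi> (f j) * n + n \<le> 3 * n" by (simp only: add_mult_distrib mult_1)
    then show ?thesis using fn(1)[of j] by linarith
  qed
  then obtain g where g: "g < (3 * n) ^ 12" "\<forall>j<12. digit g j = \<phi> (f j) * n + f j"
    using ex_digits[of 12 "\<lambda>j. \<phi> (f j) * n + f j" "3 * n"] by (auto simp: digit_def)
  have d: "digit g j mod n = f j" "digit g j div n = \<phi> (f j)" if "j < 12" for j
    using g(2) that fn[of j] by simp_all
  have "guessed g 12 v c \<longleftrightarrow> (v \<in> \<Gamma> \<longrightarrow> \<phi> v = c)" for v c
    unfolding guessed_def using d f_in f_onto by metis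
  then have "guessed_lists g = guess \<Gamma> \<phi>"
    using \<Gamma>(1) \<phi> by (auto simp: guessed_lists_def guess_def fun_eq_iff)
  then show ?thesis using g(1) by blast
qed

text \<open>A value of at most \<open>n\<close> is not the start value, so some candidate that is
  proper on the component attained it.\<close>

lemma best_sound:
  "best lab g x \<le> n \<Longrightarrow> \<exists>c. proper_on {v. v < n \<and> lab v = x} c \<and> card {v. v < n \<and> lab v = x \<and> c v = 0} = best lab g x"
proof (induction g)
  case (Suc g)
  show ?case
  proof (cases "best lab (Suc g) x = best lab g x")
    case True
    then show ?thesis using Suc by simp
  next
    case False
    then have ok: "\<forall>v<n. lab v = x \<longrightarrow> \<not> clash (cand g) v"
      "best lab (Suc g) x = cnt (\<lambda>v. lab v = x \<and> cand g v = 0) n"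
      by (auto simp: improve_def split: if_splits)
    have "proper_on {v. v < n \<and> lab v = x} (cand g)"
      using ok(1) col_less unfolding proper_on_def clash_def cand_def by blast
    then show ?thesis using ok(2) unfolding cnt_def by (intro exI[of _ "cand g"]) simp
  qed
qed simp

lemma best_mono: "g \<le> g' \<Longrightarrow> best lab g' x \<le> best lab g x"
proof (induction g' rule: dec_induct)
  case (step g')
  then show ?case using improve_le[of lab "cand g'" x "best lab g' x"] by simp
qed simp

abbreviation opt :: "(nat \<Rightarrow> nat) \<Rightarrow> nat \<Rightarrow> nat" where
  "opt lab \<equiv> best lab ((3 * n) ^ 12)"

section \<open>Optima of the components and colourings of the whole graph\<close>

context
  fixes lab :: "nat \<Rightarrow> nat"
  assumes lab_edge: "u \<sim> v \<Longrightarrow> lab u = lab v" and lab_less: "v < n \<Longrightarrow> lab v < n"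
    and lab_path: "v < n \<Longrightarrow> (lab v, v) \<in> reach"
begin

lemma lab_reach: "(a, b) \<in> reach \<Longrightarrow> lab a = lab b"
proof (induction rule: rtrancl_induct)
  case (step y z)
  then have "lab y = lab z" by (intro lab_edge) simp
  then show ?case using step by simp
qed simp

lemma lab_lab: "v < n \<Longrightarrow> lab (lab v) = lab v"
  by (rule lab_reach[OF lab_path])

definition component :: "nat \<Rightarrow> nat set" where
  "component x = {v. v < n \<and> lab v = x}"

lemma component_closed: "u \<in> component x \<Longrightarrow> u \<sim> v \<Longrightarrow> v \<in> component x"
  using lab_edge[of u v] adj_less[OF adj_sym, of u v] by (simp add: component_def)

text \<open>A part that no edge leaves contains both ends or neither end of every walk, and a walk
  joins each vertex of the component to its label \<open>x\<close>.\<close>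

lemma component_conn:
  assumes "x < n" "lab x = x"
  shows "conn (component x)"
  unfolding conn_def
proof (intro conjI allI impI)
  show "component x \<noteq> {}" using assms by (auto simp: component_def)
  fix C assume C: "C \<subseteq> component x" "C \<noteq> {}" "C \<noteq> component x"
  show "\<exists>u\<in>C. \<exists>v\<in>component x - C. u \<sim> v"
  proof (rule ccontr)
    assume no: "\<not> ?thesis"
    have step: "a \<in> C \<longleftrightarrow> b \<in> C" if "a \<sim> b" for a b
      using no C(1) component_closed[of a x b] component_closed[of b x a] that adj_sym[OF that] by blast
    have "a \<in> C \<longleftrightarrow> b \<in> C" if "(a, b) \<in> reach" for a b
      using that by (induction rule: rtrancl_induct) (use step in auto)
    then have "v \<in> C \<longleftrightarrow> x \<in> C" if "v \<in> component x" for v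
      using that lab_path[of v] by (auto simp: component_def)
    then show False using C by blast
  qed
qed

text \<open>The good guess for \<open>\<phi>\<close> is some counter value \<open>g\<close>. Its
  candidate is proper on the component and no dearer than \<open>\<phi>\<close>, it is taken into
  account in \<open>best lab (Suc g)\<close>, and later rounds only lower the value.\<close>

lemma best_complete:
  assumes x: "x < n" "lab x = x" and \<phi>: "proper_on (component x) \<phi>"
  shows "opt lab x \<le> card {v \<in> component x. \<phi> v = 0}"
proof -
  have "finite (component x)" by (simp add: component_def)
  then have "\<exists>\<Gamma>\<subseteq>component x. \<Gamma> \<noteq> {} \<and> card \<Gamma> \<le> 12 \<and> (\<forall>L. is_closure (guess \<Gamma> \<phi>) L \<longrightarrow>
      proper_on (component x) (col L) \<and> card {v \<in> component x. col L v = 0} \<le> card {v \<in> component x. \<phi> v = 0})"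
    by (rule ex_good_guess[OF _ component_conn[OF x] _ \<phi>]) (rule component_closed)
  then obtain \<Gamma> where \<Gamma>: "\<Gamma> \<subseteq> component x" "\<Gamma> \<noteq> {}" "card \<Gamma> \<le> 12"
    "\<And>L. is_closure (guess \<Gamma> \<phi>) L \<Longrightarrow> proper_on (component x) (col L) \<and>
      card {v \<in> component x. col L v = 0} \<le> card {v \<in> component x. \<phi> v = 0}"
    by blast
  obtain g where g: "g < (3 * n) ^ 12" "guessed_lists g = guess \<Gamma> \<phi>"
    using ex_guess_code[of \<Gamma> \<phi>] \<Gamma>(1-3) \<phi> by (auto simp: component_def proper_on_def subset_iff)
  obtain L where L: "is_closure (guess \<Gamma> \<phi>) L" using ex_closure by blast
  have c: "cand g = col L" using cand_closure[of g L] g(2) L by simp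
  have pr: "proper_on (component x) (cand g)" and le: "card {v \<in> component x. cand g v = 0} \<le> card {v \<in> component x. \<phi> v = 0}"
    using \<Gamma>(4)[OF L] c by simp_all
  have ok: "\<not> clash (cand g) v" if "v < n" "lab v = x" for v
    using pr component_closed[of v x] that by (auto simp: clash_def proper_on_def component_def)
  have "cnt (\<lambda>v. lab v = x \<and> cand g v = 0) n = card {v \<in> component x. cand g v = 0}"
    by (simp add: cnt_def component_def conj_assoc)
  moreover have "best lab (Suc g) x \<le> cnt (\<lambda>v. lab v = x \<and> cand g v = 0) n"
    using ok by (simp add: improve_def)
  moreover have "opt lab x \<le> best lab (Suc g) x" by (rule best_mono) (use g(1) in simp)
  ultimately show ?thesis using le by linarith
qed

definition reps :: "nat set" where
  "reps = {x. x < n \<and> lab x = x}"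

lemma card_by_component: "card {v. v < n \<and> P v} = (\<Sum>x\<in>reps. card {v \<in> component x. P v})"
proof -
  have "lab ` {v. v < n \<and> P v} \<subseteq> reps" using lab_lab lab_less by (auto simp: reps_def)
  then have "card {v. v < n \<and> P v} = (\<Sum>x\<in>reps. card {v \<in> {v. v < n \<and> P v}. lab v = x})"
    using sum.group[of "{v. v < n \<and> P v}" reps lab "\<lambda>_. 1::nat"] by (simp add: reps_def)
  also have "\<dots> = (\<Sum>x\<in>reps. card {v \<in> component x. P v})"
    by (intro sum.cong refl arg_cong[of _ _ card]) (auto simp: component_def)
  finally show ?thesis .
qed

lemma best_le_colouring:
  assumes "proper_on {..<n} \<phi>"
  shows "x \<in> reps \<Longrightarrow> opt lab x \<le> card {v \<in> component x. \<phi> v = 0}"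
    "(\<Sum>x\<in>reps. opt lab x) \<le> card {v. v < n \<and> \<phi> v = 0}"
proof -
  have *: "opt lab x \<le> card {v \<in> component x. \<phi> v = 0}" if "x \<in> reps" for x
    using best_complete[of x \<phi>] that assms by (auto simp: reps_def component_def proper_on_def)
  then show "x \<in> reps \<Longrightarrow> opt lab x \<le> card {v \<in> component x. \<phi> v = 0}" .
  show "(\<Sum>x\<in>reps. opt lab x) \<le> card {v. v < n \<and> \<phi> v = 0}"
    unfolding card_by_component by (rule sum_mono) (rule *)
qed

text \<open>Optimal colourings of the components are glued along the labels; no edge joins different
  labels, and the costs add up.\<close>

lemma best_colouring:
  assumes "\<And>x. x \<in> reps \<Longrightarrow> opt lab x \<le> n"
  shows "\<exists>\<phi>. proper_on {..<n} \<phi> \<and> card {v. v < n \<and> \<phi> v = 0} = (\<Sum>x\<in>reps. opt lab x)"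
proof -
  have "\<forall>x\<in>reps. \<exists>c. proper_on (component x) c \<and> card {v \<in> component x. c v = 0} = opt lab x"
    using best_sound[of lab "(3 * n) ^ 12"] assms by (simp add: component_def conj_assoc)
  then obtain c where c: "\<And>x. x \<in> reps \<Longrightarrow> proper_on (component x) (c x)"
    "\<And>x. x \<in> reps \<Longrightarrow> card {v \<in> component x. c x v = 0} = opt lab x"
    by metis
  have rep: "lab v \<in> reps" "v \<in> component (lab v)" if "v < n" for v
    using lab_lab[OF that] lab_less[OF that] that by (simp_all add: reps_def component_def)
  have "proper_on {..<n} (\<lambda>v. c (lab v) v)"
    using c(1) rep lab_edge unfolding proper_on_def by (metis lessThan_iff)
  moreover have "card {v. v < n \<and> c (lab v) v = 0} = (\<Sum>x\<in>reps. opt lab x)"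
    unfolding card_by_component
  proof (rule sum.cong[OF refl])
    fix x assume x: "x \<in> reps"
    have "{v \<in> component x. c (lab v) v = 0} = {v \<in> component x. c x v = 0}" by (auto simp: component_def)
    then show "card {v \<in> component x. c (lab v) v = 0} = opt lab x" using c(2)[OF x] by simp
  qed
  ultimately show ?thesis by blast
qed

end

text \<open>The power is a single expression with twelve multiplications, so it has constant
  cost.\<close>

definition setup_prog :: prog where
  "setup_prog = Seq (Assign 1 (Op Mul (Const 3) (Reg 0))) (Seq (Assign 3 (Op Mul (Reg 0) (Reg 0)))
     (Seq (Assign 4 (((\<lambda>e. Op Mul e (Reg 1)) ^^ 12) (Const 1))) (Assign 6 (Const 12))))"

lemma ev_power: "ev (((\<lambda>e. Op Mul e (Reg 1)) ^^ k) (Const 1)) r M = r 1 ^ k"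
  by (induction k) (simp_all add: mult.commute)

lemma ft_power: "r 1 = 3 * n \<Longrightarrow> k \<le> 12 \<Longrightarrow> ft (((\<lambda>e. Op Mul e (Reg 1)) ^^ k) (Const 1)) r M"
proof (induction k)
  case 0
  then show ?case using W_small[of 1] by simp
next
  case (Suc k)
  have "ev (((\<lambda>e. Op Mul e (Reg 1)) ^^ k) (Const 1)) r M * r 1 < W"
    unfolding ev_power using W_literals[OF Suc.prems(2)] Suc.prems(1) by (simp only: power_Suc2)
  then show ?case using Suc n_W(2) by simp
qed

lemma cost_power: "expr_cost (((\<lambda>e. Op Mul e (Reg 1)) ^^ k) (Const 1)) = 2 * k + 1"
  by (induction k) simp_all

lemma hoare_setup: "hoare (state_at (\<lambda>r. r 0 = n) M0) setup_prog 100 (\<lambda>r M. base r \<and> M = M0)"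
proof (rule hoare_wp)
  fix r M assume "state_at (\<lambda>r. r 0 = n) M0 r M"
  then have a: "r 0 = n" "M = M0" by (simp_all add: state_at_def)
  have "3 < W" "12 < W" using W_quadratic by linarith+
  then show "wp W setup_prog (holds (\<lambda>r M. base r \<and> M = M0)) (st n r M)"
    using a n_W unfolding setup_prog_def
    by (simp add: ev_power[unfolded One_nat_def] ft_power[unfolded One_nat_def] holdsI base_def del: funpow.simps)
qed (simp add: setup_prog_def cost_power[unfolded One_nat_def] del: funpow.simps)

definition fin_step :: prog where
  "fin_step = Cond (Op Equal (rd 3 (Reg 10)) (Reg 10))
     (Cond (Op Less (Reg 0) (rd 4 (Reg 10))) (Assign 15 (Const 0)) (Assign 14 (Op Add (Reg 14) (rd 4 (Reg 10))))) Skip"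

definition fin_prog :: prog where
  "fin_prog = Seq (Seq (Assign 14 (Const 0)) (Assign 15 (Const 1)))
     (Seq (for_loop 10 0 fin_step) (Seq (Assign 1 (Reg 14)) (Assign 0 (Reg 15))))"

lemma hoare_fin:
  assumes M0: "\<And>v. v < n \<Longrightarrow> M0 (n + 3) v = lab v" "\<And>v. v < n \<Longrightarrow> lab v < n"
    "\<And>v. v < n \<Longrightarrow> M0 (n + 4) v = b v" "\<And>v. v < n \<Longrightarrow> b v \<le> n + 1"
  shows "hoare (state_at base M0) fin_prog (4 + (for_time n 300 + 4))
    (\<lambda>r M. r 0 = (if \<exists>x<n. lab x = x \<and> n < b x then 0 else 1) \<and>
      r 1 = (\<Sum>x | x < n \<and> lab x = x \<and> b x \<le> n. b x))"
  unfolding fin_prog_def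
proof (rule hoare_Seq[OF _ hoare_Seq])
  define s where "s i = (\<Sum>x | x < i \<and> lab x = x \<and> b x \<le> n. b x)" for i
  define bad where "bad i \<longleftrightarrow> (\<exists>x<i. lab x = x \<and> n < b x)" for i
  have s0: "s 0 = 0" "\<not> bad 0" by (simp_all add: s_def bad_def)
  have s_Suc: "s (Suc i) = s i + (if lab i = i \<and> b i \<le> n then b i else 0)" for i
  proof -
    have "{x. x < Suc i \<and> lab x = x \<and> b x \<le> n} = {x. x < i \<and> lab x = x \<and> b x \<le> n} \<union> (if lab i = i \<and> b i \<le> n then {i} else {})"
      by (auto simp: less_Suc_eq)
    then show ?thesis by (simp add: s_def)
  qed
  have bad_Suc: "bad (Suc i) \<longleftrightarrow> bad i \<or> lab i = i \<and> n < b i" for i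
    by (auto simp: bad_def less_Suc_eq)
  have s_le: "s i \<le> i * n" for i
    by (induction i) (auto simp: s0 s_Suc)
  have sW: "s i < W" if "i \<le> n" for i
    using s_le[of i] mult_right_mono[OF that, of n] n_W(3) by linarith
  let ?J = "\<lambda>i r M. base r \<and> M = M0 \<and> r 14 = s i \<and> r 15 = (if bad i then 0 else 1)"
  have W': "0 < W" "Suc 0 < W" "n < W" using n_W by linarith+
  show "hoare (state_at base M0) (Seq (Assign 14 (Const 0)) (Assign 15 (Const 1))) 4 (?J 0)"
    using W' by (intro hoare_wp) (simp_all add: state_at_def holdsI s0)
  show "hoare (?J 0) (for_loop 10 0 fin_step) (for_time n 300) (?J n)"
  proof (rule hoare_for[where I = ?J])
    fix i assume i: "i < n"
    show "hoare (\<lambda>r M. ?J i r M \<and> r 10 = i) fin_step 300 (\<lambda>r M. ?J (Suc i) r M \<and> r 10 = i)"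
    proof (rule hoare_wp)
      fix r M assume a: "?J i r M \<and> r 10 = i"
      have "lab i < W" "b i < W" "s i < W" using M0(2)[OF i] M0(4)[OF i] W_quadratic sW[of i] i by linarith+
      moreover have "b i \<le> n \<Longrightarrow> s i + b i < W" if "lab i = i" using sW[of "Suc i"] s_Suc[of i] i that by simp
      ultimately show "wp W fin_step (holds (\<lambda>r M. ?J (Suc i) r M \<and> r 10 = i)) (st n r M)"
        using a i W' base_0[of r] M0(1)[OF i] M0(3)[OF i] unfolding fin_step_def
        by (simp add: holdsI s_Suc bad_Suc)
    qed (simp add: fin_step_def)
  qed (simp_all add: n_W base_0)
  show "hoare (?J n) (Seq (Assign 1 (Reg 14)) (Assign 0 (Reg 15))) 4
    (\<lambda>r M. r 0 = (if \<exists>x<n. lab x = x \<and> n < b x then 0 else 1) \<and> r 1 = (\<Sum>x | x < n \<and> lab x = x \<and> b x \<le> n. b x))"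
    unfolding s_def[symmetric] bad_def[symmetric]
    using W' sW[of n] by (intro hoare_wp) (simp_all add: holdsI)
qed

definition solve :: prog where
  "solve = Seq setup_prog (Seq lab_init (Seq lab_prog (Seq (for_loop 2 4 body) fin_prog)))"

definition solve_time :: nat where
  "solve_time = 100 + (for_time n 300 + (lab_time + (for_time ((3 * n) ^ 12) body_time + (4 + (for_time n 300 + 4)))))"

text \<open>The labelling stays existential: what follows needs only that it is constant along edges
  and picks a vertex of each component.\<close>

definition solved :: assertion where
  "solved r M \<longleftrightarrow> (\<exists>lab. (\<forall>u v. u \<sim> v \<longrightarrow> lab u = lab v) \<and> (\<forall>v<n. lab v < n) \<and>
     (\<forall>v<n. (lab v, v) \<in> reach) \<and>
     r 0 = (if \<exists>x<n. lab x = x \<and> n < opt lab x then 0 else 1) \<and>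
     r 1 = (\<Sum>x | x < n \<and> lab x = x \<and> opt lab x \<le> n. opt lab x))"

lemma hoare_solve:
  assumes M0: "graph_rows M0"
  shows "hoare (state_at (\<lambda>r. r 0 = n) M0) solve solve_time solved"
  unfolding solve_def solve_time_def
proof (rule hoare_Seq[OF hoare_setup], fold state_at_def, rule hoare_Seq_at[OF hoare_lab_init])
  fix M1 assume M1: "frame {n + 3, n + 4} M1 M0 \<and> (\<forall>v<n. M1 (n + 3) v = v \<and> M1 (n + 4) v = n + 1)"
  have "graph_rows M1" by (rule graph_rows_frame[OF conjunct1[OF M1] _ M0]) auto
  then have wf1: "lab_wf M1" using M1 by (simp add: lab_wf_def)
  define lab where "lab = relabel M1 (n + 3)"
  have wf2: "lab_wf (relabel M1)" by (rule relabel_wf[OF wf1])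
  have lab: "lab v < n" "(lab v, v) \<in> reach" if "v < n" for v
    using wf2 that by (simp_all add: lab_wf_def lab_def)
  have edge: "lab u = lab v" if "u \<sim> v" for u v unfolding lab_def by (rule relabel_edge[OF wf1 that])
  have g2: "graph_rows (relabel M1)" using wf2 by (simp add: lab_wf_def)
  have b2: "relabel M1 (n + 4) v = n + 1" if "v < n" for v
    using frameD[OF relabel_frame, of "n + 4" M1] M1 that by simp
  have l2: "relabel M1 (n + 3) v = lab v" for v by (simp add: lab_def)
  have labels: "hoare (state_at base M1) lab_prog lab_time (\<lambda>r M. base r \<and> M = relabel M1)"
    using hoare_lab[OF wf1] unfolding state_at_def .
  show "hoare (state_at base M1) (Seq lab_prog (Seq (for_loop 2 4 body) fin_prog))
      (lab_time + (for_time ((3 * n) ^ 12) body_time + (4 + (for_time n 300 + 4)))) solved"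
  proof (rule hoare_Seq_at[OF labels], elim ssubst, rule hoare_Seq_at[OF hoare_main[OF g2 l2 lab(1) b2]])
    fix M3 assume M3: "frame ({n..<n + 8} - {n + 3}) M3 (relabel M1) \<and> (\<forall>x<n. M3 (n + 4) x = opt lab x)"
    have l3: "M3 (n + 3) v = lab v" for v using frameD[OF conjunct1[OF M3], of "n + 3"] l2 by simp
    have b3: "M3 (n + 4) v = opt lab v" if "v < n" for v using M3 that by blast
    show "hoare (state_at base M3) fin_prog (4 + (for_time n 300 + 4)) solved"
      by (rule hoare_conseq[OF hoare_fin[OF l3 lab(1) b3 best_le]]) (use lab edge in \<open>auto simp: solved_def intro!: exI[of _ lab]\<close>)
  qed
qed

end

text \<open>An explicit expression in \<open>n\<close> for the asymptotic analysis. The leading term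
  is the number \<open>(3 * n) ^ 12\<close> of guesses times the \<open>3 * n\<close> passes over
  \<open>n^3\<close> triples in propagation.\<close>

lemma (in solver) solve_time_unfold:
  "solve_time = (let f = (\<lambda>N T. (N + 1) * (T + 8)); u = f n 300; v = 2 + u + 300; b = f n v in
     100 + (u + (f (n * n) (f n u) + (f ((3 * n) ^ 12) (u + (2 + f 12 300 + (f (3 * n) (f n (f n u)) +
       (u + (f n (2 + (b + 300)) + (b + f n (4 + (b + 300)))))))) + (4 + (u + 4))))))"
  unfolding solve_time_def lab_time_def body_time_def flag_time_def prop_time_def for_time_def Let_def ..

text \<open>The running time does not depend on the graph, so the edgeless one provides the locale.\<close>

lemma solve_time_bigo: "(\<lambda>n. real (solver.solve_time n)) \<in> O(\<lambda>n. real n ^ 16)"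
proof -
  have "solver (\<lambda>_ _. False) n ((n + 2) ^ 40)" for n by unfold_locales auto
  note eq = solver.solve_time_unfold[OF this]
  show ?thesis unfolding eq Let_def of_nat_add of_nat_mult of_nat_power of_nat_numeral of_nat_1
    by real_asymp
qed

section \<open>From graphs to adjacency relations, from transversals to colourings\<close>

lemma simple_graph_edges:
  assumes "simple_graph {..<n} E" "{u, v} \<in> E"
  shows "u < n" "v < n" "u \<noteq> v"
proof -
  have "{u, v} \<subseteq> {..<n}" "card {u, v} = 2" using assms unfolding simple_graph_def by blast+
  then show "u < n" "v < n" "u \<noteq> v" by auto
qed

lemma induced_P5:
  assumes E: "simple_graph V E" and V: "{a, b, c, d, e} \<subseteq> V" and dist: "distinct [a, b, c, d, e]"
    and edges: "{a, b} \<in> E" "{b, c} \<in> E" "{c, d} \<in> E" "{d, e} \<in> E"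
    and non: "{a, c} \<notin> E" "{a, d} \<notin> E" "{a, e} \<notin> E" "{b, d} \<notin> E" "{b, e} \<notin> E" "{c, e} \<notin> E"
  shows "\<not> P5_free V E"
proof -
  let ?U = "{a, b, c, d, e}"
  define f where "f x = (if x = a then 0 else if x = b then 1 else if x = c then 2 else if x = d then 3 else 4::nat)" for x
  have f: "f a = 0" "f b = 1" "f c = 2" "f d = 3" "f e = 4" using dist by (auto simp: f_def)
  have "bij_betw f ?U {..<5}"
  proof (rule bij_betw_imageI)
    show "inj_on f ?U" unfolding inj_on_def using f by auto
    have "{..<5} = {0, 1, 2, 3, 4::nat}" by auto
    then show "f ` ?U = {..<5}" using f by simp
  qed
  moreover have "{u, v} \<in> induced_edges E ?U \<longleftrightarrow> {f u, f v} \<in> path_edges 5" if uv: "u \<in> ?U" "v \<in> ?U" for u v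
  proof -
    have loop: "{x} \<notin> E" for x
    proof
      assume "{x} \<in> E"
      then have "card {x} = 2" using E unfolding simple_graph_def by blast
      then show False by simp
    qed
    have p: "{i, j} \<in> path_edges 5 \<longleftrightarrow> i < 5 \<and> j < 5 \<and> (j = Suc i \<or> i = Suc j)" for i j
      by (auto simp: path_edges_def doubleton_eq_iff)
    have "{u, v} \<in> E \<longleftrightarrow> f v = Suc (f u) \<or> f u = Suc (f v)"
      using uv edges non loop f insert_commute[of b a "{}"] insert_commute[of c b "{}"] insert_commute[of d c "{}"]
        insert_commute[of e d "{}"] insert_commute[of c a "{}"] insert_commute[of d a "{}"] insert_commute[of e a "{}"]
        insert_commute[of d b "{}"] insert_commute[of e b "{}"] insert_commute[of e c "{}"]
      by (elim insertE emptyE; simp)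
    moreover have "f u < 5" "f v < 5" by (simp_all add: f_def)
    moreover have "{u, v} \<subseteq> ?U" using uv by blast
    ultimately show ?thesis unfolding p induced_edges_def by blast
  qed
  ultimately have "graph_isomorphic ?U (induced_edges E ?U) {..<5} (path_edges 5)"
    unfolding graph_isomorphic_def by blast
  then show ?thesis using V unfolding P5_free_def by blast
qed

lemma P5_free_adjI:
  assumes E: "simple_graph {..<n} E" and P: "P5_free {..<n} E"
  shows "P5_free_adj (\<lambda>u v. {u, v} \<in> E) n"
proof
  fix u v assume "{u, v} \<in> E" then show "{v, u} \<in> E" by (simp add: insert_commute)
next
  fix u show "{u, u} \<notin> E" using simple_graph_edges[OF E, of u u] by auto
next
  fix u v assume "{u, v} \<in> E" then show "u < n" using simple_graph_edges[OF E] by blast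
next
  fix a b c d e
  assume edges: "{a, b} \<in> E" "{b, c} \<in> E" "{c, d} \<in> E" "{d, e} \<in> E"
    and non: "{a, c} \<notin> E" "{a, d} \<notin> E" "{a, e} \<notin> E" "{b, d} \<notin> E" "{b, e} \<notin> E" "{c, e} \<notin> E"
  \<comment> \<open>Adjacent vertices differ since there are no loops. Any other two of the five are
    told apart by a third vertex that is adjacent to exactly one of them.\<close>
  have "distinct [a, b, c, d, e]"
    using edges non simple_graph_edges(3)[OF E edges(1)] simple_graph_edges(3)[OF E edges(2)]
      simple_graph_edges(3)[OF E edges(3)] simple_graph_edges(3)[OF E edges(4)]
    by (auto simp: insert_commute)
  moreover have "{a, b, c, d, e} \<subseteq> {..<n}"
    using simple_graph_edges(1,2)[OF E edges(1)] simple_graph_edges(1,2)[OF E edges(3)] simple_graph_edges(2)[OF E edges(4)]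
    by simp
  ultimately show False using induced_P5[OF E] edges non P by blast
qed

lemma oct_colouring:
  assumes E: "simple_graph {..<n} E" and S: "independent_oct {..<n} E S"
  shows "\<exists>\<phi>. (\<forall>v<n. \<phi> v < (3::nat)) \<and> (\<forall>u v. {u, v} \<in> E \<longrightarrow> \<phi> u \<noteq> \<phi> v) \<and> {v. v < n \<and> \<phi> v = 0} = S"
proof -
  have S': "S \<subseteq> {..<n}" "\<And>e. e \<in> E \<Longrightarrow> \<not> e \<subseteq> S" and "bipartite ({..<n} - S) (induced_edges E ({..<n} - S))"
    using S by (simp_all add: independent_oct_def odd_cycle_transversal_def independent_set_def)
  then obtain A B where AB: "A \<union> B = {..<n} - S" "\<And>e. e \<in> induced_edges E ({..<n} - S) \<Longrightarrow> \<not> e \<subseteq> A"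
    "\<And>e. e \<in> induced_edges E ({..<n} - S) \<Longrightarrow> \<not> e \<subseteq> B"
    by (auto simp: bipartite_def independent_set_def)
  define \<phi> where "\<phi> v = (if v \<in> S then 0 else if v \<in> A then 1 else 2::nat)" for v
  have "\<phi> u \<noteq> \<phi> v" if e: "{u, v} \<in> E" for u v
  proof
    assume eq: "\<phi> u = \<phi> v"
    have "u < n" "v < n" using simple_graph_edges[OF E e] by auto
    then have "{u, v} \<subseteq> S \<or> {u, v} \<subseteq> A \<or> {u, v} \<subseteq> B" using eq AB(1) by (auto simp: \<phi>_def split: if_splits)
    moreover have "{u, v} \<in> induced_edges E ({..<n} - S)" if "{u, v} \<subseteq> A \<or> {u, v} \<subseteq> B"
      using that e AB(1) unfolding induced_edges_def by blast
    ultimately show False using S'(2)[OF e] AB(2,3) by blast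
  qed
  moreover have "{v. v < n \<and> \<phi> v = 0} = S" using S'(1) by (auto simp: \<phi>_def)
  ultimately show ?thesis by (intro exI[of _ \<phi>]) (simp add: \<phi>_def)
qed

lemma colouring_oct:
  fixes \<phi> :: "nat \<Rightarrow> nat"
  assumes E: "simple_graph {..<n} E" and \<phi>: "\<And>v. v < n \<Longrightarrow> \<phi> v < 3" "\<And>u v. {u, v} \<in> E \<Longrightarrow> \<phi> u \<noteq> \<phi> v"
  shows "independent_oct {..<n} E {v. v < n \<and> \<phi> v = 0}"
proof -
  have ind: "\<not> e \<subseteq> {v. v < n \<and> \<phi> v = c}" if "e \<in> E" for e c
  proof
    assume sub: "e \<subseteq> {v. v < n \<and> \<phi> v = c}"
    have "card e = 2" using E that by (simp add: simple_graph_def)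
    then obtain u v where "e = {u, v}" by (auto simp: card_2_iff)
    then show False using \<phi>(2)[of u v] sub that by auto
  qed
  let ?C = "\<lambda>c. {v. v < n \<and> \<phi> v = c}"
  have "\<phi> v \<noteq> 0 \<longleftrightarrow> \<phi> v = 1 \<or> \<phi> v = 2" if "v < n" for v using \<phi>(1)[OF that] by linarith
  then have "?C 1 \<union> ?C 2 = {..<n} - ?C 0" by blast
  moreover have "?C 1 \<inter> ?C 2 = {}" by auto
  ultimately show ?thesis
    using ind unfolding independent_oct_def odd_cycle_transversal_def bipartite_def independent_set_def induced_edges_def
    by (intro conjI exI[of _ "?C 1"] exI[of _ "?C 2"]) auto
qed

theorem theorem5:
  "\<exists>(p :: prog) (k :: nat) (T :: nat \<Rightarrow> nat).
     (\<lambda>n. real (T n)) \<in> O(\<lambda>n. real n ^ 16) \<and>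
     (\<forall>(n :: nat) (E :: nat set set).
        simple_graph {..<n} E \<and> P5_free {..<n} E \<longrightarrow>
        (\<exists>t s. exec ((n + 2) ^ k) p (input_state n E) t s \<and> t \<le> T n \<and>
               output_of s = min_independent_oct_size {..<n} E))"
proof (rule exI[of _ solver.solve], rule exI[of _ 40], rule exI[of _ solver.solve_time], intro conjI allI impI)
  show "(\<lambda>n. real (solver.solve_time n)) \<in> O(\<lambda>n. real n ^ 16)" by (rule solve_time_bigo)
  fix n :: nat and E :: "nat set set"
  assume "simple_graph {..<n} E \<and> P5_free {..<n} E"
  then have E: "simple_graph {..<n} E" and P: "P5_free {..<n} E" by auto
  interpret solver "\<lambda>u v. {u, v} \<in> E" n "(n + 2) ^ 40"
    by (rule solver.intro[OF P5_free_adjI[OF E P] ram.intro[OF order_refl]])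
  define r0 where "r0 x = (if x = 0 then n else 0)" for x :: nat
  define M0 where "M0 u v = (if u < n \<and> {u, v} \<in> E then 1 else 0 :: nat)" for u v
  \<comment> \<open>The bound on input addresses becomes a bound on rows; for \<open>n = 0\<close>
    both sides are false.\<close>
  have "a < n * n \<longleftrightarrow> a div n < n" for a
    by (cases "n = 0") (simp_all add: less_mult_imp_div_less div_less_iff_less_mult)
  then have input: "input_state n E = st n r0 M0"
    by (simp add: input_state_def st_def r0_def M0_def fun_eq_iff)
  have "graph_rows M0" by (simp add: graph_rows_def M0_def)
  moreover have "state_at (\<lambda>r. r 0 = n) M0 r0 M0" by (simp add: state_at_def r0_def)
  ultimately obtain t r M where run: "exec ((n + 2) ^ 40) solver.solve (input_state n E) t (st n r M)" "t \<le> solver.solve_time n"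
    and "solved r M"
    using hoare_solve[of M0] unfolding hoare_def input by blast
  then obtain lab where lab: "\<And>u v. {u, v} \<in> E \<Longrightarrow> lab u = lab v" "\<And>v. v < n \<Longrightarrow> lab v < n"
    "\<And>v. v < n \<Longrightarrow> (lab v, v) \<in> {(a, b). {a, b} \<in> E}\<^sup>*"
    and r: "r 0 = (if \<exists>x<n. lab x = x \<and> n < opt lab x then 0 else 1)"
      "r 1 = (\<Sum>x | x < n \<and> lab x = x \<and> opt lab x \<le> n. opt lab x)"
    unfolding solved_def by blast
  let ?b = "opt lab"
  have reps: "reps lab = {x. x < n \<and> lab x = x}" by (rule reps_def[OF lab])
  have proper: "proper_on {..<n} \<phi>" if "\<forall>v<n. \<phi> v < 3" "\<forall>u v. {u, v} \<in> E \<longrightarrow> \<phi> u \<noteq> \<phi> v" for \<phi>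
    using that by (simp add: proper_on_def)
  have "output_of (st n r M) = min_independent_oct_size {..<n} E"
  \<comment> \<open>A component whose value exceeds \<open>n\<close> has no proper colouring with
    three colours, which rules out every independent transversal.\<close>
  proof (cases "\<exists>x<n. lab x = x \<and> n < ?b x")
    case True
    then obtain x where x: "x \<in> reps lab" "n < ?b x" unfolding reps by blast
    have "\<not> independent_oct {..<n} E S" for S
    proof
      assume "independent_oct {..<n} E S"
      then obtain \<phi> where \<phi>: "\<forall>v<n. \<phi> v < (3::nat)" "\<forall>u v. {u, v} \<in> E \<longrightarrow> \<phi> u \<noteq> \<phi> v" using oct_colouring[OF E] by blast
      have "?b x \<le> card {v \<in> component lab x. \<phi> v = 0}"
        by (rule best_le_colouring(1)[OF lab proper[OF \<phi>] x(1)])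
      also have "\<dots> \<le> card {..<n}" by (intro card_mono) (auto simp: component_def[OF lab])
      finally show False using x(2) by simp
    qed
    then show ?thesis using True r(1) by (simp add: output_of_def min_independent_oct_size_def st_def)
  next
    case False
    then have le: "?b x \<le> n" if "x \<in> reps lab" for x using that unfolding reps by (auto simp: not_less)
    obtain \<phi> where \<phi>: "proper_on {..<n} \<phi>" "card {v. v < n \<and> \<phi> v = 0} = (\<Sum>x\<in>reps lab. ?b x)"
      using best_colouring[OF lab le] by blast
    let ?S = "{v. v < n \<and> \<phi> v = 0}"
    have "\<phi> u \<noteq> \<phi> v" if "{u, v} \<in> E" for u v
      using \<phi>(1) that simple_graph_edges[OF E that] unfolding proper_on_def by blast
    then have S: "independent_oct {..<n} E ?S"
      using \<phi>(1) by (intro colouring_oct[OF E]) (auto simp: proper_on_def)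
    have "Min (card ` {S. independent_oct {..<n} E S}) = (\<Sum>x\<in>reps lab. ?b x)"
    proof (rule Min_eqI)
      have "{S. independent_oct {..<n} E S} \<subseteq> Pow {..<n}"
        by (auto simp: independent_oct_def independent_set_def)
      then show "finite (card ` {S. independent_oct {..<n} E S})" by (meson finite_Pow_iff finite_imageI finite_lessThan finite_subset)
      show "(\<Sum>x\<in>reps lab. ?b x) \<in> card ` {S. independent_oct {..<n} E S}" using S \<phi>(2) by (metis imageI mem_Collect_eq)
      fix y assume "y \<in> card ` {S. independent_oct {..<n} E S}"
      then obtain S where y: "y = card S" "independent_oct {..<n} E S" by blast
      then obtain \<psi> where \<psi>: "\<forall>v<n. \<psi> v < (3::nat)" "\<forall>u v. {u, v} \<in> E \<longrightarrow> \<psi> u \<noteq> \<psi> v" "{v. v < n \<and> \<psi> v = 0} = S"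
        using oct_colouring[OF E] by blast
      show "(\<Sum>x\<in>reps lab. ?b x) \<le> y" using best_le_colouring(2)[OF lab proper[OF \<psi>(1,2)]] unfolding \<psi>(3) y(1) .
    qed
    moreover have "{x. x < n \<and> lab x = x \<and> ?b x \<le> n} = reps lab" using le unfolding reps by blast
    then have "r 0 = 1" "r 1 = (\<Sum>x\<in>reps lab. ?b x)" using r False by simp_all
    ultimately show ?thesis using S by (auto simp: output_of_def min_independent_oct_size_def st_def)
  qed
  then show "\<exists>t s. exec ((n + 2) ^ 40) solver.solve (input_state n E) t s \<and> t \<le> solver.solve_time n \<and>
      output_of s = min_independent_oct_size {..<n} E"
    using run by blast
qed

end
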